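(* Let $N$ be a positive integer, let $\chi$ be a Dirichlet character modulo $N$, and let $\chi'$ denote either $\chi\chi_\theta$ or $\chi\chi_\eta$ (characters of $\widetilde\Gamma_0(N)$). Let $\ell$ be a prime, $M$ a positive integer and $\beta\in\mathbb{Q}$. Let $f$ be a weakly holomorphic modular form and let $\phi$ be a weakly holomorphic Jacobi form (of some weight $k\in\frac12\mathbb{Z}$ and index $m\in\mathbb{C}$) with possible singularities at $\mathbb{Z}+\tau\mathbb{Z}$ for $\widetilde\Gamma_0(N)$ and character $\chi'$ (regarded as a character of $\widetilde\Gamma_0(N)\ltimes \mathrm{H}(\mathbb{Z})$ trivial on $\mathrm{H}(\mathbb{Z})$). If $f$ has a Ramanujan-type congruence modulo $\ell$ on $M\mathbb{Z}+\beta$ explained by $\phi$, then $f$ has explainable Ramanujan-type congruences modulo $\ell$ on $M\mathbb{Z}+u^2\beta$ for all $u\in\mathbb{Z}$ with $\gcd(M,u)=1$.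
   Context: Notation: $e(z)=\exp(2\pi i z)$, $\mathbb{H}$ is the upper half plane. $\mathrm{Mp}_1(\mathbb{R})$ is the set of pairs $(\gamma,\omega)$ with $\gamma=\begin{psmatrix}a&b\\c&d\end{psmatrix}\in\mathrm{SL}_2(\mathbb{R})$ and $\omega$ a holomorphic square root of $c\tau+d$ on $\mathbb{H}$, with product $(\gamma_1,\omega_1)(\gamma_2,\omega_2)=(\gamma_1\gamma_2,(\omega_1\circ\gamma_2)\omega_2)$; it acts on $\mathbb{H}$ via $\gamma$ by Möbius transformations. $\mathrm{Mp}_1(\mathbb{Z})$ and $\widetilde\Gamma_0(N)$ are the preimages of $\mathrm{SL}_2(\mathbb{Z})$ and $\Gamma_0(N)$. A Dirichlet character $\chi$ mod $N$ is viewed as the character $((a\ b;c\ d),\omega)\mapsto\chi(d)$ of $\widetilde\Gamma_0(N)$. The weight $k$ slash action is $(f|_k(\gamma,\omega))(\tau)=\omega(\tau)^{-2k}f(\gamma\tau)$. $\chi_\theta$ is the character of $\widetilde\Gamma_0(4)$ with $\theta|_{1/2}g=\chi_\theta(g)\theta$ for $\theta(\tau)=\sum_{n\in\mathbb{Z}}e(n^2\tau)$, and $\chi_\eta$ the character of $\mathrm{Mp}_1(\mathbb{Z})$ with $\eta|_{1/2}g=\chi_\eta(g)\eta$ for the Dedekind eta function $\eta(\tau)=e(\tau/24)\prod_{n\ge1}(1-e(n\tau))$. Weakly holomorphic modular forms: for a finite index $\Gamma\subseteq\mathrm{Mp}_1(\mathbb{Z})$ and a character $\chi$ of $\Gamma$,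 a holomorphic $f:\mathbb{H}\to\mathbb{C}$ with $f|_k g=\chi(g)f$ for $g\in\Gamma$ and such that for some $a\in\mathbb{R}$, $|(f|_k g)(\tau)|\ll\exp(a\,\mathrm{Im}\tau)$ as $\mathrm{Im}\tau\to\infty$ for all $g\in\mathrm{Mp}_1(\mathbb{Z})$. It has a Fourier expansion $f=\sum_{n\in\mathbb{Q}}c(f;n)e(n\tau)$. Integrality: all Fourier coefficients considered lie in a fixed number field $K\subset\mathbb{C}$; fix a prime ideal $\mathfrak{l}$ of $\mathcal{O}_K$ above the prime $\ell$ and let $\mathcal{O}_{K,\mathfrak{l}}$ be the localization. "$\ell$-integral" means lying in $\mathcal{O}_{K,\mathfrak{l}}$, and "$\equiv0\pmod\ell$" means lying in $\ell\mathcal{O}_{K,\mathfrak{l}}$. $f$ has a Ramanujan-type congruence modulo $\ell$ on $M\mathbb{Z}+\beta$ if $c(f;n)\equiv0\pmod\ell$ for all $n\in M\mathbb{Z}+\beta$. Jacobi forms: $\mathrm{H}(\mathbb{R})$ is the Heisenberg group of triples $(\lambda,\mu,\kappa)$, $\mathrm{H}(\mathbb{Z})$ its integral points; one writes $(\lambda,\mu)$ for $(\lambda,\mu,0)$. The weight $k$, index $m$ slash action is $(\phi|_{k,m}(\gamma,\omega))(\tau,z)=\omega(\tau)^{-2k}e\big(\frac{-mcz^2}{c\tau+d}\big)\phi\big(\gamma\tau,\frac{z}{c\tau+d}\big)$ and $(\phi|_{k,m}(\lambda,\mu,\kappa))(\tau,z)=e(m(\lambda^2\tau+2\lambda z+\kappa))\phi(\tau,z+\lambda\tau+\mu)$.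 For finite index $\Gamma\subseteq\mathrm{Mp}_1(\mathbb{Z})$ and a character $\chi$ of $\Gamma\ltimes\mathrm{H}(\mathbb{Z})$, a weakly holomorphic Jacobi form of weight $k$ and index $m$ for $\chi$ with singularities at torsion points is a meromorphic $\phi:\mathbb{H}\times\mathbb{C}\to\mathbb{C}$ such that (i) for some $N'\ge1$, $\phi$ is regular outside $z\in\frac1{N'}(\mathbb{Z}+\tau\mathbb{Z})$, (ii) $\phi|_{k,m}g=\chi(g)\phi$ for all $g\in\Gamma\ltimes\mathrm{H}(\mathbb{Z})$, (iii) for some $a\in\mathbb{R}$, $|(\phi|_{k,m}g)(\tau,z)|\ll\exp(a\,\mathrm{Im}\tau)$ as $\mathrm{Im}\tau\to\infty$ for all $g\in\mathrm{Mp}_1(\mathbb{Z})$ and all $z\in\mathbb{Q}+\gamma\tau\mathbb{Q}$ at which it is regular. It has possible singularities at $\mathbb{Z}+\tau\mathbb{Z}$ if it is regular outside $z\in\mathbb{Z}+\tau\mathbb{Z}$. Its Fourier expansion $\phi=\sum_{n,r\in\mathbb{Q}}c(\phi;n,r)e(n\tau+rz)$ is valid for $0<\mathrm{Im}z/\mathrm{Im}\tau$ sufficiently small; set $c(\phi;n;z)=\sum_r c(\phi;n,r)e(rz)$. If $-\nu$ is the order of $\phi$ at $z=0$, the leading Fourier coefficients are $\tilde c(\phi;n;z)=(e(z/2)-e(-z/2))^\nu c(\phi;n;z)$; these are Laurent polynomials in $e(z/N'')$ for $N''$ the level of the character, and divisibility statements refer to this Laurent polynomial ring. $\phi$ specializes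 to $f$ if $f(\tau)=\lim_{z\to0}(e(z/2)-e(-z/2))^\nu\phi(\tau,z)$. Explanation: $\phi$ with possible singularities at $\mathbb{Z}+\tau\mathbb{Z}$ specializing to $f$ explains the Ramanujan-type congruence modulo $\ell$ of $f$ on $M\mathbb{Z}+\beta$ if all $c(\phi;n,r)$ are $\ell$-integral and the $\ell$-th cyclotomic polynomial $\sum_{r=0}^{\ell-1}e(rz)$ in $e(z)$ divides $\tilde c(\phi;n;z)$ for all $n\in M\mathbb{Z}+\beta$. An explainable Ramanujan-type congruence is one explained by such a $\phi$.
   Formalization: Added: Z+β contains some n with c(f;n)≠0. Otherwise false: f=φ=θ, ℓ=M=3, β=1/4, u=2 (vacuous on 3Z+1/4, but c(θ;1)=2). The growth exponent a in (iii) may depend on the torsion point. *)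

theory Defs
  imports
    "HOL-Complex_Analysis.Complex_Analysis"
    "HOL-Algebra.Algebra"
    "HOL-Library.Poly_Mapping"
    "HOL-Library.Landau_Symbols"
begin

section \<open>The metaplectic group\<close>

definition e :: "complex \<Rightarrow> complex" where
  "e z = exp (2 * of_real pi * \<i> * z)"

definition uhp :: "complex set" where
  "uhp = {\<tau>. Im \<tau> > 0}"

definition auto_factor :: "real^2^2 \<Rightarrow> complex \<Rightarrow> complex" where
  "auto_factor A \<tau> = of_real (A$2$1) * \<tau> + of_real (A$2$2)"

definition moebius :: "real^2^2 \<Rightarrow> complex \<Rightarrow> complex" where
  "moebius A \<tau> = (of_real (A$1$1) * \<tau> + of_real (A$1$2)) / auto_factor A \<tau>"

type_synonym mp = "(real^2^2) \<times> (complex \<Rightarrow> complex)"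

text \<open>The square roots are functions on the upper half plane only; they are made total by
  requiring them to be \<^const>\<open>undefined\<close> elsewhere, so that equality of group elements is the
  intended one.\<close>

definition Mp1R :: "mp monoid" where
  "Mp1R = \<lparr>carrier = {(A, w). det A = 1 \<and> w \<in> extensional uhp \<and> w holomorphic_on uhp \<and>
                             (\<forall>\<tau>\<in>uhp. w \<tau> ^ 2 = auto_factor A \<tau>)},
           mult = (\<lambda>(A, w) (B, v). (A ** B, \<lambda>\<tau>\<in>uhp. w (moebius B \<tau>) * v \<tau>)),
           one = (mat 1, \<lambda>\<tau>\<in>uhp. 1)\<rparr>"

definition Mp1Z :: "mp monoid" where
  "Mp1Z = Mp1R\<lparr>carrier := {g \<in> carrier Mp1R. \<forall>i j. fst g $ i $ j \<in> \<int>}\<rparr>"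

definition Gamma0 :: "nat \<Rightarrow> mp set" where
  "Gamma0 N = {g \<in> carrier Mp1Z. \<exists>t. fst g $ 2 $ 1 = of_int (int N * t)}"

definition finite_index :: "mp set \<Rightarrow> bool" where
  "finite_index \<Gamma> \<longleftrightarrow> subgroup \<Gamma> Mp1Z \<and> finite (rcosets\<^bsub>Mp1Z\<^esub> \<Gamma>)"

definition complex_ring :: "complex ring" where
  "complex_ring = \<lparr>carrier = UNIV, mult = (*), one = 1, ring.zero = 0, add = (+)\<rparr>"

definition is_character :: "('g, 'b) monoid_scheme \<Rightarrow> 'g set \<Rightarrow> ('g \<Rightarrow> complex) \<Rightarrow> bool" where
  "is_character G \<Gamma> chi \<longleftrightarrow> chi \<in> hom (G\<lparr>carrier := \<Gamma>\<rparr>) (mult_of complex_ring)"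


section \<open>Weakly holomorphic modular forms\<close>

text \<open>Weights \<open>k\<close> are half-integral, so that \<open>\<lfloor>2 * k\<rfloor>\<close> below is just \<open>2 * k\<close>.\<close>

definition slash :: "real \<Rightarrow> (complex \<Rightarrow> complex) \<Rightarrow> mp \<Rightarrow> complex \<Rightarrow> complex" where
  "slash k f g \<tau> = snd g \<tau> powi (- \<lfloor>2 * k\<rfloor>) * f (moebius (fst g) \<tau>)"

definition weakly_holomorphic_modular_form ::
    "real \<Rightarrow> mp set \<Rightarrow> (mp \<Rightarrow> complex) \<Rightarrow> (complex \<Rightarrow> complex) \<Rightarrow> bool" where
  "weakly_holomorphic_modular_form k \<Gamma> chi f \<longleftrightarrow>
     2 * k \<in> \<int> \<and> finite_index \<Gamma> \<and> is_character Mp1Z \<Gamma> chi \<and> f holomorphic_on uhp \<and>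
     (\<forall>g\<in>\<Gamma>. \<forall>\<tau>\<in>uhp. slash k f g \<tau> = chi g * f \<tau>) \<and>
     (\<exists>a::real. \<forall>g\<in>carrier Mp1Z.
        (\<lambda>\<tau>. norm (slash k f g \<tau>)) \<in> O[filtercomap Im at_top](\<lambda>\<tau>. exp (a * Im \<tau>)))"

definition has_fourier_expansion :: "(complex \<Rightarrow> complex) \<Rightarrow> (rat \<Rightarrow> complex) \<Rightarrow> bool" where
  "has_fourier_expansion f c \<longleftrightarrow>
     (\<forall>\<tau>\<in>uhp. ((\<lambda>n. c n * e (of_rat n * \<tau>)) has_sum f \<tau>) UNIV)"


section \<open>The characters\<close>

definition dirichlet_character :: "nat \<Rightarrow> (int \<Rightarrow> complex) \<Rightarrow> bool" where
  "dirichlet_character N chi \<longleftrightarrow>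
     (\<forall>a b. chi (a * b) = chi a * chi b) \<and> (\<forall>a. chi (a + int N) = chi a) \<and>
     (\<forall>a. chi a \<noteq> 0 \<longleftrightarrow> coprime a (int N))"

definition character_of_dirichlet :: "(int \<Rightarrow> complex) \<Rightarrow> mp \<Rightarrow> complex" where
  "character_of_dirichlet chi g = chi \<lfloor>fst g $ 2 $ 2\<rfloor>"

definition theta :: "complex \<Rightarrow> complex" where
  "theta \<tau> = (\<Sum>\<^sub>\<infinity>n::int. e (of_int n ^ 2 * \<tau>))"

definition eta :: "complex \<Rightarrow> complex" where
  "eta \<tau> = e (\<tau> / 24) * prodinf (\<lambda>n. 1 - e (of_nat (Suc n) * \<tau>))"

text \<open>The next two predicates determine \<open>chi\<close> on \<open>Gamma0 4\<close> and on \<open>carrier Mp1Z\<close>,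
  because neither \<open>theta\<close> nor \<open>eta\<close> vanishes identically.\<close>

definition theta_character :: "(mp \<Rightarrow> complex) \<Rightarrow> bool" where
  "theta_character chi \<longleftrightarrow> is_character Mp1Z (Gamma0 4) chi \<and>
     (\<forall>g\<in>Gamma0 4. \<forall>\<tau>\<in>uhp. slash (1/2) theta g \<tau> = chi g * theta \<tau>)"

definition eta_character :: "(mp \<Rightarrow> complex) \<Rightarrow> bool" where
  "eta_character chi \<longleftrightarrow> is_character Mp1Z (carrier Mp1Z) chi \<and>
     (\<forall>g\<in>carrier Mp1Z. \<forall>\<tau>\<in>uhp. slash (1/2) eta g \<tau> = chi g * eta \<tau>)"


section \<open>Meromorphic functions of two variables\<close>

definition holomorphic2_on :: "(complex \<times> complex \<Rightarrow> complex) \<Rightarrow> (complex \<times> complex) set \<Rightarrow> bool"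
    (infixl \<open>holomorphic2'_on\<close> 50) where
  "F holomorphic2_on U \<longleftrightarrow>
     (\<forall>p\<in>U. \<exists>a b. (F has_derivative (\<lambda>(s, t). a * s + b * t)) (at p))"

definition regular_at :: "(complex \<times> complex \<Rightarrow> complex) \<Rightarrow> complex \<times> complex \<Rightarrow> bool" where
  "regular_at \<phi> p \<longleftrightarrow> (\<exists>U. open U \<and> p \<in> U \<and> \<phi> holomorphic2_on U)"

text \<open>A meromorphic function is locally a quotient of holomorphic functions. The second half of the
  definition fixes the total function that represents it, in the spirit of
  \<^const>\<open>nicely_meromorphic_on\<close>: removable singularities have been removed, and the
  value at the remaining singular points is \<open>0\<close>. With this convention equality of
  meromorphic functions is equality of values.\<close>

definition meromorphic2_on :: "(complex \<times> complex \<Rightarrow> complex) \<Rightarrow> (complex \<times> complex) set \<Rightarrow> bool"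
    (infixl \<open>meromorphic2'_on\<close> 50) where
  "\<phi> meromorphic2_on S \<longleftrightarrow>
     (\<forall>p\<in>S. \<exists>U F G. open U \<and> p \<in> U \<and> F holomorphic2_on U \<and> G holomorphic2_on U \<and>
        (\<forall>V. open V \<and> V \<subseteq> U \<and> V \<noteq> {} \<longrightarrow> (\<exists>q\<in>V. G q \<noteq> 0)) \<and>
        (\<forall>q\<in>U. G q \<noteq> 0 \<longrightarrow> \<phi> q = F q / G q)) \<and>
     (\<forall>p\<in>S. \<not> regular_at \<phi> p \<longrightarrow>
        \<phi> p = 0 \<and>
        \<not> (\<exists>U F. open U \<and> p \<in> U \<and> F holomorphic2_on U \<and> (\<forall>q\<in>U. regular_at \<phi> q \<longrightarrow> \<phi> q = F q)))"


section \<open>Weakly holomorphic Jacobi forms\<close>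

type_synonym heis = "real \<times> real \<times> real"

definition HZ :: "heis set" where
  "HZ = \<int> \<times> \<int> \<times> \<int>"

text \<open>In the coordinates in which \<open>(\<lambda>, \<mu>, \<kappa>)\<close> acts through
  \<open>e (m * (\<lambda>\<^sup>2 * \<tau> + 2 * \<lambda> * z + \<kappa>))\<close>, without the summand \<open>\<lambda> * \<mu>\<close> that other authors
  include, the group laws below are the ones that turn the slash actions into a right
  action of the semidirect product, \<open>((g, h), (g', h')) \<mapsto> (g g', h\<^sup>g\<^sup>' h')\<close>.\<close>

definition heis_mult :: "heis \<Rightarrow> heis \<Rightarrow> heis" where
  "heis_mult = (\<lambda>(l, m, k) (l', m', k'). (l + l', m + m', k + k' + 2 * l * m'))"

definition heis_act :: "heis \<Rightarrow> real^2^2 \<Rightarrow> heis" where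
  "heis_act = (\<lambda>(l, m, k) A.
     let l' = l * A$1$1 + m * A$2$1; m' = l * A$1$2 + m * A$2$2
     in (l', m', k + l' * m' - l * m))"

definition jacobi_group :: "(mp \<times> heis) monoid" where
  "jacobi_group = \<lparr>carrier = carrier Mp1R \<times> UNIV,
     mult = (\<lambda>(g, h) (g', h'). (g \<otimes>\<^bsub>Mp1R\<^esub> g', heis_mult (heis_act h (fst g')) h')),
     one = (\<one>\<^bsub>Mp1R\<^esub>, (0, 0, 0))\<rparr>"

definition jslash_mp ::
    "real \<Rightarrow> complex \<Rightarrow> (complex \<times> complex \<Rightarrow> complex) \<Rightarrow> mp \<Rightarrow> complex \<times> complex \<Rightarrow> complex" where
  "jslash_mp k m \<phi> g = (\<lambda>(\<tau>, z).
     snd g \<tau> powi (- \<lfloor>2 * k\<rfloor>)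
     * e (- m * of_real (fst g $ 2 $ 1) * z ^ 2 / auto_factor (fst g) \<tau>)
     * \<phi> (moebius (fst g) \<tau>, z / auto_factor (fst g) \<tau>))"

definition jslash_heis ::
    "complex \<Rightarrow> (complex \<times> complex \<Rightarrow> complex) \<Rightarrow> heis \<Rightarrow> complex \<times> complex \<Rightarrow> complex" where
  "jslash_heis m \<phi> = (\<lambda>(l, u, v) (\<tau>, z).
     e (m * (of_real l ^ 2 * \<tau> + 2 * of_real l * z + of_real v))
     * \<phi> (\<tau>, z + of_real l * \<tau> + of_real u))"

definition jslash :: "real \<Rightarrow> complex \<Rightarrow> (complex \<times> complex \<Rightarrow> complex) \<Rightarrow> mp \<times> heis
    \<Rightarrow> complex \<times> complex \<Rightarrow> complex" where
  "jslash k m \<phi> = (\<lambda>(g, h). jslash_heis m (jslash_mp k m \<phi> g) h)"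

definition torsion_lattice :: "nat \<Rightarrow> complex \<Rightarrow> complex set" where
  "torsion_lattice N \<tau> = {(of_int a + of_int b * \<tau>) / of_nat N | a b. True}"

definition singularities_at_torsion :: "nat \<Rightarrow> (complex \<times> complex \<Rightarrow> complex) \<Rightarrow> bool" where
  "singularities_at_torsion N \<phi> \<longleftrightarrow>
     (\<forall>\<tau>\<in>uhp. \<forall>z. z \<notin> torsion_lattice N \<tau> \<longrightarrow> regular_at \<phi> (\<tau>, z))"

text \<open>The growth condition at torsion points: as \<open>\<tau>\<close> varies, the point is
  \<open>z = x + y * \<tau>\<close> with \<open>x\<close>, \<open>y\<close> rational and fixed. Equivalently, the point
  \<open>z / (c * \<tau> + d)\<close> at which \<open>\<phi>\<close> itself is evaluated ranges over \<open>\<rat> + (g \<tau>) \<rat>\<close>.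
  The exponent \<open>a\<close> may depend on \<open>x\<close> and \<open>y\<close>: the elliptic
  transformation multiplies the value at \<open>x + y * \<tau>\<close> by
  \<open>e (- m * (\<lambda>\<^sup>2 * \<tau> + 2 * \<lambda> * (x + y * \<tau>)))\<close> when \<open>y\<close> is replaced by \<open>y + \<lambda>\<close>, so one exponent
  for all points would exclude every non-zero form of positive index.\<close>

definition weakly_holomorphic_jacobi_form ::
    "real \<Rightarrow> complex \<Rightarrow> mp set \<Rightarrow> (mp \<times> heis \<Rightarrow> complex) \<Rightarrow> (complex \<times> complex \<Rightarrow> complex) \<Rightarrow> bool"
  where
  "weakly_holomorphic_jacobi_form k m \<Gamma> chi \<phi> \<longleftrightarrow>
     2 * k \<in> \<int> \<and> finite_index \<Gamma> \<and> is_character jacobi_group (\<Gamma> \<times> HZ) chi \<and>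
     \<phi> meromorphic2_on (uhp \<times> UNIV) \<and>
     (\<exists>N'\<ge>1. singularities_at_torsion N' \<phi>) \<and>
     (\<forall>g\<in>\<Gamma> \<times> HZ. \<forall>p\<in>uhp \<times> UNIV. jslash k m \<phi> g p = chi g * \<phi> p) \<and>
     (\<forall>x y :: rat. \<exists>a::real. \<forall>g\<in>carrier Mp1Z.
        (\<lambda>\<tau>. norm (jslash_mp k m \<phi> g (\<tau>, of_rat x + of_rat y * \<tau>)))
        \<in> O[inf (filtercomap Im at_top)
              (principal {\<tau>. regular_at (jslash_mp k m \<phi> g) (\<tau>, of_rat x + of_rat y * \<tau>)})](\<lambda>\<tau>. exp (a * Im \<tau>)))"

definition has_jacobi_fourier_expansion ::
    "(complex \<times> complex \<Rightarrow> complex) \<Rightarrow> (rat \<Rightarrow> rat \<Rightarrow> complex) \<Rightarrow> bool" where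
  "has_jacobi_fourier_expansion \<phi> c \<longleftrightarrow>
     (\<exists>\<epsilon>>0. \<forall>\<tau>\<in>uhp. \<forall>z. 0 < Im z / Im \<tau> \<and> Im z / Im \<tau> < \<epsilon> \<longrightarrow>
        ((\<lambda>(n, r). c n r * e (of_rat n * \<tau> + of_rat r * z)) has_sum \<phi> (\<tau>, z)) UNIV)"

text \<open>The order of \<open>\<phi>\<close> along the divisor \<open>z = 0\<close>; in particular \<open>\<phi>\<close> is not
  identically \<open>0\<close>.\<close>

definition has_order_at_zero :: "(complex \<times> complex \<Rightarrow> complex) \<Rightarrow> int \<Rightarrow> bool" where
  "has_order_at_zero \<phi> n \<longleftrightarrow>
     (\<exists>a. (\<forall>\<tau>\<in>uhp. ((\<lambda>z. z powi (- n) * \<phi> (\<tau>, z)) \<longlongrightarrow> a \<tau>) (at 0)) \<and> (\<exists>\<tau>\<in>uhp. a \<tau> \<noteq> 0))"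

definition pole_factor :: "int \<Rightarrow> complex \<Rightarrow> complex" where
  "pole_factor \<nu> z = (e (z / 2) - e (- z / 2)) powi \<nu>"

definition specializes_to :: "(complex \<times> complex \<Rightarrow> complex) \<Rightarrow> (complex \<Rightarrow> complex) \<Rightarrow> bool" where
  "specializes_to \<phi> f \<longleftrightarrow>
     (\<exists>\<nu>. has_order_at_zero \<phi> (- \<nu>) \<and>
        (\<forall>\<tau>\<in>uhp. ((\<lambda>z. pole_factor \<nu> z * \<phi> (\<tau>, z)) \<longlongrightarrow> f \<tau>) (at 0)))"

text \<open>Laurent polynomials in \<open>e (z / D)\<close>, for all \<open>D\<close> at once: the exponent \<open>r :: rat\<close>
  stands for \<open>e (r * z)\<close>. Enlarging \<open>D\<close> does not affect divisibility by polynomials in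
  \<open>e z\<close>.\<close>

type_synonym laurent = "rat \<Rightarrow>\<^sub>0 complex"

definition laurent_eval :: "laurent \<Rightarrow> complex \<Rightarrow> complex" where
  "laurent_eval P z = (\<Sum>r\<in>Poly_Mapping.keys P. Poly_Mapping.lookup P r * e (of_rat r * z))"

definition leading_coefficients ::
    "(complex \<times> complex \<Rightarrow> complex) \<Rightarrow> (rat \<Rightarrow> rat \<Rightarrow> complex) \<Rightarrow> (rat \<Rightarrow> laurent) \<Rightarrow> bool" where
  "leading_coefficients \<phi> c ct \<longleftrightarrow>
     (\<exists>\<nu>. has_order_at_zero \<phi> (- \<nu>) \<and>
        (\<forall>n. \<forall>z\<in>uhp. laurent_eval (ct n) z =
           pole_factor \<nu> z * (\<Sum>\<^sub>\<infinity>r. c n r * e (of_rat r * z))))"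


section \<open>Integrality\<close>

definition number_field :: "complex set \<Rightarrow> bool" where
  "number_field K \<longleftrightarrow> subfield K complex_ring \<and> ring.finite_dimension complex_ring \<rat> K"

definition ring_of_integers :: "complex set \<Rightarrow> complex ring" where
  "ring_of_integers K = complex_ring\<lparr>carrier := {x \<in> K. algebraic_int x}\<rparr>"

definition prime_above :: "complex set \<Rightarrow> complex set \<Rightarrow> nat \<Rightarrow> bool" where
  "prime_above K L l \<longleftrightarrow> primeideal L (ring_of_integers K) \<and> of_nat l \<in> L"

definition localization :: "complex set \<Rightarrow> complex set \<Rightarrow> complex set" where
  "localization K L =
     {x / y | x y. x \<in> carrier (ring_of_integers K) \<and> y \<in> carrier (ring_of_integers K) - L}"


section \<open>Congruences and explanations\<close>

definition progression :: "nat \<Rightarrow> rat \<Rightarrow> rat set" where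
  "progression M \<beta> = {of_int (int M * t) + \<beta> | t. True}"

text \<open>The clause \<open>range c \<subseteq> K\<close> is the standing assumption that all coefficients lie in \<open>K\<close>.\<close>

definition ramanujan_congruence ::
    "complex set \<Rightarrow> complex set \<Rightarrow> nat \<Rightarrow> nat \<Rightarrow> rat \<Rightarrow> (complex \<Rightarrow> complex) \<Rightarrow> bool" where
  "ramanujan_congruence K L l M \<beta> f \<longleftrightarrow>
     (\<exists>c. has_fourier_expansion f c \<and> range c \<subseteq> K \<and>
        (\<forall>n\<in>progression M \<beta>. c n \<in> (\<lambda>x. of_nat l * x) ` localization K L))"

definition cyclotomic :: "nat \<Rightarrow> laurent" where
  "cyclotomic l = (\<Sum>r<l. Poly_Mapping.single (of_nat r) 1)"

definition laurent_dvd :: "complex set \<Rightarrow> laurent \<Rightarrow> laurent \<Rightarrow> bool" where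
  "laurent_dvd R P Q \<longleftrightarrow> (\<exists>S. range (Poly_Mapping.lookup S) \<subseteq> R \<and> Q = P * S)"

definition explains ::
    "complex set \<Rightarrow> complex set \<Rightarrow> nat \<Rightarrow> nat \<Rightarrow> rat \<Rightarrow>
     (complex \<times> complex \<Rightarrow> complex) \<Rightarrow> (complex \<Rightarrow> complex) \<Rightarrow> bool" where
  "explains K L l M \<beta> \<phi> f \<longleftrightarrow>
     singularities_at_torsion 1 \<phi> \<and> specializes_to \<phi> f \<and>
     (\<exists>c ct. has_jacobi_fourier_expansion \<phi> c \<and> leading_coefficients \<phi> c ct \<and>
        (\<forall>n r. c n r \<in> localization K L) \<and>
        (\<forall>n\<in>progression M \<beta>. laurent_dvd (localization K L) (cyclotomic l) (ct n)))"

definition explainable_congruence ::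
    "complex set \<Rightarrow> complex set \<Rightarrow> nat \<Rightarrow> nat \<Rightarrow> rat \<Rightarrow> (complex \<Rightarrow> complex) \<Rightarrow> bool" where
  "explainable_congruence K L l M \<beta> f \<longleftrightarrow>
     ramanujan_congruence K L l M \<beta> f \<and>
     (\<exists>k m \<Gamma> chi \<phi>. weakly_holomorphic_jacobi_form k m \<Gamma> chi \<phi> \<and> explains K L l M \<beta> \<phi> f)"

text \<open>The progression \<open>M \<int> + \<beta>\<close> lies in a class modulo \<open>\<int>\<close> that contains an exponent of \<open>f\<close>.
  On other classes a congruence is vacuous, and it then says nothing about \<open>M \<int> + u\<^sup>2 \<beta>\<close>:
  \<open>theta\<close>, with \<open>\<phi>(\<tau>, z) = theta \<tau>\<close>, has no exponents in \<open>3 \<int> + 1/4\<close>, but its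
  coefficient at \<open>1 = 2\<^sup>2 * (1/4)\<close> is \<open>2\<close>.\<close>

definition meets_exponents :: "rat \<Rightarrow> (complex \<Rightarrow> complex) \<Rightarrow> bool" where
  "meets_exponents \<beta> f \<longleftrightarrow> (\<exists>c n. has_fourier_expansion f c \<and> c n \<noteq> 0 \<and> n - \<beta> \<in> \<int>)"

end

(* The same Jacobi form phi explains all the congruences. The cyclotomic polynomial
   divides a leading coefficient if and only if that coefficient vanishes at z = j/l for
   all integers j prime to l. The values of the leading coefficients at j/l are the Fourier
   coefficients of phi(tau, j/l), up to a nonzero constant; at z = 0 they are the coefficients of f,
   and division by the cyclotomic polynomial, whose value there is l, gives the congruence for f. For
   gamma = (a b; c d) with N l^2 | c the elliptic and modular transformations give
   phi(gamma tau, ja/l) = chi'(gamma) (c tau + d)^k phi(tau, j/l). Choose a = u modulo 24M and c a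
   highly divisible square. Then T^(h/M) gamma = gamma_h T^(d^2 h/M) with gamma_h congruent to gamma,
   and chi'(gamma_h) = chi'(gamma), so that gamma carries the sieve for M Z + beta to the one for
   M Z + u^2 beta. If u^2 beta and beta differ modulo 1, there are no exponents to consider.

   That chi' takes the same value at gamma_h and gamma is seen for theta by comparing the behaviour at
   a/c, a Gauss sum that depends on a modulo 4 alone when c is a square, with that at infinity. The
   quotient chi_eta / chi_theta is a character of Gamma_0(4), which is generated by T, L^4 and -1, and
   is therefore given by an explicit congruence formula. *)

theory Submission
  imports Defs
begin

section \<open>Fourier expansions with rational exponents\<close>

text \<open>The double series for \<open>\<phi>\<close> is given only in a thin strip above the real
  axis of \<open>z\<close>. The points \<open>j/l\<close> and 0, where the leading coefficients have
  to be evaluated, lie on its boundary. Continuing a single coefficient to them requires a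
  functional that samples finitely many \<open>\<tau>\<close> and stays bounded as \<open>z\<close>
  moves: averages along a horizontal line do this, and normal families carry their limits to the
  real axis. Integrals over a period would need a common denominator of the exponents, which is not
  given. Integrality stays out of the modular argument. Vanishing at the \<open>j/l\<close> yields
  division over the complex numbers only; the quotient returns to the localization because the
  divisors involved have lowest coefficient 1 or -1. The index \<open>m\<close> is merely complex,
  but trivial action of the centre of \<open>HZ\<close> on a nonzero form makes it an integer, and
  this removes the exponential factors at torsion points. For eta, a matrix with
  \<open>a = u\<close> modulo \<open>24 * M\<close> and highly divisible \<open>c\<close> exists
  only if \<open>u\<close> is prime to 6; this comes from comparing exponents modulo 1, which forces
  \<open>u ^ 2 = 1\<close> modulo 24.\<close>

lemma e_add: "e (x + y) = e x * e y"
  by (simp add: e_def ring_distribs exp_add)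

lemma e_0 [simp]: "e 0 = 1"
  by (simp add: e_def)

lemma e_minus: "e (- x) = inverse (e x)"
  by (simp add: e_def exp_minus)

lemma e_diff: "e (x - y) = e x / e y"
  by (simp add: e_def ring_distribs exp_diff)

lemma e_nonzero [simp]: "e x \<noteq> 0"
  by (simp add: e_def)

lemma norm_e: "norm (e x) = exp (- 2 * pi * Im x)"
  by (simp add: e_def)

lemma e_of_nat_mult: "e (of_nat n * x) = e x ^ n"
  by (simp add: e_def exp_of_nat_mult [symmetric] mult_ac)

lemma e_eq_1_iff: "e x = 1 \<longleftrightarrow> x \<in> \<int>"
proof
  assume "e x = 1"
  then obtain n :: int where n: "Re (2 * of_real pi * \<i> * x) = 0" "Im (2 * of_real pi * \<i> * x) = of_int (2 * n) * pi"
    unfolding e_def exp_eq_1 by blast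
  then have "x = of_int n" by (auto simp: complex_eq_iff)
  then show "x \<in> \<int>" by simp
next
  assume "x \<in> \<int>"
  then obtain n :: int where "x = of_int n" by (auto elim: Ints_cases)
  moreover have "exp (2 * of_real pi * \<i> * of_int n) = 1"
    using exp_integer_2pi [of "of_int n"] by (simp add: mult_ac)
  ultimately show "e x = 1" by (simp add: e_def)
qed

lemma e_of_int [simp]: "e (of_int n) = 1"
  by (simp add: e_eq_1_iff)

lemma e_of_nat [simp]: "e (of_nat n) = 1"
  by (simp add: e_eq_1_iff)

lemma e_add_of_int [simp]: "e (x + of_int n) = e x"
  by (simp add: e_add)

lemma e_eq_iff: "e x = e y \<longleftrightarrow> x - y \<in> \<int>"
  by (metis e_diff e_eq_1_iff e_nonzero divide_eq_1_iff)

lemma holomorphic_e [holomorphic_intros]: "f holomorphic_on S \<Longrightarrow> (\<lambda>x. e (f x)) holomorphic_on S"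
  unfolding e_def by (intro holomorphic_intros)

lemma e_sum_roots:
  assumes "n > 0" "of_nat n * x \<in> \<int>"
  shows "(\<Sum>i<n. e (of_nat i * x)) = (if x \<in> \<int> then of_nat n else 0)"
proof (cases "x \<in> \<int>")
  case True
  then have "e (of_nat i * x) = 1" for i by (auto simp: e_eq_1_iff intro: Ints_mult)
  then show ?thesis using True by simp
next
  case False
  then have "e x \<noteq> 1" by (simp add: e_eq_1_iff)
  then have "(\<Sum>i<n. e x ^ i) = (e x ^ n - 1) / (e x - 1)" by (simp add: geometric_sum)
  also have "e x ^ n = 1" using assms(2) by (simp add: e_of_nat_mult [symmetric] e_eq_1_iff)
  finally show ?thesis using False by (simp add: e_of_nat_mult)
qed

section \<open>Extraction of a single Fourier coefficient by finite averages\<close>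

lemma has_sum_sum:
  fixes f :: "'i \<Rightarrow> 'a \<Rightarrow> 'b :: topological_comm_monoid_add"
  assumes "finite I" "\<And>i. i \<in> I \<Longrightarrow> (f i has_sum S i) A"
  shows "((\<lambda>x. \<Sum>i\<in>I. f i x) has_sum (\<Sum>i\<in>I. S i)) A"
  using assms by (induction I rule: finite_induct) (auto intro: has_sum_add)

text \<open>Tannery's theorem with dominating series \<open>a\<close>: a finite set containing
  \<open>n0\<close> carries all but \<epsilon>/2 of the absolute sum, and on it the weights
  \<open>d J\<close> eventually equal the indicator of \<open>n0\<close> exactly. Weights bounded by
  1 keep the tail small uniformly in \<open>J\<close>.\<close>

lemma tannery_selecting:
  fixes a :: "'a \<Rightarrow> complex"
  assumes summable: "a summable_on UNIV"
    and le1: "\<And>J n. norm (d J n) \<le> 1"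
    and null: "\<And>n. n \<noteq> n0 \<Longrightarrow> \<forall>\<^sub>F J in sequentially. d J n = 0"
    and one: "\<forall>\<^sub>F J in sequentially. d J n0 = 1"
    and S: "\<And>J. ((\<lambda>n. a n * d J n) has_sum S J) UNIV"
  shows "S \<longlonglongrightarrow> a n0"
proof (rule tendstoI)
  fix \<epsilon> :: real assume "\<epsilon> > 0"
  have norms: "(\<lambda>n. norm (a n)) summable_on UNIV"
    using summable by (simp add: summable_on_iff_abs_summable_on_complex)
  obtain F where F: "finite F" "dist (sum (\<lambda>n. norm (a n)) F) (infsum (\<lambda>n. norm (a n)) UNIV) \<le> \<epsilon>/2"
    using infsum_finite_approximation [OF norms, of "\<epsilon>/2"] \<open>\<epsilon> > 0\<close> by auto
  define G where "G = insert n0 F"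
  have "finite G" using F by (simp add: G_def)
  have split: "infsum f UNIV = sum f G + infsum f (- G)" if "f summable_on UNIV" for f :: "'a \<Rightarrow> 'b :: banach"
    using infsum_Un_disjoint [of f G "- G"] \<open>finite G\<close> summable_on_subset_banach [OF that] by auto
  have "sum (\<lambda>n. norm (a n)) F \<le> sum (\<lambda>n. norm (a n)) G"
    by (rule sum_mono2) (use F in \<open>auto simp: G_def\<close>)
  then have tail: "infsum (\<lambda>n. norm (a n)) (- G) \<le> \<epsilon>/2"
    using F(2) split [OF norms] unfolding dist_real_def by linarith
  have "\<forall>\<^sub>F J in sequentially. \<forall>n\<in>G. d J n = (if n = n0 then 1 else 0)"
    using \<open>finite G\<close>
    by (rule eventually_ball_finite) (use null one in auto)
  then show "\<forall>\<^sub>F J in sequentially. dist (S J) (a n0) < \<epsilon>"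
  proof eventually_elim
    case (elim J)
    have sm: "(\<lambda>n. a n * d J n) summable_on UNIV" using S has_sum_imp_summable by blast
    have "S J = (\<Sum>n\<in>G. a n * d J n) + infsum (\<lambda>n. a n * d J n) (- G)"
      using S [of J] split [OF sm] by (simp add: infsumI)
    also have "(\<Sum>n\<in>G. a n * d J n) = (\<Sum>n\<in>G. if n = n0 then a n else 0)"
      by (rule sum.cong) (use elim in auto)
    also have "\<dots> = a n0" using \<open>finite G\<close> by (simp add: G_def)
    finally have "dist (S J) (a n0) = norm (infsum (\<lambda>n. a n * d J n) (- G))" by (simp add: dist_norm)
    also have "\<dots> \<le> infsum (\<lambda>n. norm (a n)) (- G)"
    proof (rule norm_infsum_le)
      show "((\<lambda>n. a n * d J n) has_sum infsum (\<lambda>n. a n * d J n) (- G)) (- G)"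
        using summable_on_subset_banach [OF sm] by auto
      show "((\<lambda>n. norm (a n)) has_sum infsum (\<lambda>n. norm (a n)) (- G)) (- G)"
        using summable_on_subset_banach [OF norms] by auto
      show "norm (a n * d J n) \<le> norm (a n)" if "n \<in> - G" for n
        using mult_left_mono [OF le1 [of J n], of "norm (a n)"] by (simp add: norm_mult)
    qed
    also have "\<dots> < \<epsilon>" using tail \<open>\<epsilon> > 0\<close> by simp
    finally show ?case .
  qed
qed

text \<open>A stand-in for the mean over a period: step \<open>1 / J\<close>, length
  \<open>fact J\<close>. The exponents are arbitrary rationals without a common denominator, so
  fineness and length both grow with \<open>J\<close>. For \<open>J = 0\<close> the value is
  0.\<close>

definition average :: "nat \<Rightarrow> rat \<Rightarrow> (complex \<Rightarrow> complex) \<Rightarrow> complex \<Rightarrow> complex" where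
  "average J n g \<tau> = (\<Sum>i<J * fact J. g (\<tau> + of_real (of_nat i / of_nat J)) * e (- of_rat n * (\<tau> + of_real (of_nat i / of_nat J))))
     / of_nat (J * fact J)"

lemma Re_of_rat [simp]: "Re (of_rat q) = of_rat q" and Im_of_rat [simp]: "Im (of_rat q) = 0"
proof -
  obtain a b where "q = of_int a / of_int b" by (metis Fract_of_int_quotient Rat_cases)
  then have "(of_rat q :: complex) = of_real (of_rat q)" by (simp add: of_rat_divide)
  then show "Re (of_rat q) = of_rat q" "Im (of_rat q) = 0" by simp_all
qed

lemma of_rat_in_Ints_iff: "(of_rat q :: complex) \<in> \<int> \<longleftrightarrow> q \<in> \<int>"
proof
  assume "(of_rat q :: complex) \<in> \<int>"
  then obtain k where "(of_rat q :: complex) = of_int k" by (auto elim: Ints_cases)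
  then have "(of_rat q :: complex) = of_rat (of_int k)" by simp
  then have "q = of_int k" by (simp only: of_rat_eq_iff)
  then show "q \<in> \<int>" by simp
qed (auto elim!: Ints_cases)

text \<open>These are the conditions under which the sum of roots of unity in \<open>average\<close>
  vanishes for a difference \<open>q\<close> of exponents: \<open>fact J * q\<close> integral gives
  whole periods, and \<bar>q\<bar> < J keeps the root of unity different from 1.\<close>

lemma dvd_fact_eventually:
  fixes q :: rat
  assumes "q \<noteq> 0"
  shows "\<forall>\<^sub>F J in sequentially. J > 0 \<and> fact J * q \<in> \<int> \<and> q / of_nat J \<notin> \<int>"
proof -
  obtain a b where ab: "q = of_int a / of_int b" "b > 0"
    by (metis Fract_of_int_quotient Rat_cases)
  show ?thesis
  proof (rule eventually_sequentiallyI)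
    fix J assume J: "J \<ge> nat b + nat \<lceil>\<bar>q\<bar>\<rceil> + 1"
    have "nat b dvd fact J" using J ab(2) by (intro dvd_fact) auto
    then have "b dvd fact J" using ab(2) by (metis int_dvd_int_iff int_nat_eq less_imp_le of_nat_fact)
    then obtain k where "fact J = b * k" by blast
    then have "(fact J :: rat) = of_int b * of_int k" by (metis of_int_fact of_int_mult)
    then have "fact J * q = of_int (k * a)" using ab by simp
    then have 1: "fact J * q \<in> \<int>" by simp
    have "\<bar>q\<bar> < of_nat J" using J by linarith
    then have "\<bar>q / of_nat J\<bar> < 1" using J by (simp add: field_simps)
    moreover have "q / of_nat J \<noteq> 0" using assms J by simp
    ultimately have 2: "q / of_nat J \<notin> \<int>" using Ints_nonzero_abs_less1 by blast
    show "J > 0 \<and> fact J * q \<in> \<int> \<and> q / of_nat J \<notin> \<int>" using 1 2 J by simp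
  qed
qed

text \<open>The expansion is required along one horizontal line only, since \<open>average\<close>
  samples nothing else. Once \<open>e (n0 * \<tau>)\<close> is divided out, the normalised sums of
  roots of unity \<open>d J n\<close> are weights as in \<open>tannery_selecting\<close>.\<close>

lemma average_tendsto:
  assumes sums: "\<And>x::real. ((\<lambda>n. c n * e (of_rat n * (\<tau> + of_real x))) has_sum g (\<tau> + of_real x)) UNIV"
  shows "(\<lambda>J. average J n0 g \<tau>) \<longlonglongrightarrow> c n0"
proof -
  define d where "d J n = (\<Sum>i<J * fact J. e (of_nat i * of_rat ((n - n0) / of_nat J))) / of_nat (J * fact J)" for J n
  have "(\<lambda>J. average J n0 g \<tau>) \<longlonglongrightarrow> c n0 * e (of_rat (n0 - n0) * \<tau>)"
  proof (rule tannery_selecting [where d = d and a = "\<lambda>n. c n * e (of_rat (n - n0) * \<tau>)"])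
    have "(\<lambda>n. c n * e (of_rat n * \<tau>) * e (- of_rat n0 * \<tau>)) summable_on UNIV"
      using sums [of 0] by (intro summable_on_cmult_left) (auto dest: has_sum_imp_summable)
    then show "(\<lambda>n. c n * e (of_rat (n - n0) * \<tau>)) summable_on UNIV"
      by (simp add: of_rat_diff left_diff_distrib e_diff e_minus field_simps)
    show "norm (d J n) \<le> 1" for J n
    proof -
      have "norm (\<Sum>i<J * fact J. e (of_nat i * of_rat ((n - n0) / of_nat J))) \<le> (\<Sum>i<J * fact J. 1)"
        by (rule sum_norm_le) (simp add: norm_e)
      then show ?thesis by (auto simp: d_def norm_divide divide_le_eq simp del: of_nat_mult)
    qed
    show "\<forall>\<^sub>F J in sequentially. d J n = 0" if "n \<noteq> n0" for n
    proof -
      from that have "n - n0 \<noteq> 0" by simp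
      from dvd_fact_eventually [OF this] show ?thesis
      proof eventually_elim
      case (elim J)
      then have *: "J > 0" "fact J * (n - n0) \<in> \<int>" "(n - n0) / of_nat J \<notin> \<int>" by auto
      have fact_rat: "(of_rat (fact J) :: complex) = fact J" by (metis of_nat_fact of_rat_of_nat_eq)
      have "of_nat (J * fact J) * (of_rat ((n - n0) / of_nat J) :: complex) = of_rat (fact J * (n - n0))"
        using *(1) fact_rat by (simp add: of_rat_mult of_rat_divide)
      also have "\<dots> \<in> \<int>" using * by (simp only: of_rat_in_Ints_iff)
      finally have 1: "of_nat (J * fact J) * (of_rat ((n - n0) / of_nat J) :: complex) \<in> \<int>" .
      have 2: "(of_rat ((n - n0) / of_nat J) :: complex) \<notin> \<int>" using * by (simp only: of_rat_in_Ints_iff) simp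
      have "J * fact J > 0" using *(1) by simp
      from e_sum_roots [OF this 1] 2 show ?case unfolding d_def by (simp only: if_False div_0)
      qed
    qed
    show "\<forall>\<^sub>F J in sequentially. d J n0 = 1"
      using eventually_gt_at_top [of 0] by eventually_elim (simp add: d_def)
    show "((\<lambda>n. c n * e (of_rat (n - n0) * \<tau>) * d J n) has_sum average J n0 g \<tau>) UNIV" for J
    proof -
      have summand: "c n * e (of_rat n * (\<tau> + of_real x)) * e (- of_rat n0 * (\<tau> + of_real x))
          = c n * e (of_rat (n - n0) * \<tau>) * e (of_rat (n - n0) * of_real x)" for n x
      proof -
        have "of_rat n * (\<tau> + of_real x) + - of_rat n0 * (\<tau> + of_real x) = of_rat (n - n0) * \<tau> + of_rat (n - n0) * of_real x"
          by (simp add: of_rat_diff algebra_simps)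
        then show ?thesis by (metis e_add mult.assoc)
      qed
      have "((\<lambda>n. (\<Sum>i<J * fact J. c n * e (of_rat n * (\<tau> + of_real (of_nat i / of_nat J))) * e (- of_rat n0 * (\<tau> + of_real (of_nat i / of_nat J)))) / of_nat (J * fact J))
         has_sum average J n0 g \<tau>) UNIV"
        unfolding average_def
        by (intro has_sum_divide_const has_sum_sum has_sum_cmult_left sums finite_lessThan)
      moreover have "(\<Sum>i<J * fact J. c n * e (of_rat n * (\<tau> + of_real (of_nat i / of_nat J))) * e (- of_rat n0 * (\<tau> + of_real (of_nat i / of_nat J)))) / of_nat (J * fact J)
         = c n * e (of_rat (n - n0) * \<tau>) * d J n" for n
        unfolding d_def summand sum_distrib_left [symmetric]
        by (simp add: of_rat_divide mult.commute)
      ultimately show ?thesis by simp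
    qed
  qed
  then show ?thesis by simp
qed

lemma fourier_expansion_average:
  assumes "has_fourier_expansion g c" "\<tau> \<in> uhp"
  shows "(\<lambda>J. average J n g \<tau>) \<longlonglongrightarrow> c n"
  using assms by (intro average_tendsto) (auto simp: has_fourier_expansion_def uhp_def)

lemma fourier_expansion_unique:
  assumes "has_fourier_expansion g c" "has_fourier_expansion g c'"
  shows "c = c'"
proof
  have "\<i> \<in> uhp" by (simp add: uhp_def)
  then show "c n = c' n" for n
    using assms fourier_expansion_average LIMSEQ_unique by blast
qed


text \<open>Vitali's argument. The averages are holomorphic in \<open>z\<close> and bounded by one
  constant. If they did not converge at \<open>z0\<close>, a subsequence would stay away from
  \<open>C z0\<close>; Montel extracts from it a convergent one, whose limit equals \<open>C\<close>
  on the part of the disc in the strip 0 < Im z < \<epsilon>, hence on the whole disc, a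
  contradiction.\<close>

lemma average_continuation:
  assumes "r > 0" "\<epsilon> > 0" "Im z0 = 0"
    and hol: "\<And>x::real. H (\<tau> + of_real x) holomorphic_on ball z0 r"
    and bd: "\<And>(x::real) z. z \<in> ball z0 r \<Longrightarrow> norm (H (\<tau> + of_real x) z) \<le> B"
    and lim: "\<And>z. z \<in> ball z0 r \<Longrightarrow> 0 < Im z \<Longrightarrow> Im z < \<epsilon> \<Longrightarrow> (\<lambda>J. average J n (\<lambda>\<tau>'. H \<tau>' z) \<tau>) \<longlonglongrightarrow> C z"
    and C: "C holomorphic_on ball z0 r"
  shows "(\<lambda>J. average J n (\<lambda>\<tau>'. H \<tau>' z0) \<tau>) \<longlonglongrightarrow> C z0"
proof (rule ccontr)
  define F where "F J z = average J n (\<lambda>\<tau>'. H \<tau>' z) \<tau>" for J z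
  \<comment> \<open>The factor \<open>e (- n * (\<tau> + x))\<close> has the same modulus for all
    real \<open>x\<close>, so one bound serves all averages.\<close>
  define B' where "B' = B * exp (2 * pi * of_rat n * Im \<tau>)"
  have "norm (H (\<tau> + of_real 0) z0) \<le> B" using bd [of z0 0] \<open>r > 0\<close> by simp
  then have "B \<ge> 0" using norm_ge_zero order_trans by blast
  have F_hol: "F J holomorphic_on ball z0 r" for J
    unfolding F_def average_def by (intro holomorphic_intros hol) (cases "J = 0"; simp)
  have F_bd: "norm (F J z) \<le> B'" if "z \<in> ball z0 r" for J z
  proof -
    have "norm (\<Sum>i<J * fact J. H (\<tau> + of_real (of_nat i / of_nat J)) z * e (- of_rat n * (\<tau> + of_real (of_nat i / of_nat J)))) \<le> (\<Sum>i<J * fact J. B')"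
    proof (rule sum_norm_le)
      fix i
      have "norm (e (- of_rat n * (\<tau> + of_real (of_nat i / of_nat J)))) = exp (2 * pi * of_rat n * Im \<tau>)"
        by (simp add: norm_e del: of_real_divide)
      then show "norm (H (\<tau> + of_real (of_nat i / of_nat J)) z * e (- of_rat n * (\<tau> + of_real (of_nat i / of_nat J)))) \<le> B'"
        unfolding norm_mult B'_def using mult_right_mono [OF bd [OF that, of "of_nat i / of_nat J"]] by simp
    qed
    moreover have "B' \<ge> 0" using \<open>B \<ge> 0\<close> by (simp add: B'_def)
    ultimately show ?thesis
      unfolding F_def average_def norm_divide
      by (cases "J = 0") (simp_all add: divide_le_eq norm_mult mult.commute)
  qed
  assume "\<not> (\<lambda>J. average J n (\<lambda>\<tau>'. H \<tau>' z0) \<tau>) \<longlonglongrightarrow> C z0"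
  then have "\<not> (\<lambda>J. F J z0) \<longlonglongrightarrow> C z0" by (simp add: F_def)
  then obtain \<delta> where \<delta>: "\<delta> > 0" "\<not> (\<forall>\<^sub>F J in sequentially. dist (F J z0) (C z0) < \<delta>)"
    by (auto simp: tendsto_iff)
  then obtain s :: "nat \<Rightarrow> nat" where s: "strict_mono s" "\<And>J. \<not> dist (F (s J) z0) (C z0) < \<delta>"
    using not_eventually_sequentiallyD [OF \<delta>(2)] by blast
  obtain g t where g: "g holomorphic_on ball z0 r" "strict_mono (t :: nat \<Rightarrow> nat)"
    "\<And>z. z \<in> ball z0 r \<Longrightarrow> (\<lambda>J. F (s (t J)) z) \<longlonglongrightarrow> g z"
  proof (rule Montel [of "ball z0 r" "range F" "\<lambda>J. F (s J)"])
    show "\<exists>B. \<forall>h\<in>range F. \<forall>z\<in>K. norm (h z) \<le> B" if "compact K" "K \<subseteq> ball z0 r" for K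
      using F_bd that by blast
  qed (use F_hol in auto)
  have st: "strict_mono (\<lambda>J. s (t J))" using strict_mono_o [OF s(1) g(2)] by (simp add: o_def)
  define U where "U = ball z0 r \<inter> {z. 0 < Im z} \<inter> {z. Im z < \<epsilon>}"
  have "g z0 = C z0"
  proof (rule analytic_continuation_open [of U "ball z0 r" g C])
    show "open U" unfolding U_def by (intro open_Int open_ball open_halfspace_Im_gt open_halfspace_Im_lt)
    define x where "x = min r \<epsilon> / 2"
    have "z0 + \<i> * of_real x \<in> U"
      using assms by (auto simp: U_def x_def dist_norm norm_mult min_def)
    then show "U \<noteq> {}" by blast
    show "g z = C z" if "z \<in> U" for z
    proof (rule LIMSEQ_unique)
      show "(\<lambda>J. F (s (t J)) z) \<longlonglongrightarrow> g z" using g that by (auto simp: U_def)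
      have "(\<lambda>J. F J z) \<longlonglongrightarrow> C z" using lim that by (auto simp: U_def F_def)
      from LIMSEQ_subseq_LIMSEQ [OF this st] show "(\<lambda>J. F (s (t J)) z) \<longlonglongrightarrow> C z" by (simp add: o_def)
    qed
  qed (use g C \<open>r > 0\<close> in \<open>auto simp: U_def\<close>)
  then have "(\<lambda>J. F (s (t J)) z0) \<longlonglongrightarrow> C z0" using g(3) [of z0] \<open>r > 0\<close> by simp
  then have "\<forall>\<^sub>F J in sequentially. dist (F (s (t J)) z0) (C z0) < \<delta>" using \<delta>(1) by (rule tendstoD)
  then show False using s(2) by (auto simp: eventually_sequentially)
qed

section \<open>Expansion of quasi-periodic functions of moderate growth\<close>

lemma periodic_add_int:
  fixes g :: "complex \<Rightarrow> complex"
  assumes "\<And>\<tau>. \<tau> \<in> uhp \<Longrightarrow> g (\<tau> + 1) = g \<tau>" "\<tau> \<in> uhp"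
  shows "g (\<tau> + of_int n) = g \<tau>"
proof -
  have nat: "g (\<tau> + of_nat n) = g \<tau>" if "\<tau> \<in> uhp" for n \<tau>
  proof (induction n)
    case (Suc n)
    have "\<tau> + of_nat n \<in> uhp" using that by (simp add: uhp_def)
    then show ?case using assms(1) [of "\<tau> + of_nat n"] Suc by (simp add: add_ac)
  qed simp
  show ?thesis
  proof (cases n rule: int_cases2)
    case (nonneg m)
    then show ?thesis using nat assms by simp
  next
    case (nonpos m)
    have "\<tau> - of_nat m \<in> uhp" using assms by (simp add: uhp_def)
    then show ?thesis using nat [of "\<tau> - of_nat m" m] nonpos by simp
  qed
qed

text \<open>Dividing by \<open>e (s * \<tau>)\<close> leaves a function of
  \<open>q = e \<tau>\<close> on the punctured disc. The growth bound makes \<open>q ^ K\<close>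
  times it bounded near 0, so the singularity is removable, and the Taylor series with exponents
  shifted by \<open>s - K\<close> is the expansion.\<close>

lemma periodic_fourier_expansion:
  assumes hol: "g holomorphic_on uhp"
    and per: "\<And>\<tau>. \<tau> \<in> uhp \<Longrightarrow> g (\<tau> + 1) = e (of_rat s) * g \<tau>"
    and growth: "\<And>\<tau>. Im \<tau> \<ge> Y \<Longrightarrow> norm (g \<tau>) \<le> C * exp (a * Im \<tau>)"
  shows "\<exists>c. has_fourier_expansion g c"
proof -
  define g1 where "g1 \<tau> = e (- of_rat s * \<tau>) * g \<tau>" for \<tau>
  have g1_hol: "g1 holomorphic_on uhp" unfolding g1_def by (intro holomorphic_intros hol)
  have g1_per: "g1 (\<tau> + of_int n) = g1 \<tau>" if "\<tau> \<in> uhp" for \<tau> n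
    by (rule periodic_add_int [OF _ that])
       (simp add: g1_def per ring_distribs e_diff e_add e_minus)
  \<comment> \<open>Large enough for the modulus of \<open>q ^ K\<close> to absorb the growth
    \<open>exp (a * Im \<tau>)\<close> together with the factor
    \<open>e (- s * \<tau>)\<close>.\<close>
  define K where "K = nat \<lceil>(\<bar>a\<bar> + 2 * pi * \<bar>of_rat s\<bar>) / (2 * pi)\<rceil>"
  have K: "\<bar>a\<bar> + 2 * pi * \<bar>of_rat s\<bar> \<le> 2 * pi * of_nat K"
  proof -
    have "(\<bar>a\<bar> + 2 * pi * \<bar>of_rat s\<bar>) / (2 * pi) \<le> of_nat K" unfolding K_def by (rule real_nat_ceiling_ge)
    then show ?thesis by (simp add: divide_le_eq mult.commute)
  qed
  define lg where "lg q = Ln q / (2 * of_real pi * \<i>)" for q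
  have e_lg: "e (lg q) = q" if "q \<noteq> 0" for q using that by (simp add: e_def lg_def)
  have Im_lg: "Im (lg q) = - ln (norm q) / (2 * pi)" if "q \<noteq> 0" for q
    using that by (simp add: lg_def Im_divide power2_eq_square)
  have lg_uhp: "lg q \<in> uhp" if "q \<noteq> 0" "norm q < 1" for q
    using that by (simp add: uhp_def Im_lg divide_neg_pos)
  define G where "G q = q ^ K * g1 (lg q)" for q
  have G_e: "G (e \<tau>) = e (of_nat K * \<tau>) * g1 \<tau>" if "\<tau> \<in> uhp" for \<tau>
  proof -
    have "e (lg (e \<tau>)) = e \<tau>" by (simp add: e_lg)
    then obtain n where "lg (e \<tau>) - \<tau> = of_int n" by (auto simp: e_eq_iff elim: Ints_cases)
    then have "lg (e \<tau>) = \<tau> + of_int n" by (simp add: algebra_simps)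
    then show ?thesis using g1_per [OF that, of n] by (simp add: G_def e_of_nat_mult)
  qed
  have G_diff: "G field_differentiable at q" if q: "q \<noteq> 0" "norm q < 1" for q
  proof -
    \<comment> \<open>\<open>Ln\<close> jumps across the negative axis, so near \<open>q\<close> the
      logarithm is based at \<open>q\<close>: on the ball below \<open>w / q\<close> stays within
      distance 1 of 1. \<open>G\<close> does not notice the change of branch because
      \<open>g1\<close> has period 1.\<close>
    define lq where "lq w = lg q + Ln (w / q) / (2 * of_real pi * \<i>)" for w
    define \<delta> where "\<delta> = min (norm q) (1 - norm q)"
    have ball: "w / q \<notin> \<real>\<^sub>\<le>\<^sub>0" "w \<noteq> 0" "norm w < 1" if "w \<in> ball q \<delta>" for w
    proof -
      have w: "norm (w - q) < norm q" "norm (w - q) < 1 - norm q" using that by (auto simp: \<delta>_def dist_norm norm_minus_commute)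
      have "norm (w / q - 1) < 1"
      proof -
        have "w / q - 1 = (w - q) / q" using q by (simp add: field_simps)
        then show ?thesis using w q by (simp add: norm_divide)
      qed
      then have "\<bar>Re (w / q - 1)\<bar> < 1" using abs_Re_le_cmod le_less_trans by blast
      then show "w / q \<notin> \<real>\<^sub>\<le>\<^sub>0" by (auto simp: complex_nonpos_Reals_iff)
      show "w \<noteq> 0" using w by auto
      show "norm w < 1" using w norm_triangle_ineq [of "w - q" q] by simp
    qed
    have e_lq: "e (lq w) = w" if "w \<in> ball q \<delta>" for w
    proof -
      have "e (lq w) = e (lg q) * e (Ln (w / q) / (2 * of_real pi * \<i>))" by (simp add: lq_def e_add)
      also have "e (Ln (w / q) / (2 * of_real pi * \<i>)) = exp (Ln (w / q))" by (simp add: e_def)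
      finally show ?thesis using ball [OF that] q e_lg by simp
    qed
    have lq_uhp: "lq w \<in> uhp" if "w \<in> ball q \<delta>" for w
    proof -
      have "norm (e (lq w)) < 1" using ball(3) [OF that] e_lq [OF that] by simp
      then have "0 < pi * Im (lq w)" by (simp add: norm_e)
      then show ?thesis using pi_gt_zero by (simp only: uhp_def zero_less_mult_iff mem_Collect_eq) auto
    qed
    have "lq holomorphic_on ball q \<delta>"
      unfolding lq_def using ball q by (intro holomorphic_intros) auto
    then have "(g1 \<circ> lq) holomorphic_on ball q \<delta>"
      by (rule holomorphic_on_compose_gen [OF _ g1_hol]) (use lq_uhp in auto)
    then have "(\<lambda>w. w ^ K * (g1 \<circ> lq) w) holomorphic_on ball q \<delta>" by (intro holomorphic_intros)
    moreover have "w ^ K * (g1 \<circ> lq) w = G w" if "w \<in> ball q \<delta>" for w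
      using G_e [OF lq_uhp [OF that]] by (simp add: e_lq [OF that] e_of_nat_mult)
    ultimately have "G holomorphic_on ball q \<delta>" by (rule holomorphic_transform)
    moreover have "q \<in> ball q \<delta>" using q by (simp add: \<delta>_def)
    ultimately show ?thesis by (meson holomorphic_on_imp_differentiable_at open_ball)
  qed
  have "\<forall>\<^sub>F q in at 0. norm (G q) \<le> \<bar>C\<bar>"
  proof -
    define \<rho> where "\<rho> = min 1 (exp (- 2 * pi * Y))"
    have "norm (G q) \<le> \<bar>C\<bar>" if q: "q \<noteq> 0" "norm q < \<rho>" for q
    proof -
      define y where "y = Im (lg q)"
      have "lg q \<in> uhp" using q lg_uhp by (simp add: \<rho>_def)
      then have "y > 0" by (simp add: y_def uhp_def)
      have nq: "norm q = exp (- 2 * pi * y)" unfolding y_def norm_e [symmetric] using q e_lg by simp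
      then have "exp (- 2 * pi * y) < exp (- 2 * pi * Y)" using q by (simp add: \<rho>_def)
      then have "y \<ge> Y" by simp
      have "norm (G q) = exp (- 2 * pi * y) ^ K * exp (2 * pi * of_rat s * y) * norm (g (lg q))"
        by (simp add: G_def g1_def norm_mult norm_power nq norm_e y_def)
      also have "\<dots> \<le> exp (- 2 * pi * y) ^ K * exp (2 * pi * of_rat s * y) * (\<bar>C\<bar> * exp (a * y))"
      proof (intro mult_left_mono)
        have "norm (g (lg q)) \<le> C * exp (a * y)" using growth [of "lg q"] \<open>y \<ge> Y\<close> by (simp add: y_def)
        also have "\<dots> \<le> \<bar>C\<bar> * exp (a * y)" by (intro mult_right_mono) auto
        finally show "norm (g (lg q)) \<le> \<bar>C\<bar> * exp (a * y)" .
      qed auto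
      also have "\<dots> = \<bar>C\<bar> * exp ((a + 2 * pi * of_rat s - 2 * pi * of_nat K) * y)"
      proof -
        have E1: "exp (- 2 * pi * y) ^ K = exp (of_nat K * (- 2 * pi * y))" by (rule exp_of_nat_mult [symmetric])
        have E2: "(a + 2 * pi * of_rat s - 2 * pi * of_nat K) * y = of_nat K * (- 2 * pi * y) + 2 * pi * of_rat s * y + a * y"
          by (simp add: algebra_simps)
        show ?thesis unfolding E1 E2 exp_add by (simp only: mult_ac)
      qed
      also have "\<dots> \<le> \<bar>C\<bar> * 1"
      proof (intro mult_left_mono)
        have "2 * pi * of_rat s \<le> 2 * pi * \<bar>of_rat s\<bar>" by (intro mult_left_mono abs_ge_self) auto
        then have "a + 2 * pi * of_rat s - 2 * pi * of_nat K \<le> 0" using K by linarith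
        then show "exp ((a + 2 * pi * of_rat s - 2 * pi * of_nat K) * y) \<le> 1"
          using \<open>y > 0\<close> by (simp add: mult_nonpos_nonneg)
      qed auto
      finally show ?thesis by simp
    qed
    moreover have "\<rho> > 0" by (simp add: \<rho>_def)
    ultimately show ?thesis unfolding eventually_at by (intro exI [of _ \<rho>]) auto
  qed
  moreover have "G holomorphic_on ball 0 1 - {0}"
    using G_diff by (auto simp: holomorphic_on_def intro: field_differentiable_at_within)
  ultimately obtain G2 where G2: "G2 holomorphic_on ball 0 1" "\<And>q. q \<in> ball 0 1 - {0} \<Longrightarrow> G2 q = G q"
    using holomorphic_on_extend_bounded [of G "ball 0 1" 0] by auto
  define A where "A k = (deriv ^^ k) G2 0 / fact k" for k
  have A: "(\<lambda>k. A k * q ^ k) sums G2 q" if "norm q < 1" for q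
    using holomorphic_power_series [OF G2(1), of q] that by (simp add: A_def)
  have A_sum: "((\<lambda>k. A k * q ^ k) has_sum G2 q) UNIV" if "norm q < 1" for q
  proof (rule norm_summable_imp_has_sum [OF _ A [OF that]])
    define \<rho> where "\<rho> = (norm q + 1) / 2"
    have "norm q < \<rho>" "\<rho> < 1" "\<rho> \<ge> 0" using that by (simp_all add: \<rho>_def)
    then have "norm (of_real \<rho> :: complex) < 1" "norm q < norm (of_real \<rho> :: complex)" using \<open>\<rho> \<ge> 0\<close> by (simp_all add: abs_of_nonneg)
    from powser_insidea [OF sums_summable [OF A [OF this(1)]] this(2)]
    show "summable (\<lambda>k. norm (A k * q ^ k))" .
  qed
  define idx :: "nat \<Rightarrow> rat" where "idx k = of_nat k - of_nat K + s" for k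
  have "inj idx" by (auto simp: idx_def inj_def)
  define c where "c n = (if n \<in> range idx then A (inv_into UNIV idx n) else 0)" for n
  have c_idx: "c (idx k) = A k" for k using \<open>inj idx\<close> by (simp add: c_def)
  have "((\<lambda>n. c n * e (of_rat n * \<tau>)) has_sum g \<tau>) UNIV" if \<tau>: "\<tau> \<in> uhp" for \<tau>
  proof -
    have "norm (e \<tau>) < 1" using \<tau> by (simp add: norm_e uhp_def)
    from has_sum_cmult_right [OF A_sum [OF this], of "e ((of_rat s - of_nat K) * \<tau>)"]
    have "((\<lambda>k. e ((of_rat s - of_nat K) * \<tau>) * (A k * e \<tau> ^ k)) has_sum e ((of_rat s - of_nat K) * \<tau>) * G2 (e \<tau>)) UNIV" .
    also have "e ((of_rat s - of_nat K) * \<tau>) * G2 (e \<tau>) = g \<tau>"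
    proof -
      have "G2 (e \<tau>) = e (of_nat K * \<tau>) * g1 \<tau>" using G2(2) [of "e \<tau>"] G_e [OF \<tau>] \<open>norm (e \<tau>) < 1\<close> by simp
      then show ?thesis by (simp add: g1_def left_diff_distrib e_diff e_minus)
    qed
    also have "(\<lambda>k. e ((of_rat s - of_nat K) * \<tau>) * (A k * e \<tau> ^ k)) = (\<lambda>n. c n * e (of_rat n * \<tau>)) \<circ> idx"
    proof
      fix k
      have "of_rat (idx k) * \<tau> = (of_rat s - of_nat K) * \<tau> + of_nat k * \<tau>"
        by (simp add: idx_def of_rat_add of_rat_diff algebra_simps)
      then show "e ((of_rat s - of_nat K) * \<tau>) * (A k * e \<tau> ^ k) = ((\<lambda>n. c n * e (of_rat n * \<tau>)) \<circ> idx) k"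
        by (simp add: c_idx e_add flip: e_of_nat_mult)
    qed
    finally have "((\<lambda>n. c n * e (of_rat n * \<tau>)) has_sum g \<tau>) (range idx)"
      using has_sum_reindex [OF \<open>inj idx\<close>] by metis
    then show ?thesis
      by (rule has_sum_cong_neutral [THEN iffD1, rotated -1]) (auto simp: c_def)
  qed
  then show ?thesis unfolding has_fourier_expansion_def by blast
qed

section \<open>Laurent polynomials and integrality\<close>

abbreviation "coef \<equiv> Poly_Mapping.lookup"
abbreviation "monomial \<equiv> Poly_Mapping.single"
abbreviation "supp \<equiv> Poly_Mapping.keys"

text \<open>A bare set of numbers instead of a ring record, so that membership of coefficients can
  be proved with the arithmetic of type \<open>complex\<close>.\<close>

definition subring_set :: "complex set \<Rightarrow> bool" where
  "subring_set R \<longleftrightarrow> 1 \<in> R \<and> (\<forall>x\<in>R. \<forall>y\<in>R. x + y \<in> R \<and> x * y \<in> R) \<and> (\<forall>x\<in>R. - x \<in> R)"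

lemma subring_setD:
  assumes "subring_set R"
  shows "1 \<in> R" "x \<in> R \<Longrightarrow> y \<in> R \<Longrightarrow> x + y \<in> R" "x \<in> R \<Longrightarrow> y \<in> R \<Longrightarrow> x * y \<in> R" "x \<in> R \<Longrightarrow> - x \<in> R"
    "x \<in> R \<Longrightarrow> y \<in> R \<Longrightarrow> x - y \<in> R" "0 \<in> R"
proof -
  show 1: "1 \<in> R" "x \<in> R \<Longrightarrow> y \<in> R \<Longrightarrow> x + y \<in> R" "x \<in> R \<Longrightarrow> y \<in> R \<Longrightarrow> x * y \<in> R" "x \<in> R \<Longrightarrow> - x \<in> R" for x y
    using assms by (auto simp: subring_set_def)
  show "x \<in> R \<Longrightarrow> y \<in> R \<Longrightarrow> x - y \<in> R" for x y
    using 1(2) [of x "- y"] 1(4) [of y] by simp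
  from this [OF 1(1) 1(1)] show "0 \<in> R" by simp
qed

lemma subring_set_sum:
  assumes "subring_set R" "\<And>i. i \<in> I \<Longrightarrow> f i \<in> R"
  shows "sum f I \<in> R"
  using assms(2) by (induction I rule: infinite_finite_induct) (auto intro: subring_setD [OF assms(1)])

text \<open>Primality of \<open>L\<close> keeps its complement closed under products, so fractions
  have common denominators; \<open>0 \<in> L\<close> keeps denominators nonzero.\<close>

lemma subring_set_localization:
  assumes "number_field K" "prime_above K L l"
  shows "subring_set (localization K L)"
proof -
  interpret primeideal L "ring_of_integers K" using assms by (simp add: prime_above_def)
  have ops: "\<one>\<^bsub>ring_of_integers K\<^esub> = 1" "\<zero>\<^bsub>ring_of_integers K\<^esub> = 0" "x \<otimes>\<^bsub>ring_of_integers K\<^esub> y = x * y" "x \<oplus>\<^bsub>ring_of_integers K\<^esub> y = x + y" for x y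
    by (simp_all add: ring_of_integers_def complex_ring_def)
  define OK where "OK = carrier (ring_of_integers K)"
  have OK: "1 \<in> OK" "x \<in> OK \<Longrightarrow> y \<in> OK \<Longrightarrow> x + y \<in> OK" "x \<in> OK \<Longrightarrow> y \<in> OK \<Longrightarrow> x * y \<in> OK" for x y
    using m_closed [of x y] a_closed [of x y] one_closed unfolding OK_def ops by auto
  have Om: "- x \<in> OK" if "x \<in> OK" for x
  proof -
    have "\<ominus>\<^bsub>ring_of_integers K\<^esub> x \<in> OK" using that unfolding OK_def by (rule a_inv_closed)
    moreover have "x + \<ominus>\<^bsub>ring_of_integers K\<^esub> x = 0" using r_neg [of x] that unfolding OK_def ops by simp
    ultimately show ?thesis by (simp add: add_eq_0_iff)
  qed
  have OL: "x * y \<in> OK - L" if "x \<in> OK - L" "y \<in> OK - L" for x y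
    using that I_prime [of x y] OK(3) [of x y] unfolding OK_def ops by auto
  have "0 \<in> L" using zero_closed additive_subgroup.zero_closed [OF is_additive_subgroup] unfolding ops by simp
  then have nz: "y \<noteq> 0" if "y \<in> OK - L" for y using that by auto
  have "1 \<notin> L" using one_imp_carrier I_notcarr unfolding ops by auto
  then have 1: "1 \<in> OK - L" using OK(1) by simp
  have mem: "x / y \<in> localization K L" if "x \<in> OK" "y \<in> OK - L" for x y
    using that unfolding localization_def OK_def by blast
  show ?thesis unfolding subring_set_def
  proof (intro conjI ballI)
    show "1 \<in> localization K L" using mem [OF OK(1) 1] by simp
    fix a assume "a \<in> localization K L"
    then obtain x y where a: "a = x / y" "x \<in> OK" "y \<in> OK - L" unfolding localization_def OK_def by blast
    show "- a \<in> localization K L" using mem [OF Om a(3)] a by simp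
    fix b assume "b \<in> localization K L"
    then obtain x' y' where b: "b = x' / y'" "x' \<in> OK" "y' \<in> OK - L" unfolding localization_def OK_def by blast
    have "a + b = (x * y' + x' * y) / (y * y')" using a b nz by (simp add: add_frac_eq)
    then show "a + b \<in> localization K L" using a b OK OL by (auto intro!: mem)
    have "a * b = (x * x') / (y * y')" using a b by simp
    then show "a * b \<in> localization K L" using a b OK OL by (auto intro!: mem)
  qed
qed

section \<open>Laurent polynomials with rational exponents, their products and values\<close>

lemma laurent_decompose: "P = (\<Sum>r\<in>supp P. monomial r (coef P r))"
proof (rule poly_mapping_eqI)
  fix k
  have "coef (\<Sum>r\<in>supp P. monomial r (coef P r)) k
    = (\<Sum>r\<in>supp P. if r = k then coef P k else 0)"
    unfolding lookup_sum by (rule sum.cong) (auto simp: lookup_single when_def)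
  also have "\<dots> = coef P k" by (auto simp: in_keys_iff)
  finally show "coef P k = coef (\<Sum>r\<in>supp P. monomial r (coef P r)) k" ..
qed

lemma laurent_induct [case_names single add]:
  fixes P :: laurent
  assumes single: "\<And>r a. prop (monomial r a)"
    and add: "\<And>P Q. prop P \<Longrightarrow> prop Q \<Longrightarrow> prop (P + Q)"
  shows "prop P"
proof -
  have "prop (\<Sum>r\<in>A. monomial r (coef P r))" if "finite A" for A
    using that
  proof (induction A rule: finite_induct)
    case empty
    show ?case using single [of 0 0] by simp
  next
    case (insert x F)
    then show ?case using single add by simp
  qed
  from this [OF finite_keys [of P]] show ?thesis by (subst laurent_decompose)
qed

lemma lookup_single_mult:
  fixes Q :: laurent
  shows "coef (monomial k a * Q) r = a * coef Q (r - k)"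
proof (induction Q rule: laurent_induct)
  case (single q b)
  then show ?case by (auto simp: mult_single lookup_single when_def)
next
  case (add P Q)
  then show ?case by (simp add: ring_distribs lookup_add)
qed

lemma lookup_times:
  fixes P Q :: laurent
  shows "coef (P * Q) r = (\<Sum>k\<in>supp P. coef P k * coef Q (r - k))"
proof -
  have "P * Q = (\<Sum>k\<in>supp P. monomial k (coef P k) * Q)"
    by (subst (1) laurent_decompose [of P]) (rule sum_distrib_right)
  then show ?thesis by (simp add: lookup_sum lookup_single_mult)
qed

lemma laurent_eval_superset:
  assumes "finite A" "supp P \<subseteq> A"
  shows "laurent_eval P z = (\<Sum>r\<in>A. coef P r * e (of_rat r * z))"
  unfolding laurent_eval_def by (rule sum.mono_neutral_left) (use assms in \<open>auto simp: in_keys_iff\<close>)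

lemma laurent_eval_single [simp]: "laurent_eval (monomial r a) z = a * e (of_rat r * z)"
  by (subst laurent_eval_superset [of "{r}"]) auto

lemma laurent_eval_add [simp]: "laurent_eval (P + Q) z = laurent_eval P z + laurent_eval Q z"
proof -
  define A where "A = supp P \<union> supp Q"
  have "finite A" "supp (P + Q) \<subseteq> A" "supp P \<subseteq> A" "supp Q \<subseteq> A"
    using keys_add [of P Q] by (auto simp: A_def)
  then show ?thesis by (simp add: laurent_eval_superset [of A] lookup_add ring_distribs sum.distrib)
qed

lemma laurent_eval_0 [simp]: "laurent_eval 0 z = 0"
  by (simp add: laurent_eval_def)

lemma laurent_eval_1 [simp]: "laurent_eval 1 z = 1"
  using laurent_eval_single [of 0 1] by simp

lemma laurent_eval_minus [simp]: "laurent_eval (- P) z = - laurent_eval P z"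
  using laurent_eval_add [of P "- P" z] by (simp add: add_eq_0_iff)

lemma laurent_eval_diff [simp]: "laurent_eval (P - Q) z = laurent_eval P z - laurent_eval Q z"
  using laurent_eval_add [of P "- Q" z] by simp

lemma laurent_eval_sum [simp]: "laurent_eval (sum f A) z = (\<Sum>i\<in>A. laurent_eval (f i) z)"
  by (induction A rule: infinite_finite_induct) auto

lemma laurent_eval_mult [simp]: "laurent_eval (P * Q) z = laurent_eval P z * laurent_eval Q z"
proof (induction P rule: laurent_induct)
  case (single r a)
  show ?case
  proof (induction Q rule: laurent_induct)
    case (single q b)
    then show ?case by (simp add: mult_single of_rat_add ring_distribs e_add)
  qed (simp add: ring_distribs)
qed (simp add: ring_distribs)

lemma laurent_eval_power [simp]: "laurent_eval (P ^ n) z = laurent_eval P z ^ n"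
  by (induction n) auto

lemma holomorphic_laurent_eval [holomorphic_intros]: "laurent_eval P holomorphic_on S"
  unfolding laurent_eval_def by (intro holomorphic_intros)

lemma laurent_eval_fourier_expansion: "has_fourier_expansion (laurent_eval P) (coef P)"
  unfolding has_fourier_expansion_def
proof
  fix \<tau>
  have "((\<lambda>n. coef P n * e (of_rat n * \<tau>)) has_sum laurent_eval P \<tau>) (supp P)"
    unfolding laurent_eval_def by (rule has_sum_finite) simp
  then show "((\<lambda>n. coef P n * e (of_rat n * \<tau>)) has_sum laurent_eval P \<tau>) UNIV"
    by (rule has_sum_cong_neutral [THEN iffD1, rotated -1]) (auto simp: in_keys_iff)
qed

lemma fourier_expansion_laurent_mult:
  assumes "has_fourier_expansion g c"
  shows "has_fourier_expansion (\<lambda>z. laurent_eval P z * g z)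
    (\<lambda>r. \<Sum>k\<in>supp P. coef P k * c (r - k))"
  unfolding has_fourier_expansion_def
proof
  fix z assume z: "z \<in> uhp"
  have "((\<lambda>r. \<Sum>k\<in>supp P. coef P k * c (r - k) * e (of_rat r * z)) has_sum
     (\<Sum>k\<in>supp P. coef P k * e (of_rat k * z) * g z)) UNIV"
  proof (rule has_sum_sum)
    fix k
    have "((\<lambda>r. c r * e (of_rat r * z)) has_sum g z) UNIV" using assms z by (simp add: has_fourier_expansion_def)
    then have "((\<lambda>r. c (r - k) * e (of_rat (r - k) * z)) has_sum g z) UNIV"
      by (rule has_sum_reindex_bij_witness [where i = "\<lambda>r. r - k" and j = "\<lambda>r. r + k", THEN iffD1, rotated -1]) auto
    from has_sum_cmult_right [OF this, of "coef P k * e (of_rat k * z)"]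
    moreover have "e (of_rat k * z) * e (of_rat (r - k) * z) = e (of_rat r * z)" for r
      by (simp add: of_rat_diff left_diff_distrib flip: e_add)
    then have "coef P k * e (of_rat k * z) * (c (r - k) * e (of_rat (r - k) * z)) = coef P k * c (r - k) * e (of_rat r * z)" for r
      by (metis mult.assoc mult.left_commute)
    ultimately show "((\<lambda>r. coef P k * c (r - k) * e (of_rat r * z)) has_sum coef P k * e (of_rat k * z) * g z) UNIV"
      by simp
  qed simp
  then show "((\<lambda>r. (\<Sum>k\<in>supp P. coef P k * c (r - k)) * e (of_rat r * z)) has_sum laurent_eval P z * g z) UNIV"
    by (simp add: laurent_eval_def sum_distrib_right)
qed

text \<open>Take the least exponent \<open>r\<close> at which \<open>P\<close> leaves
  \<open>R\<close>. In the coefficient of \<open>P * Q\<close> at \<open>r + qmin\<close>, the terms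
  with smaller exponent of \<open>P\<close> lie in \<open>R\<close> by minimality, and those with
  larger exponent meet \<open>Q\<close> below its lowest term. What remains is
  \<open>coef P r\<close> times the unit \<open>coef Q qmin\<close>.\<close>

lemma coefficients_of_quotient:
  assumes R: "subring_set R" and PQ: "range (coef (P * Q)) \<subseteq> R" and Q: "range (coef Q) \<subseteq> R"
    and v: "v \<in> R" "v * coef Q qmin = 1" and low: "\<And>q. q < qmin \<Longrightarrow> coef Q q = 0"
  shows "range (coef (P :: laurent)) \<subseteq> R"
proof (rule ccontr)
  define B where "B = {r \<in> supp P. coef P r \<notin> R}"
  assume "\<not> ?thesis"
  then obtain r0 where "coef P r0 \<notin> R" by auto
  then have "r0 \<in> B" using subring_setD(6) [OF R] by (auto simp: B_def in_keys_iff)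
  then have "B \<noteq> {}" by blast
  moreover have "finite B" by (simp add: B_def)
  ultimately have m: "Min B \<in> B" "\<And>r. r \<in> B \<Longrightarrow> Min B \<le> r" by auto
  define r where "r = Min B"
  have r: "r \<in> supp P" "coef P r \<notin> R" using m by (auto simp: r_def B_def)
  define rest where "rest = (\<Sum>k\<in>supp P - {r}. coef P k * coef Q (r + qmin - k))"
  have eq: "coef (P * Q) (r + qmin) = coef P r * coef Q qmin + rest"
    unfolding lookup_times rest_def using r by (subst sum.remove [of _ r]) auto
  have "rest \<in> R"
    unfolding rest_def
  proof (rule subring_set_sum [OF R])
    fix k assume k: "k \<in> supp P - {r}"
    show "coef P k * coef Q (r + qmin - k) \<in> R"
    proof (cases "k < r")
      case True
      then have "k \<notin> B" using m(2) [of k] by (auto simp: r_def)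
      then have "coef P k \<in> R" using k by (auto simp: B_def)
      then show ?thesis using Q by (auto intro: subring_setD [OF R])
    next
      case False
      then have "coef Q (r + qmin - k) = 0" using k by (intro low) auto
      then show ?thesis using subring_setD(6) [OF R] by simp
    qed
  qed
  moreover have "coef (P * Q) (r + qmin) \<in> R" using PQ by blast
  ultimately have "coef (P * Q) (r + qmin) - rest \<in> R" using subring_setD(5) [OF R] by blast
  then have "coef P r * coef Q qmin \<in> R" unfolding eq by simp
  then have "v * (coef P r * coef Q qmin) \<in> R" using v subring_setD(3) [OF R] by blast
  moreover have "v * (coef P r * coef Q qmin) = coef P r"
    using v(2) by (metis mult.left_commute mult.right_neutral)
  ultimately show False using r by simp
qed

section \<open>The pole factor and integrality of the leading coefficients\<close>

definition pole_laurent :: laurent where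
  "pole_laurent = monomial (1/2) 1 - monomial (-1/2) 1"

lemma laurent_eval_pole: "laurent_eval pole_laurent z = e (z / 2) - e (- z / 2)"
  by (simp add: pole_laurent_def of_rat_divide of_rat_minus)

lemma lookup_pole_laurent: "coef pole_laurent r = (if r = 1/2 then 1 else if r = -1/2 then -1 else 0)"
  by (auto simp: pole_laurent_def lookup_minus lookup_single when_def)

lemma e_half_diff_eq_0_iff: "e (z / 2) - e (- z / 2) = 0 \<longleftrightarrow> z \<in> \<int>"
  by (simp add: e_eq_iff)

lemma range_lookup_times:
  assumes R: "subring_set R" and "range (coef P) \<subseteq> R" "range (coef Q) \<subseteq> R"
  shows "range (coef (P * Q :: laurent)) \<subseteq> R"
  using assms(2,3) by (auto simp: lookup_times intro!: subring_set_sum [OF R] subring_setD [OF R])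

lemma range_lookup_pole_power:
  assumes R: "subring_set R"
  shows "range (coef (pole_laurent ^ n)) \<subseteq> R"
proof (induction n)
  case 0
  then show ?case using subring_setD [OF R] by (auto simp: lookup_one when_def)
next
  case (Suc n)
  have "range (coef pole_laurent) \<subseteq> R"
    using subring_setD [OF R] by (auto simp: lookup_pole_laurent)
  then show ?case using range_lookup_times [OF R] Suc by simp
qed

lemma coefficients_of_pole_quotient:
  assumes R: "subring_set R" and "range (coef (P * pole_laurent ^ n)) \<subseteq> R"
  shows "range (coef P) \<subseteq> R"
  using assms(2)
proof (induction n arbitrary: P)
  case (Suc n)
  from Suc.IH [of "P * pole_laurent"] Suc.prems have "range (coef (P * pole_laurent)) \<subseteq> R"
    by (simp add: mult.assoc)
  then show ?case
    by (rule coefficients_of_quotient [OF R, where v = "-1" and qmin = "-1/2"])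
       (use subring_setD [OF R] in \<open>auto simp: lookup_pole_laurent\<close>)
qed simp

text \<open>For \<open>\<nu> \<ge> 0\<close> the pole factor is a Laurent polynomial with integer
  coefficients, and \<open>Q\<close> arises by convolution. For \<open>\<nu> < 0\<close> it is
  \<open>Q\<close> times a power of \<open>pole_laurent\<close> that has the coefficients
  \<open>c\<close>, and division by a polynomial with lowest coefficient -1 stays in
  \<open>R\<close>. Uniqueness of Fourier expansions turns equality of functions into equality of
  coefficients.\<close>

lemma leading_coefficient_integral:
  assumes R: "subring_set R" and g: "has_fourier_expansion g c" and c: "range c \<subseteq> R"
    and Q: "\<And>z. z \<in> uhp \<Longrightarrow> laurent_eval Q z = pole_factor \<nu> z * g z"
  shows "range (coef Q) \<subseteq> R"
proof (cases "\<nu> \<ge> 0")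
  case True
  define p where "p = pole_laurent ^ nat \<nu>"
  have "has_fourier_expansion (\<lambda>z. laurent_eval p z * g z) (coef Q)"
    using laurent_eval_fourier_expansion [of Q] True
    by (simp add: has_fourier_expansion_def Q pole_factor_def p_def laurent_eval_pole power_int_def)
  from fourier_expansion_unique [OF this fourier_expansion_laurent_mult [OF g]]
  have "coef Q = (\<lambda>r. \<Sum>k\<in>supp p. coef p k * c (r - k))" .
  then show ?thesis
    using range_lookup_pole_power [OF R, of "nat \<nu>"] c
    by (auto simp: p_def intro!: subring_set_sum [OF R] subring_setD [OF R])
next
  case False
  define p where "p = pole_laurent ^ nat (- \<nu>)"
  have "laurent_eval (Q * p) z = g z" if z: "z \<in> uhp" for z
  proof -
    have "z \<notin> \<int>" using z by (auto simp: uhp_def elim!: Ints_cases)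
    then have nz: "e (z / 2) - e (- z / 2) \<noteq> 0" using e_half_diff_eq_0_iff by blast
    have "laurent_eval p z * pole_factor \<nu> z = 1"
      using False nz by (simp add: p_def laurent_eval_pole pole_factor_def power_int_def del: right_minus_eq flip: power_mult_distrib)
    then show ?thesis using Q [OF z] by (simp add: mult_ac)
  qed
  then have "has_fourier_expansion g (coef (Q * p))"
    using laurent_eval_fourier_expansion [of "Q * p"] by (simp add: has_fourier_expansion_def del: laurent_eval_mult)
  then have "coef (Q * p) = c" using fourier_expansion_unique g by blast
  then show ?thesis using coefficients_of_pole_quotient [OF R, of Q "nat (- \<nu>)"] c by (simp add: p_def)
qed


section \<open>Divisibility by the cyclotomic polynomial\<close>

lemma laurent_eval_cyclotomic: "laurent_eval (cyclotomic l) z = (\<Sum>r<l. e (of_nat r * z))"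
  by (simp add: cyclotomic_def)

lemma laurent_eval_cyclotomic_root:
  assumes "l > 0" "\<not> int l dvd j"
  shows "laurent_eval (cyclotomic l) (of_int j / of_nat l) = 0"
proof -
  have "(of_int j / of_nat l :: complex) \<notin> \<int>"
  proof
    assume "(of_int j / of_nat l :: complex) \<in> \<int>"
    then obtain i where "(of_int j / of_nat l :: complex) = of_int i" by (auto elim: Ints_cases)
    then have "(of_int j :: complex) = of_int (i * int l)" using assms by (simp add: divide_eq_eq)
    then have "j = i * int l" by (simp only: of_int_eq_iff)
    then show False using assms by simp
  qed
  then show ?thesis
    using e_sum_roots [of l "of_int j / of_nat l"] assms by (simp add: laurent_eval_cyclotomic)
qed

lemma lookup_cyclotomic:
  "coef (cyclotomic l) r = (if \<exists>i<l. r = of_nat i then 1 else 0)"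
proof (cases "\<exists>i<l. r = of_nat i")
  case True
  then obtain i where i: "i < l" "r = of_nat i" by blast
  have "coef (cyclotomic l) r = (\<Sum>k<l. if k = i then 1 else 0)"
    unfolding cyclotomic_def lookup_sum by (rule sum.cong) (auto simp: lookup_single when_def i)
  then show ?thesis using i True by simp
next
  case False
  then have "coef (cyclotomic l) r = 0"
    unfolding cyclotomic_def lookup_sum by (intro sum.neutral) (auto simp: lookup_single when_def)
  then show ?thesis using False by simp
qed

text \<open>With \<open>X\<close> for the monomial of exponent 1, the cyclotomic polynomial divides
  \<open>X ^ l - 1\<close>, which divides every \<open>X ^ (n * l) - 1\<close>; a negative exponent
  differs by a monomial factor. This is what permits reducing exponents modulo
  \<open>l\<close>.\<close>

lemma cyclotomic_dvd_single_minus_one: "cyclotomic l dvd monomial (of_int (t * int l)) 1 - 1"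
proof -
  define x :: laurent where "x = monomial (of_nat l) 1"
  have pow: "monomial (of_nat n * r) 1 = (monomial r 1 :: laurent) ^ n" for n r
  proof (induction n)
    case (Suc n)
    have "(monomial r 1 :: laurent) ^ Suc n = monomial r 1 * monomial (of_nat n * r) 1"
      using Suc by simp
    then show ?case by (simp add: mult_single ring_distribs)
  qed simp
  have "cyclotomic l * (monomial 1 1 - 1) = x - 1"
  proof -
    have "cyclotomic l = (\<Sum>i<l. monomial 1 1 ^ i)"
      unfolding cyclotomic_def using pow [of _ 1] by simp
    moreover have "x = monomial 1 1 ^ l" using pow [of l 1] by (simp add: x_def)
    ultimately show ?thesis by (simp add: power_diff_1_eq mult.commute)
  qed
  then have "cyclotomic l dvd x - 1" by (metis dvd_triv_left)
  moreover have "x - 1 dvd x ^ n - 1" for n by (simp add: power_diff_1_eq)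
  ultimately have dvd_nonneg: "cyclotomic l dvd monomial (of_nat n * of_nat l) 1 - 1" for n
    unfolding pow x_def [symmetric] by (rule dvd_trans)
  show ?thesis
  proof (cases t rule: int_cases2)
    case (nonneg n)
    then show ?thesis using dvd_nonneg [of n] by simp
  next
    case (nonpos n)
    have "monomial (of_int (t * int l)) 1 - 1 = (1 - monomial (of_nat n * of_nat l) 1) * (monomial (of_int (t * int l)) 1 :: laurent)"
      using nonpos by (simp add: left_diff_distrib mult_single)
    moreover have "cyclotomic l dvd 1 - monomial (of_nat n * of_nat l) 1"
      using dvd_nonneg [of n] by (metis dvd_minus_iff minus_diff_eq)
    ultimately show ?thesis by simp
  qed
qed

lemma common_denominator:
  assumes "finite (A :: rat set)"
  shows "\<exists>D::nat. D > 0 \<and> (\<forall>r\<in>A. of_nat D * r \<in> \<int>)"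
  using assms
proof (induction A rule: finite_induct)
  case empty
  show ?case by (intro exI [of _ 1]) auto
next
  case (insert q A)
  then obtain D where D: "D > 0" "\<forall>r\<in>A. of_nat D * r \<in> \<int>" by blast
  obtain a b where q: "q = of_int a / of_int b" "b > 0" by (metis Fract_of_int_quotient Rat_cases)
  have b: "(of_nat (nat b) :: rat) = of_int b" using q by simp
  have "of_nat (D * nat b) * q = of_int (int D * a)" using q b by simp
  then have "of_nat (D * nat b) * q \<in> \<int>" by (metis Ints_of_int)
  moreover have "of_nat (D * nat b) * r \<in> \<int>" if "r \<in> A" for r
  proof -
    have "of_nat (D * nat b) * r = of_nat (nat b) * (of_nat D * r)" by simp
    then show ?thesis using D that by (metis Ints_mult Ints_of_nat)
  qed
  ultimately show ?case using D q by (intro exI [of _ "D * nat b"]) auto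
qed

lemma sum_lessThan_mult:
  fixes f :: "nat \<Rightarrow> 'a :: comm_monoid_add"
  shows "(\<Sum>i<l * D. f i) = (\<Sum>r<l. \<Sum>i<D. f (i + r * D))"
proof (induction l)
  case (Suc l)
  have "(\<Sum>i<a + b. f i) = (\<Sum>i<a. f i) + (\<Sum>i<b. f (i + a))" for a b
    by (induction b) (simp_all add: add_ac)
  from this [of "l * D" D] show ?case using Suc by (simp add: add.commute)
qed simp

text \<open>Modulo the cyclotomic polynomial the exponents may be reduced modulo \<open>l\<close>. With exponents in
  \<open>(1/D) \<int>\<close> the reduced coefficients \<open>q\<close> form a function on \<open>\<int>/lD\<close>, and the vanishing says that its
  discrete Fourier transform lives on the multiples of \<open>l\<close>, so that \<open>q\<close> has period \<open>D\<close>.\<close>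

lemma cyclotomic_dvd_of_vanishing:
  assumes l: "l > 0"
    and vanish: "\<And>j. \<not> int l dvd j \<Longrightarrow> laurent_eval P (of_int j / of_nat l) = 0"
  shows "cyclotomic l dvd P"
proof -
  obtain D where D: "D > 0" "\<And>r. r \<in> supp P \<Longrightarrow> of_nat D * r \<in> \<int>"
    using common_denominator [OF finite_keys [of P]] by blast
  define n where "n = l * D"
  have "n > 0" using l D by (simp add: n_def)
  \<comment> \<open>Reducing the numerator over \<open>D\<close> modulo \<open>n = l * D\<close>
    reduces the exponent itself modulo \<open>l\<close>.\<close>
  define red where "red r = nat (\<lfloor>of_nat D * r\<rfloor> mod int n)" for r :: rat
  have red_less: "red r < n" for r using \<open>n > 0\<close> by (simp add: red_def nat_less_iff)
  define p where "p = coef P"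
  define q where "q i = (\<Sum>r\<in>{r \<in> supp P. red r = i}. p r)" for i
  define Q :: laurent where "Q = (\<Sum>i<n. monomial (of_nat i / of_nat D) (q i))"
  have single_red: "cyclotomic l dvd monomial r (p r) - monomial (of_nat (red r) / of_nat D) (p r)"
    if r: "r \<in> supp P" for r
  proof -
    define m where "m = \<lfloor>of_nat D * r\<rfloor>"
    have m: "of_nat D * r = of_int m" using D(2) [OF r] by (auto simp: m_def elim!: Ints_cases)
    define t where "t = m div int n"
    have "int (red r) = m mod int n" using \<open>n > 0\<close> by (simp add: red_def m_def)
    then have "m = int (red r) + t * int n" by (simp add: t_def)
    then have "of_nat D * r = of_nat (red r) + of_int t * of_nat n" unfolding m by simp
    then have "r = of_nat (red r) / of_nat D + of_int (t * int l)" using D by (simp add: field_simps n_def)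
    then have "monomial r (p r) = monomial (of_nat (red r) / of_nat D) (p r) * monomial (of_int (t * int l)) 1"
      unfolding mult_single by simp
    then have "monomial r (p r) - monomial (of_nat (red r) / of_nat D) (p r)
      = monomial (of_nat (red r) / of_nat D) (p r) * (monomial (of_int (t * int l)) 1 - 1)"
      by (simp add: right_diff_distrib)
    then show ?thesis using cyclotomic_dvd_single_minus_one by simp
  qed
  have "Q = (\<Sum>i<n. \<Sum>r\<in>{r \<in> supp P. red r = i}. monomial (of_nat (red r) / of_nat D) (p r))"
    unfolding Q_def
  proof (rule sum.cong [OF refl])
    fix i
    have hom: "monomial k (\<Sum>r\<in>A. p r) = (\<Sum>r\<in>A. monomial k (p r))" for A and k :: rat
      by (induction A rule: infinite_finite_induct) (auto simp: single_add)
    show "(monomial (of_nat i / of_nat D) (q i) :: laurent) = (\<Sum>r\<in>{r \<in> supp P. red r = i}. monomial (of_nat (red r) / of_nat D) (p r))"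
      unfolding q_def hom by (rule sum.cong) auto
  qed
  also have "\<dots> = (\<Sum>r\<in>supp P. monomial (of_nat (red r) / of_nat D) (p r))"
    by (rule sum.group) (auto simp: red_less)
  finally have "P - Q = (\<Sum>r\<in>supp P. monomial r (p r) - monomial (of_nat (red r) / of_nat D) (p r))"
    unfolding sum_subtractf p_def by (simp flip: laurent_decompose)
  then have PQ: "cyclotomic l dvd P - Q" using single_red by (simp add: dvd_sum)
  have Q0: "(\<Sum>i<n. q i * e (of_nat i * of_int j / of_nat n)) = 0" if "\<not> int l dvd j" for j
  proof -
    obtain S where "P - Q = cyclotomic l * S" using PQ by (rule dvdE)
    then have "laurent_eval (P - Q) (of_int j / of_nat l) = 0"
      using laurent_eval_cyclotomic_root [OF l that] by simp
    then have "laurent_eval Q (of_int j / of_nat l) = 0" using vanish [OF that] by simp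
    then show ?thesis using D l by (simp add: Q_def n_def of_rat_divide mult.commute)
  qed
  have q_dft: "of_nat n * q i = (\<Sum>j<n. e (- (of_nat i * of_nat j / of_nat n)) * (\<Sum>k<n. q k * e (of_nat k * of_nat j / of_nat n)))" if "i < n" for i
  proof -
    have "(\<Sum>j<n. e (- (of_nat i * of_nat j / of_nat n)) * (\<Sum>k<n. q k * e (of_nat k * of_nat j / of_nat n)))
      = (\<Sum>k<n. q k * (\<Sum>j<n. e (of_nat j * ((of_nat k - of_nat i) / of_nat n))))"
    proof -
      have eq: "e (- (of_nat i * of_nat j / of_nat n)) * (q k * e (of_nat k * of_nat j / of_nat n)) = q k * e (of_nat j * ((of_nat k - of_nat i) / of_nat n))" for j k
      proof -
        have "of_nat j * ((of_nat k - of_nat i) / of_nat n) = - (of_nat i * of_nat j / of_nat n) + of_nat k * of_nat j / (of_nat n :: complex)"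
          by (simp add: diff_divide_distrib right_diff_distrib mult.commute)
        then have "e (of_nat j * ((of_nat k - of_nat i) / of_nat n)) = e (- (of_nat i * of_nat j / of_nat n)) * e (of_nat k * of_nat j / of_nat n)"
          by (simp only: e_add)
        then show ?thesis by (simp del: of_nat_mult)
      qed
      show ?thesis unfolding sum_distrib_left by (subst sum.swap) (simp only: eq)
    qed
    also have "\<dots> = (\<Sum>k<n. if k = i then q k * of_nat n else 0)"
    proof (rule sum.cong [OF refl])
      fix k assume "k \<in> {..<n}"
      have int: "of_nat n * ((of_nat k - of_nat i) / of_nat n) \<in> (\<int> :: complex set)" using \<open>n > 0\<close> by simp
      have "((of_nat k - of_nat i) / of_nat n \<in> (\<int> :: complex set)) \<longleftrightarrow> k = i"
      proof
        assume "(of_nat k - of_nat i) / of_nat n \<in> (\<int> :: complex set)"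
        then obtain t where "(of_nat k - of_nat i) / of_nat n = (of_int t :: complex)" by (auto elim: Ints_cases)
        then have "(of_int (int k - int i) :: complex) = of_int (t * int n)" using \<open>n > 0\<close> by (simp add: divide_eq_eq)
        then have *: "int k - int i = t * int n" by (simp only: of_int_eq_iff)
        have less: "\<bar>int k - int i\<bar> < int n" using that \<open>k \<in> {..<n}\<close> by auto
        have "t = 0"
        proof (rule ccontr)
          assume "t \<noteq> 0"
          then have "1 \<le> \<bar>t\<bar>" by linarith
          from mult_right_mono [OF this, of "int n"] less show False by (simp add: * abs_mult)
        qed
        then show "k = i" using * by simp
      qed simp
      then show "q k * (\<Sum>j<n. e (of_nat j * ((of_nat k - of_nat i) / of_nat n))) = (if k = i then q k * of_nat n else 0)"
        using e_sum_roots [OF \<open>n > 0\<close> int] by simp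
    qed
    finally show ?thesis using that by (simp add: mult.commute)
  qed
  have q_shift: "q (i + r * D) = q i" if "i + r * D < n" for i r
  proof -
    have "of_nat n * q (i + r * D) = of_nat n * q i"
      using that unfolding q_dft [OF that] q_dft [of i, OF le_less_trans [OF le_add1 that]]
    proof (intro sum.cong [OF refl])
      fix j
      show "e (- (of_nat (i + r * D) * of_nat j / of_nat n)) * (\<Sum>k<n. q k * e (of_nat k * of_nat j / of_nat n))
        = e (- (of_nat i * of_nat j / of_nat n)) * (\<Sum>k<n. q k * e (of_nat k * of_nat j / of_nat n))"
      \<comment> \<open>A frequency divisible by \<open>l\<close> does not see a shift by
        \<open>r * D\<close>, as \<open>n = l * D\<close>; at the other frequencies the transform is
        0 by \<open>Q0\<close>.\<close>
      proof (cases "int l dvd int j")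
        case True
        then obtain j' where "j = l * j'" by (metis int_dvd_int_iff dvdE)
        then have "- (of_nat (i + r * D) * of_nat j / of_nat n) = - (of_nat i * of_nat j / of_nat n) + (of_int (- int (r * j')) :: complex)"
          using l D by (simp add: n_def field_simps)
        then show ?thesis by (simp only: e_add_of_int)
      next
        case False
        then show ?thesis using Q0 [OF False] by simp
      qed
    qed
    then show ?thesis using \<open>n > 0\<close> by simp
  qed
  \<comment> \<open>Period \<open>D\<close> makes the \<open>l\<close> blocks of length
    \<open>D\<close> copies of the first one, shifted by the exponents \<open>0, ..., l - 1\<close>;
    these shifts form the factor \<open>cyclotomic l\<close>.\<close>
  have "Q = (\<Sum>r<l. \<Sum>i<D. monomial (of_nat (i + r * D) / of_nat D) (q (i + r * D)))"
    unfolding Q_def n_def by (rule sum_lessThan_mult)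
  also have "\<dots> = (\<Sum>r<l. \<Sum>i<D. monomial (of_nat r) 1 * monomial (of_nat i / of_nat D) (q i))"
  proof (intro sum.cong refl)
    fix r i assume "r \<in> {..<l}" "i \<in> {..<D}"
    then have "r + 1 \<le> l" "i < D" by auto
    then have "(r + 1) * D \<le> n" unfolding n_def by (intro mult_le_mono1)
    then have "i + r * D < n" using \<open>i < D\<close> by simp
    then show "(monomial (of_nat (i + r * D) / of_nat D) (q (i + r * D)) :: laurent) = monomial (of_nat r) 1 * monomial (of_nat i / of_nat D) (q i)"
      using D by (simp add: mult_single q_shift add_divide_distrib add.commute)
  qed
  also have "\<dots> = cyclotomic l * (\<Sum>i<D. monomial (of_nat i / of_nat D) (q i))"
    unfolding cyclotomic_def sum_product ..
  finally have "cyclotomic l dvd Q" by simp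
  then show ?thesis using PQ by (metis dvd_diff_right_iff dvd_minus_iff minus_diff_eq)
qed

text \<open>Divisibility holds at first over the complex numbers. The lowest coefficient of the
  cyclotomic polynomial is 1, so the quotient has its coefficients in \<open>R\<close>.\<close>

lemma laurent_dvd_cyclotomicI:
  assumes R: "subring_set R" and l: "l > 0" and P: "range (coef P) \<subseteq> R"
    and vanish: "\<And>j. \<not> int l dvd j \<Longrightarrow> laurent_eval P (of_int j / of_nat l) = 0"
  shows "laurent_dvd R (cyclotomic l) P"
proof -
  obtain S where S: "P = cyclotomic l * S" using cyclotomic_dvd_of_vanishing [OF l vanish] by blast
  have "range (coef S) \<subseteq> R"
  proof (rule coefficients_of_quotient [OF R])
    show "range (coef (S * cyclotomic l)) \<subseteq> R" using P S by (simp add: mult.commute)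
    show "range (coef (cyclotomic l)) \<subseteq> R" using subring_setD [OF R] by (auto simp: lookup_cyclotomic)
    show "1 \<in> R" by (rule subring_setD [OF R])
    show "1 * coef (cyclotomic l) 0 = 1" using l by (auto simp: lookup_cyclotomic)
    show "coef (cyclotomic l) q = 0" if "q < 0" for q using that by (auto simp: lookup_cyclotomic)
  qed
  then show ?thesis unfolding laurent_dvd_def using S by blast
qed

section \<open>Theta near the cusps\<close>

lemma has_sum_int:
  fixes f :: "int \<Rightarrow> 'a :: {topological_comm_monoid_add, t3_space}"
  assumes "((\<lambda>m. f (int m)) has_sum a) UNIV" "((\<lambda>m. f (- 1 - int m)) has_sum b) UNIV"
  shows "(f has_sum (a + b)) UNIV"
proof -
  have "(f has_sum a) {0..}"
    by (rule has_sum_reindex_bij_witness [where i = int and j = nat, THEN iffD2, OF _ _ _ _ _ _ assms(1)]) auto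
  moreover have "(f has_sum b) {..<0}"
    by (rule has_sum_reindex_bij_witness [where i = "\<lambda>m. - 1 - int m" and j = "\<lambda>n. nat (- 1 - n)", THEN iffD2, OF _ _ _ _ _ _ assms(2)]) auto
  ultimately have "(f has_sum (a + b)) ({0..} \<union> {..<0})"
    by (rule has_sum_Un_disjoint) auto
  moreover have "{0..} \<union> {..<0} = (UNIV :: int set)" by auto
  ultimately show ?thesis by simp
qed

section \<open>Gaussian sums with periodic weights\<close>

definition gauss :: "real \<Rightarrow> int \<Rightarrow> real" where
  "gauss y n = exp (- 2 * pi * y * of_int n ^ 2)"

lemma gauss_pos: "gauss y n > 0"
  by (simp add: gauss_def)

lemma gauss_0 [simp]: "gauss y 0 = 1"
  by (simp add: gauss_def)

lemma gauss_even: "gauss y (- n) = gauss y n"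
  by (simp add: gauss_def)

lemma gauss_antimono:
  assumes "y > 0"
  shows "gauss y (int (Suc m)) \<le> gauss y (int m)"
  using assms by (simp add: gauss_def power_mono)

lemma gauss_le_geometric:
  assumes "y > 0"
  shows "gauss y (int m) \<le> exp (- 2 * pi * y) ^ m"
proof -
  have "m \<le> m ^ 2" by (simp add: power2_eq_square)
  then have "real m \<le> real m ^ 2" by (metis of_nat_le_iff of_nat_power)
  then have "gauss y (int m) \<le> exp (of_nat m * (- 2 * pi * y))"
    using assms by (simp add: gauss_def)
  then show ?thesis by (simp only: exp_of_nat_mult)
qed

lemma gauss_summable_nat:
  assumes "y > 0"
  shows "(\<lambda>m. gauss y (int m)) summable_on UNIV"
proof -
  have "summable (\<lambda>m. gauss y (int m))"
  proof (rule summable_comparison_test')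
    show "summable (\<lambda>m. exp (- 2 * pi * y) ^ m)" using assms by (intro summable_geometric) simp
    show "norm (gauss y (int m)) \<le> exp (- 2 * pi * y) ^ m" for m
      using gauss_le_geometric [OF assms, of m] gauss_pos [of y "int m"] by simp
  qed
  then show ?thesis by (subst summable_on_UNIV_nonneg_real_iff) (simp_all add: gauss_pos less_imp_le)
qed

lemma gauss_summable:
  assumes "y > 0"
  shows "gauss y summable_on UNIV"
proof -
  have "(\<lambda>m. gauss y (int (Suc m))) summable_on UNIV"
    using summable_on_imp_summable [OF gauss_summable_nat [OF assms]]
    by (subst summable_on_UNIV_nonneg_real_iff) (simp_all only: gauss_pos less_imp_le summable_Suc_iff [of "\<lambda>m. gauss y (int m)"])
  moreover have "gauss y (- 1 - int m) = gauss y (int (Suc m))" for m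
    using gauss_even [of y "int (Suc m)"] by (simp add: add.commute)
  ultimately have "(\<lambda>m. gauss y (- 1 - int m)) summable_on UNIV" by (simp only:)
  with gauss_summable_nat [OF assms] show ?thesis
    unfolding summable_on_def using has_sum_int [of "gauss y"] by blast
qed

text \<open>The Gaussian climbs from 0 to 1 and falls back to 0, monotone on each side, so each half
  telescopes to 1.\<close>

lemma gauss_total_variation:
  assumes "y > 0"
  shows "((\<lambda>n. \<bar>gauss y n - gauss y (n + 1)\<bar>) has_sum 2) UNIV"
proof -
  have lim: "(\<lambda>m. gauss y (int m)) \<longlonglongrightarrow> 0"
    using gauss_summable_nat [OF assms] summable_LIMSEQ_zero summable_on_imp_summable by blast
  have *: "((\<lambda>m. \<bar>gauss y (int m) - gauss y (int (Suc m))\<bar>) has_sum 1) UNIV"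
  proof (rule sums_nonneg_imp_has_sum)
    show "(\<lambda>m. \<bar>gauss y (int m) - gauss y (int (Suc m))\<bar>) sums 1"
      using telescope_sums' [OF lim] gauss_antimono [OF assms] by simp
  qed simp
  have "((\<lambda>n. \<bar>gauss y n - gauss y (n + 1)\<bar>) has_sum (1 + 1)) UNIV"
  proof (rule has_sum_int)
    show "((\<lambda>m. \<bar>gauss y (int m) - gauss y (int m + 1)\<bar>) has_sum 1) UNIV"
      using * by (simp add: add.commute)
    have "gauss y (- 1 - int m) = gauss y (int (Suc m))" "gauss y (- 1 - int m + 1) = gauss y (int m)" for m
      using gauss_even [of y "int (Suc m)"] gauss_even [of y "int m"] by (simp_all add: add.commute)
    then show "((\<lambda>m. \<bar>gauss y (- 1 - int m) - gauss y (- 1 - int m + 1)\<bar>) has_sum 1) UNIV"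
      using * by (simp add: abs_minus_commute)
  qed
  then show ?thesis by simp
qed

lemma norm_infsum_diff_le:
  fixes f :: "'a \<Rightarrow> complex"
  assumes "(f has_sum a) UNIV" "(g has_sum b) UNIV" "(h has_sum c) UNIV" "\<And>n. norm (f n - g n) \<le> h n"
  shows "norm (a - b) \<le> c"
proof (rule norm_infsum_le)
  show "((\<lambda>n. f n - g n) has_sum (a - b)) UNIV"
    using has_sum_add [OF assms(1) has_sum_uminusI [OF assms(2)]] by simp
qed (use assms in auto)

text \<open>Shifting the Gaussian by one changes the sum by at most its total variation; averaging over
  \<open>P\<close> shifts turns the weight into its mean.\<close>

lemma gauss_periodic_weight:
  fixes w :: "int \<Rightarrow> complex"
  assumes y: "y > 0" and P: "P > 0"
    and le1: "\<And>n. norm (w n) \<le> 1" and per: "\<And>n. w (n + int P) = w n" and even: "\<And>n. w (- n) = w n"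
  shows "norm (infsum (\<lambda>n. w n * of_real (gauss y n)) UNIV - (\<Sum>j<P. w (int j)) / of_nat P * infsum (\<lambda>n. of_real (gauss y n)) UNIV) \<le> 2 * real P"
proof -
  have shift: "(\<lambda>n. gauss y (n + int j)) summable_on UNIV" for j
    by (rule summable_on_reindex_bij_witness [where i = "\<lambda>n. n - int j" and j = "\<lambda>n. n + int j", THEN iffD2, OF _ _ _ _ _ gauss_summable [OF y]]) auto
  have bound: "norm (w n * of_real (gauss y (n + int j))) \<le> gauss y (n + int j)" for n j
    using mult_right_mono [OF le1 [of n], of "gauss y (n + int j)"] gauss_pos [of y "n + int j"] by (simp add: norm_mult)
  have sm: "(\<lambda>n. w n * of_real (gauss y (n + int j))) summable_on UNIV" for j
    by (rule Infinite_Sum.abs_summable_summable, rule Infinite_Sum.abs_summable_on_comparison_test' [OF shift bound])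
  define T where "T j = infsum (\<lambda>n. w n * of_real (gauss y (n + int j))) UNIV" for j
  have T: "((\<lambda>n. w n * of_real (gauss y (n + int j))) has_sum T j) UNIV" for j
    unfolding T_def using sm by (rule has_sum_infsum)
  have step: "norm (T j - T (Suc j)) \<le> 2" for j
  proof (rule norm_infsum_diff_le [OF T T])
    show "((\<lambda>n. \<bar>gauss y (n + int j) - gauss y (n + int j + 1)\<bar>) has_sum 2) UNIV"
      by (rule has_sum_reindex_bij_witness [where i = "\<lambda>n. n - int j" and j = "\<lambda>n. n + int j", THEN iffD2, OF _ _ _ _ _ _ gauss_total_variation [OF y]]) auto
    show "norm (w n * of_real (gauss y (n + int j)) - w n * of_real (gauss y (n + int (Suc j)))) \<le> \<bar>gauss y (n + int j) - gauss y (n + int j + 1)\<bar>" for n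
    proof -
      have "w n * of_real (gauss y (n + int j)) - w n * of_real (gauss y (n + int (Suc j))) = w n * of_real (gauss y (n + int j) - gauss y (n + int j + 1))"
        by (simp add: right_diff_distrib add_ac)
      then show ?thesis using mult_right_mono [OF le1 [of n], of "\<bar>gauss y (n + int j) - gauss y (n + int j + 1)\<bar>"]
        by (simp only: norm_mult norm_of_real) simp
    qed
  qed
  have T0: "norm (T 0 - T j) \<le> 2 * real j" for j
  proof (induction j)
    case (Suc j)
    have "norm (T 0 - T (Suc j)) \<le> norm (T 0 - T j) + norm (T j - T (Suc j))"
      using norm_triangle_ineq [of "T 0 - T j" "T j - T (Suc j)"] by simp
    then show ?case using Suc step [of j] by simp
  qed simp
  \<comment> \<open>The sum of \<open>w\<close> over \<open>P\<close> consecutive integers does not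
    depend on where they start; evenness of \<open>w\<close> then replaces \<open>- j\<close> by
    \<open>j\<close>.\<close>
  have mean: "(\<Sum>j<P. w (n - int j)) = (\<Sum>j<P. w (int j))" for n
  proof -
    have suc: "(\<Sum>j<P. w (n + 1 - int j)) = (\<Sum>j<P. w (n - int j))" for n
    proof -
      have "(\<Sum>j<Suc P. w (n + 1 - int j)) = w (n + 1) + (\<Sum>j<P. w (n - int j))"
        by (subst sum.lessThan_Suc_shift) simp
      moreover have "w (n + 1 - int P) = w (n + 1)" using per [of "n + 1 - int P"] by simp
      ultimately show ?thesis by (simp add: add.commute)
    qed
    have "(\<Sum>j<P. w (n - int j)) = (\<Sum>j<P. w (0 - int j))"
    proof (induction n rule: int_induct [where k = 0])
      case (step1 i)
      then show ?case using suc [of i] by simp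
    next
      case (step2 i)
      then show ?case using suc [of "i - 1"] by simp
    qed simp
    then show ?thesis by (simp add: even)
  qed
  define E where "E = infsum (\<lambda>n. of_real (gauss y n) :: complex) UNIV"
  have E: "((\<lambda>n. of_real (gauss y n) :: complex) has_sum E) UNIV"
    unfolding E_def using gauss_summable [OF y] by (intro has_sum_infsum summable_on_of_real)
  have "((\<lambda>n. w (n - int j) * of_real (gauss y n)) has_sum T j) UNIV" for j
    by (rule has_sum_reindex_bij_witness [where i = "\<lambda>n. n + int j" and j = "\<lambda>n. n - int j", THEN iffD2, OF _ _ _ _ _ _ T]) auto
  then have "((\<lambda>n. \<Sum>j<P. w (n - int j) * of_real (gauss y n)) has_sum (\<Sum>j<P. T j)) UNIV"
    by (intro has_sum_sum) auto
  then have "((\<lambda>n. (\<Sum>j<P. w (int j)) * of_real (gauss y n)) has_sum (\<Sum>j<P. T j)) UNIV"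
    by (simp add: mean flip: sum_distrib_right)
  then have ET: "(\<Sum>j<P. T j) = (\<Sum>j<P. w (int j)) * E"
    using has_sum_cmult_right [OF E] has_sum_unique by blast
  have "norm (\<Sum>j<P. T 0 - T j) \<le> (\<Sum>j<P. 2 * real P)"
  proof (rule sum_norm_le)
    fix j assume "j \<in> {..<P}"
    then show "norm (T 0 - T j) \<le> 2 * real P" using T0 [of j] by simp
  qed
  also have "(\<Sum>j<P. T 0 - T j) = of_nat P * (T 0 - (\<Sum>j<P. w (int j)) / of_nat P * E)"
    using P by (simp add: sum_subtractf ET right_diff_distrib)
  finally have "real P * norm (T 0 - (\<Sum>j<P. w (int j)) / of_nat P * E) \<le> real P * (2 * real P)"
    by (simp add: norm_mult)
  then have "norm (T 0 - (\<Sum>j<P. w (int j)) / of_nat P * E) \<le> 2 * real P" using P by simp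
  then show ?thesis by (simp add: T_def E_def)
qed

lemma e_eq_gauss: "e (of_int n ^ 2 * (x + \<i> * of_real y)) = e (of_int n ^ 2 * x) * of_real (gauss y n)"
proof -
  have "e (of_int n ^ 2 * (\<i> * of_real y)) = of_real (gauss y n)"
    by (simp add: e_def gauss_def exp_of_real [symmetric] mult_ac)
  then show ?thesis by (simp add: ring_distribs e_add)
qed

lemma norm_e_square: "norm (e (of_int n ^ 2 * \<tau>)) = gauss (Im \<tau>) n"
proof -
  have "Im (of_int n ^ 2 * \<tau>) = of_int n ^ 2 * Im \<tau>"
    by (metis Im_complex_of_real Re_complex_of_real add.commute add_0 mult_zero_left of_real_of_int_eq of_real_power times_complex.simps(2))
  then show ?thesis by (simp add: norm_e gauss_def mult_ac)
qed

lemma theta_has_sum: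
  assumes "\<tau> \<in> uhp"
  shows "((\<lambda>n::int. e (of_int n ^ 2 * \<tau>)) has_sum theta \<tau>) UNIV"
  unfolding theta_def
proof (rule has_sum_infsum, rule Infinite_Sum.abs_summable_summable)
  show "(\<lambda>n::int. norm (e (of_int n ^ 2 * \<tau>))) summable_on UNIV"
    unfolding norm_e_square by (rule gauss_summable) (use assms in \<open>simp add: uhp_def\<close>)
qed

lemma theta_bound:
  assumes "\<tau> \<in> uhp"
  defines "r \<equiv> exp (- 2 * pi * Im \<tau>)"
  shows "norm (theta \<tau> - 1) \<le> 2 * (r / (1 - r))"
proof -
  have y: "Im \<tau> > 0" using assms by (simp add: uhp_def)
  have r: "0 < r" "r < 1" using y by (simp_all add: r_def)
  define f where "f n = e (of_int n ^ 2 * \<tau>)" for n :: int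
  have f: "(f has_sum theta \<tau>) UNIV" unfolding f_def by (rule theta_has_sum) fact
  have nf: "norm (f (int (Suc m))) \<le> r ^ Suc m" "norm (f (- 1 - int m)) \<le> r ^ Suc m" for m
    using gauss_le_geometric [OF y, of "Suc m"] gauss_even [of "Im \<tau>" "int (Suc m)"]
    unfolding f_def norm_e_square r_def by auto
  have geo: "((\<lambda>m. r ^ Suc m) has_sum (r / (1 - r))) UNIV"
  proof (rule sums_nonneg_imp_has_sum)
    show "(\<lambda>m. r ^ Suc m) sums (r / (1 - r))"
      using sums_mult [OF geometric_sums [of r], of r] r by simp
  qed (use r in auto)
  have sum: "\<exists>s. (g has_sum s) UNIV \<and> norm s \<le> r / (1 - r)" if "\<And>m. norm (g m) \<le> r ^ Suc m" for g :: "nat \<Rightarrow> complex"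
  proof -
    have "g summable_on UNIV"
      by (rule Infinite_Sum.abs_summable_summable, rule Infinite_Sum.abs_summable_on_comparison_test' [OF _ that]) (use geo in \<open>auto dest: has_sum_imp_summable\<close>)
    then obtain s where s: "(g has_sum s) UNIV" unfolding summable_on_def by blast
    then have "norm s \<le> r / (1 - r)" using norm_infsum_le [OF s geo] that by blast
    then show ?thesis using s by blast
  qed
  obtain s1 where s1: "((\<lambda>m. f (int (Suc m))) has_sum s1) UNIV" "norm s1 \<le> r / (1 - r)" using sum [OF nf(1)] by auto
  obtain s2 where s2: "((\<lambda>m. f (- 1 - int m)) has_sum s2) UNIV" "norm s2 \<le> r / (1 - r)" using sum [OF nf(2)] by auto
  have "((\<lambda>m. f (int m)) has_sum (1 + s1)) UNIV"
  proof -
    have "((\<lambda>m. f (int m)) has_sum s1) {Suc 0..}"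
      by (rule has_sum_reindex_bij_witness [where i = Suc and j = "\<lambda>m. m - 1", THEN iffD2, OF _ _ _ _ _ _ s1(1)]) auto
    from has_sum_insert [OF _ this, of 0]
    have "((\<lambda>m. f (int m)) has_sum (f 0 + s1)) (insert 0 {Suc 0..})" by simp
    moreover have "insert 0 {Suc 0..} = UNIV" by auto
    ultimately show ?thesis by (simp add: f_def)
  qed
  from has_sum_int [OF this s2(1)] have "theta \<tau> = 1 + s1 + s2" using f has_sum_unique by blast
  then show ?thesis using norm_triangle_ineq [of s1 s2] s1(2) s2(2) by simp
qed

lemma theta_tendsto_1:
  assumes "\<forall>\<^sub>F x in F. g x \<in> uhp" "filterlim (\<lambda>x. Im (g x)) at_top F"
  shows "((\<lambda>x. theta (g x)) \<longlongrightarrow> 1) F"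
proof -
  have r: "((\<lambda>t. exp (- 2 * pi * t)) \<longlongrightarrow> 0) at_top" by real_asymp
  have "((\<lambda>x. exp (- 2 * pi * Im (g x))) \<longlongrightarrow> 0) F"
    using filterlim_compose [OF r assms(2)] by simp
  then have "((\<lambda>x. 2 * (exp (- 2 * pi * Im (g x)) / (1 - exp (- 2 * pi * Im (g x))))) \<longlongrightarrow> 2 * (0 / (1 - 0))) F"
    by (intro tendsto_intros) auto
  then have lim0: "((\<lambda>x. 2 * (exp (- 2 * pi * Im (g x)) / (1 - exp (- 2 * pi * Im (g x))))) \<longlongrightarrow> 0) F" by simp
  have "\<forall>\<^sub>F x in F. norm (theta (g x) - 1) \<le> 2 * (exp (- 2 * pi * Im (g x)) / (1 - exp (- 2 * pi * Im (g x))))"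
    using assms(1) by eventually_elim (rule theta_bound)
  from Lim_null_comparison [OF this lim0] show ?thesis by (simp add: LIM_zero_iff)
qed

section \<open>Quadratic Gauss sums to square moduli, and theta above a cusp\<close>

lemma of_int_div_of_nat_in_Ints_iff:
  assumes "q > 0"
  shows "(of_int k / of_nat q :: complex) \<in> \<int> \<longleftrightarrow> int q dvd k"
proof
  assume "(of_int k / of_nat q :: complex) \<in> \<int>"
  then obtain i where "(of_int k / of_nat q :: complex) = of_int i" by (auto elim: Ints_cases)
  then have "(of_int k :: complex) = of_int (i * int q)" using assms by (simp add: divide_eq_eq)
  then have "k = i * int q" by (simp only: of_int_eq_iff)
  then show "int q dvd k" by simp
qed (use assms in auto)

text \<open>Write \<open>n = x + r * q\<close>. Modulo \<open>q ^ 2\<close> the square is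
  \<open>x ^ 2 + 2 * x * r * q\<close>, so the sum over \<open>r\<close> runs over
  \<open>q\<close>-th roots of unity and vanishes unless \<open>q\<close> divides
  \<open>2 * x\<close>, that is, \<open>x = 0\<close> or \<open>x = q / 2\<close>. These two
  contribute 1 and \<open>e (a / 4)\<close>; no quadratic residue symbol arises.\<close>

lemma gauss_sum_square:
  assumes "even q" "q > 0" "coprime a (int q)"
  shows "(\<Sum>n<q ^ 2. e (of_int (int n) ^ 2 * (of_int a / of_nat (q ^ 2)))) = of_nat q * (1 + e (of_int a / 4))"
proof -
  have expand: "e (of_int (int (x + r * q)) ^ 2 * (of_int a / of_nat (q ^ 2)))
      = e (of_nat x ^ 2 * (of_int a / of_nat (q ^ 2))) * e (of_nat r * (of_int (2 * a * int x) / of_nat q))" for x r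
  proof -
    have "of_int (int (x + r * q)) ^ 2 * (of_int a / of_nat (q ^ 2))
      = of_nat x ^ 2 * (of_int a / of_nat (q ^ 2)) + of_nat r * (of_int (2 * a * int x) / of_nat q) + (of_int (a * int r ^ 2) :: complex)"
      using assms by (simp add: field_simps power2_eq_square)
    then show ?thesis by (simp only: e_add e_of_int mult_1_right)
  qed
  obtain p where p: "q = 2 * p" "p > 0" using assms by auto
  have inner: "(\<Sum>r<q. e (of_nat r * (of_int (2 * a * int x) / of_nat q))) = (if x = 0 \<or> x = p then of_nat q else 0)" if "x < q" for x
  proof -
    have int: "of_nat q * (of_int (2 * a * int x) / of_nat q) \<in> (\<int> :: complex set)" using assms by simp
    have "int q dvd 2 * a * int x \<longleftrightarrow> x = 0 \<or> x = p"
    proof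
      assume "int q dvd 2 * a * int x"
      then have "int q dvd a * (2 * int x)" by (simp add: mult_ac)
      then have "int q dvd 2 * int x" using assms(3) by (simp add: coprime_dvd_mult_right_iff coprime_commute)
      then have "int p dvd int x" using p by simp
      then have "p dvd x" by simp
      then obtain k where k: "x = p * k" by blast
      then have "k < 2" using that p by simp
      then show "x = 0 \<or> x = p" using k by (cases k) auto
    qed (use p in auto)
    then show ?thesis using e_sum_roots [OF assms(2) int] of_int_div_of_nat_in_Ints_iff [OF assms(2), of "2 * a * int x"] by simp
  qed
  have "(\<Sum>n<q ^ 2. e (of_int (int n) ^ 2 * (of_int a / of_nat (q ^ 2))))
    = (\<Sum>x<q. e (of_nat x ^ 2 * (of_int a / of_nat (q ^ 2))) * (\<Sum>r<q. e (of_nat r * (of_int (2 * a * int x) / of_nat q))))"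
    unfolding power2_eq_square [of q] sum_lessThan_mult
    unfolding power2_eq_square [of q, symmetric] expand sum_distrib_left by (rule sum.swap)
  also have "\<dots> = (\<Sum>x<q. if x = 0 \<or> x = p then e (of_nat x ^ 2 * (of_int a / of_nat (q ^ 2))) * of_nat q else 0)"
  proof (rule sum.cong [OF refl])
    fix x assume "x \<in> {..<q}"
    then have "x < q" by simp
    show "e (of_nat x ^ 2 * (of_int a / of_nat (q ^ 2))) * (\<Sum>r<q. e (of_nat r * (of_int (2 * a * int x) / of_nat q)))
      = (if x = 0 \<or> x = p then e (of_nat x ^ 2 * (of_int a / of_nat (q ^ 2))) * of_nat q else 0)"
      unfolding inner [OF \<open>x < q\<close>] by simp
  qed
  also have "\<dots> = (\<Sum>x\<in>{0, p}. e (of_nat x ^ 2 * (of_int a / of_nat (q ^ 2))) * of_nat q)"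
    by (rule sum.mono_neutral_cong_right) (use p in auto)
  also have "\<dots> = of_nat q + e (of_nat p ^ 2 * (of_int a / of_nat (q ^ 2))) * of_nat q" using p by simp
  also have "of_nat p ^ 2 * (of_int a / of_nat (q ^ 2)) = (of_int a / 4 :: complex)" using p by (simp add: power_mult_distrib)
  finally show ?thesis by (simp add: ring_distribs mult.commute)
qed

text \<open>On the line above \<open>a / q ^ 2\<close> the terms of theta are Gaussians with weights
  \<open>e (n ^ 2 * a / q ^ 2)\<close>, even and of period \<open>q ^ 2\<close>, whose mean is the
  Gauss sum. The error bound is uniform in \<open>y\<close>, as the passage to the cusp
  needs.\<close>

lemma theta_near_cusp:
  assumes "even q" "q > 0" "coprime a (int q)" "y > 0"
  shows "norm (theta (of_int a / of_nat (q ^ 2) + \<i> * of_real y) - (1 + e (of_int a / 4)) / of_nat q * theta (\<i> * of_real y)) \<le> 2 * real (q ^ 2)"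
proof -
  define w where "w n = e (of_int n ^ 2 * (of_int a / of_nat (q ^ 2)))" for n :: int
  have per: "w (n + int (q ^ 2)) = w n" for n
  proof -
    have "of_int (n + int (q ^ 2)) ^ 2 * (of_int a / of_nat (q ^ 2)) = of_int n ^ 2 * (of_int a / of_nat (q ^ 2)) + (of_int (a * (2 * n + int (q ^ 2))) :: complex)"
      using assms by (simp add: field_simps power2_eq_square)
    then show ?thesis unfolding w_def by (simp only: e_add_of_int)
  qed
  have nw: "norm (w n) = 1" for n
    by (simp add: w_def norm_e power2_eq_square)
  have "norm (infsum (\<lambda>n. w n * of_real (gauss y n)) UNIV - (\<Sum>j<q ^ 2. w (int j)) / of_nat (q ^ 2) * infsum (\<lambda>n. of_real (gauss y n)) UNIV) \<le> 2 * real (q ^ 2)"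
  proof (rule gauss_periodic_weight [where w = w and P = "q ^ 2", OF \<open>y > 0\<close> _ _ per])
    show "norm (w n) \<le> 1" for n by (simp add: nw)
  qed (use assms in \<open>simp_all add: w_def\<close>)
  also have "infsum (\<lambda>n. w n * of_real (gauss y n)) UNIV = theta (of_int a / of_nat (q ^ 2) + \<i> * of_real y)"
    unfolding theta_def w_def e_eq_gauss ..
  also have "infsum (\<lambda>n. of_real (gauss y n)) UNIV = theta (\<i> * of_real y)"
    unfolding theta_def using e_eq_gauss [of _ 0 y] by simp
  also have "(\<Sum>j<q ^ 2. w (int j)) / of_nat (q ^ 2) = (1 + e (of_int a / 4)) / of_nat q"
    unfolding w_def gauss_sum_square [OF assms(1-3)] using assms by (simp add: power2_eq_square)
  finally show ?thesis .
qed

lemma theta_imaginary_nonneg: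
  assumes "y > 0"
  shows "\<exists>x\<ge>0. theta (\<i> * of_real y) = of_real x"
proof -
  have "theta (\<i> * of_real y) = infsum (\<lambda>n. of_real (gauss y n)) UNIV"
    unfolding theta_def using e_eq_gauss [of _ 0 y] by simp
  also have "\<dots> = of_real (infsum (gauss y) UNIV)"
    using has_sum_of_real [OF has_sum_infsum [OF gauss_summable [OF assms]]] by (rule infsumI)
  finally show ?thesis using infsum_nonneg [of UNIV "gauss y"] gauss_pos less_imp_le by blast
qed

section \<open>The metaplectic group and its characters\<close>

definition imat :: "int \<Rightarrow> int \<Rightarrow> int \<Rightarrow> int \<Rightarrow> real^2^2" where
  "imat a b c d = vector [vector [of_int a, of_int b], vector [of_int c, of_int d]]"

lemma imat_nth [simp]:
  "vec_nth (vec_nth (imat a b c d) 1) 1 = of_int a" "vec_nth (vec_nth (imat a b c d) 1) 2 = of_int b"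
  "vec_nth (vec_nth (imat a b c d) 2) 1 = of_int c" "vec_nth (vec_nth (imat a b c d) 2) 2 = of_int d"
  by (simp_all add: imat_def)

lemma imat_eq_iff: "A = imat a b c d \<longleftrightarrow> vec_nth (vec_nth A 1) 1 = of_int a \<and> vec_nth (vec_nth A 1) 2 = of_int b \<and>
   vec_nth (vec_nth A 2) 1 = of_int c \<and> vec_nth (vec_nth A 2) 2 = of_int d"
  by (auto simp: vec_eq_iff forall_2)

lemma imat_inject [simp]: "imat a b c d = imat a' b' c' d' \<longleftrightarrow> a = a' \<and> b = b' \<and> c = c' \<and> d = d'"
  by (auto simp: imat_eq_iff)

lemma imat_mult: "imat a b c d ** imat a' b' c' d' = imat (a * a' + b * c') (a * b' + b * d') (c * a' + d * c') (c * b' + d * d')"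
  by (simp add: imat_eq_iff matrix_matrix_mult_def sum_2)

lemma det_imat: "det (imat a b c d) = of_int (a * d - b * c)"
  by (simp add: det_2)

definition mob :: "int \<Rightarrow> int \<Rightarrow> int \<Rightarrow> int \<Rightarrow> complex \<Rightarrow> complex" where
  "mob a b c d \<tau> = (of_int a * \<tau> + of_int b) / (of_int c * \<tau> + of_int d)"

lemma auto_factor_imat: "auto_factor (imat a b c d) \<tau> = of_int c * \<tau> + of_int d"
  by (simp add: auto_factor_def)

lemma moebius_imat: "moebius (imat a b c d) = mob a b c d"
  by (simp add: moebius_def auto_factor_imat mob_def fun_eq_iff)

lemma denominator_nonzero:
  assumes "a * d - b * c = (1 :: int)" "\<tau> \<in> uhp"
  shows "of_int c * \<tau> + of_int d \<noteq> 0"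
proof
  assume "of_int c * \<tau> + of_int d = 0"
  then have "Im (of_int c * \<tau> + of_int d) = 0" "Re (of_int c * \<tau> + of_int d) = 0" by simp_all
  then have "c = 0" "d = 0" using assms by (auto simp: uhp_def)
  then show False using assms by simp
qed

lemma Im_mob:
  assumes "a * d - b * c = (1 :: int)"
  shows "Im (mob a b c d \<tau>) = Im \<tau> / norm (of_int c * \<tau> + of_int d) ^ 2"
proof -
  have "of_int (a * d - b * c) = (1 :: real)" using assms by simp
  then have ad: "of_int a * of_int d = 1 + of_int b * (of_int c :: real)" by simp
  have "Im (mob a b c d \<tau>) = (of_int a * Im \<tau> * (of_int c * Re \<tau> + of_int d) - (of_int a * Re \<tau> + of_int b) * (of_int c * Im \<tau>)) / norm (of_int c * \<tau> + of_int d) ^ 2"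
    unfolding mob_def by (subst Im_divide) (simp add: cmod_power2)
  also have "of_int a * Im \<tau> * (of_int c * Re \<tau> + of_int d) - (of_int a * Re \<tau> + of_int b) * (of_int c * Im \<tau>) = (of_int a * of_int d - of_int b * of_int c) * Im \<tau>"
    by (simp add: algebra_simps)
  also have "\<dots> = Im \<tau>" using ad by simp
  finally show ?thesis .
qed

lemma mob_in_uhp:
  assumes "a * d - b * c = (1 :: int)" "\<tau> \<in> uhp"
  shows "mob a b c d \<tau> \<in> uhp"
  using denominator_nonzero [OF assms] assms(2) by (simp add: uhp_def Im_mob [OF assms(1)])

lemma mob_cocycle:
  assumes "a' * d' - b' * c' = (1 :: int)" "\<tau> \<in> uhp"
  shows "(of_int c * mob a' b' c' d' \<tau> + of_int d) * (of_int c' * \<tau> + of_int d') = of_int (c * a' + d * c') * \<tau> + of_int (c * b' + d * d')"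
  using denominator_nonzero [OF assms] by (simp add: mob_def field_simps)

lemma holomorphic_mob:
  assumes "a * d - b * c = (1 :: int)"
  shows "mob a b c d holomorphic_on uhp"
  unfolding mob_def using denominator_nonzero [OF assms] by (intro holomorphic_intros) auto

lemma csqrt_first_quadrant:
  assumes "Im z > 0"
  shows "Re (csqrt z) > 0" "Im (csqrt z) > 0"
proof -
  have "Im (w ^ 2) = 2 * (Re w * Im w)" for w by (simp add: power2_eq_square)
  from this [of "csqrt z"] have "Re (csqrt z) * Im (csqrt z) > 0" using assms unfolding power2_csqrt by linarith
  then show "Re (csqrt z) > 0" "Im (csqrt z) > 0" using Re_csqrt [of z] by (auto simp: zero_less_mult_iff)
qed

lemma square_eq_upper:
  fixes x y :: complex
  assumes "x ^ 2 = y ^ 2" "Im x > 0" "Im y > 0"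
  shows "x = y"
  using assms by (auto simp: power2_eq_iff)

text \<open>For \<open>c \<noteq> 0\<close> the argument \<open>c * \<tau> + d\<close> is never real
  on the upper half plane, so the principal root is holomorphic there; for \<open>c > 0\<close> its
  values lie in the open first quadrant.\<close>

definition lift :: "int \<Rightarrow> int \<Rightarrow> int \<Rightarrow> int \<Rightarrow> mp" where
  "lift a b c d = (imat a b c d, \<lambda>\<tau>\<in>uhp. csqrt (of_int c * \<tau> + of_int d))"

definition translation :: "int \<Rightarrow> mp" where
  "translation n = (imat 1 n 0 1, \<lambda>\<tau>\<in>uhp. 1)"

lemma Gamma0_cases:
  assumes "g \<in> Gamma0 N"
  obtains a b c d w where "g = (imat a b c d, w)" "a * d - b * c = 1" "int N dvd c" "w \<in> extensional uhp"
    "w holomorphic_on uhp" "\<And>\<tau>. \<tau> \<in> uhp \<Longrightarrow> w \<tau> ^ 2 = of_int c * \<tau> + of_int d"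
proof -
  obtain A w where g: "g = (A, w)" by (cases g)
  have int: "\<And>i j. vec_nth (vec_nth A i) j \<in> \<int>" and det: "det A = 1" and w: "w \<in> extensional uhp" "w holomorphic_on uhp" "\<And>\<tau>. \<tau> \<in> uhp \<Longrightarrow> w \<tau> ^ 2 = auto_factor A \<tau>"
    using assms by (auto simp: g Gamma0_def Mp1Z_def Mp1R_def)
  define a b c d where "a = \<lfloor>vec_nth (vec_nth A 1) 1\<rfloor>" and "b = \<lfloor>vec_nth (vec_nth A 1) 2\<rfloor>" and "c = \<lfloor>vec_nth (vec_nth A 2) 1\<rfloor>" and "d = \<lfloor>vec_nth (vec_nth A 2) 2\<rfloor>"
  have A: "A = imat a b c d" unfolding imat_eq_iff a_def b_def c_def d_def using int by (simp add: of_int_floor)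
  have "a * d - b * c = 1" using det by (simp only: A det_imat of_int_eq_1_iff)
  moreover have "int N dvd c"
  proof -
    obtain t where "vec_nth (vec_nth A 2) 1 = of_int (int N * t)" using assms by (auto simp: g Gamma0_def)
    then have "c = int N * t" by (simp only: c_def floor_of_int)
    then show ?thesis by simp
  qed
  ultimately show ?thesis using that [of a b c d w] w g by (simp add: A auto_factor_imat)
qed

lemma Gamma0I:
  assumes "a * d - b * c = 1" "int N dvd c" "w \<in> extensional uhp" "w holomorphic_on uhp"
    "\<And>\<tau>. \<tau> \<in> uhp \<Longrightarrow> w \<tau> ^ 2 = of_int c * \<tau> + of_int d"
  shows "(imat a b c d, w) \<in> Gamma0 N"
proof -
  have "det (imat a b c d) = 1" using assms(1) by (simp only: det_imat of_int_1)
  moreover have "vec_nth (vec_nth (imat a b c d) i) j \<in> \<int>" for i j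
    using exhaust_2 [of i] exhaust_2 [of j] by auto
  moreover obtain t where "c = int N * t" using assms(2) by blast
  ultimately show ?thesis using assms by (auto simp: Gamma0_def Mp1Z_def Mp1R_def auto_factor_imat)
qed

lemma Gamma0_subset_Mp1Z: "Gamma0 N \<subseteq> carrier Mp1Z"
  by (auto simp: Gamma0_def)

lemma Gamma0_mono:
  assumes "M dvd N"
  shows "Gamma0 N \<subseteq> Gamma0 M"
proof
  fix g assume "g \<in> Gamma0 N"
  then obtain t where t: "g \<in> carrier Mp1Z" "vec_nth (vec_nth (fst g) 2) 1 = of_int (int N * t)"
    unfolding Gamma0_def by blast
  obtain k where "N = M * k" using assms by blast
  then have "int N * t = int M * (int k * t)" by simp
  then show "g \<in> Gamma0 M" unfolding Gamma0_def using t by (metis (mono_tags, lifting) mem_Collect_eq)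
qed

lemma mult_Mp1Z:
  "(imat a b c d, w) \<otimes>\<^bsub>Mp1Z\<^esub> (imat a' b' c' d', v) =
   (imat (a * a' + b * c') (a * b' + b * d') (c * a' + d * c') (c * b' + d * d'), \<lambda>\<tau>\<in>uhp. w (mob a' b' c' d' \<tau>) * v \<tau>)"
  by (simp add: Mp1Z_def Mp1R_def imat_mult moebius_imat)

lemma Gamma0_mult_closed:
  assumes "g \<in> Gamma0 N" "h \<in> Gamma0 N"
  shows "g \<otimes>\<^bsub>Mp1Z\<^esub> h \<in> Gamma0 N"
proof -
  obtain a b c d w where g: "g = (imat a b c d, w)" "a * d - b * c = 1" "int N dvd c" "w \<in> extensional uhp"
    "w holomorphic_on uhp" "\<And>\<tau>. \<tau> \<in> uhp \<Longrightarrow> w \<tau> ^ 2 = of_int c * \<tau> + of_int d" using assms(1) by (elim Gamma0_cases) blast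
  obtain a' b' c' d' v where h: "h = (imat a' b' c' d', v)" "a' * d' - b' * c' = 1" "int N dvd c'" "v \<in> extensional uhp"
    "v holomorphic_on uhp" "\<And>\<tau>. \<tau> \<in> uhp \<Longrightarrow> v \<tau> ^ 2 = of_int c' * \<tau> + of_int d'" using assms(2) by (elim Gamma0_cases) blast
  show ?thesis unfolding g(1) h(1) mult_Mp1Z
  proof (rule Gamma0I)
    show "(a * a' + b * c') * (c * b' + d * d') - (a * b' + b * d') * (c * a' + d * c') = 1"
    proof -
      have "(a * a' + b * c') * (c * b' + d * d') - (a * b' + b * d') * (c * a' + d * c') = (a * d - b * c) * (a' * d' - b' * c')"
        by (simp add: algebra_simps)
      then show ?thesis using g(2) h(2) by simp
    qed
    show "int N dvd c * a' + d * c'" using g(3) h(3) by simp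
    have "(\<lambda>\<tau>. w (mob a' b' c' d' \<tau>) * v \<tau>) holomorphic_on uhp"
    proof (intro holomorphic_intros h)
      have "(w \<circ> mob a' b' c' d') holomorphic_on uhp"
        by (rule holomorphic_on_compose_gen [OF holomorphic_mob [OF h(2)] g(5)]) (use mob_in_uhp [OF h(2)] in auto)
      then show "(\<lambda>\<tau>. w (mob a' b' c' d' \<tau>)) holomorphic_on uhp" by (simp add: o_def)
    qed
    then show "(\<lambda>\<tau>\<in>uhp. w (mob a' b' c' d' \<tau>) * v \<tau>) holomorphic_on uhp"
      by (rule holomorphic_transform) simp
    show "(\<lambda>\<tau>\<in>uhp. w (mob a' b' c' d' \<tau>) * v \<tau>) \<tau> ^ 2 = of_int (c * a' + d * c') * \<tau> + of_int (c * b' + d * d')" if "\<tau> \<in> uhp" for \<tau>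
      using that mob_cocycle [OF h(2) that, of c d] by (simp add: power_mult_distrib g(6) [OF mob_in_uhp [OF h(2) that]] h(6))
  qed auto
qed

lemma lift_in_Gamma0:
  assumes "a * d - b * c = 1" "int N dvd c" "c \<noteq> 0"
  shows "lift a b c d \<in> Gamma0 N"
  unfolding lift_def
proof (rule Gamma0I [OF assms(1,2)])
  have "(\<lambda>\<tau>. csqrt (of_int c * \<tau> + of_int d)) holomorphic_on uhp"
    using assms(3) by (intro holomorphic_intros) (auto simp: complex_nonpos_Reals_iff uhp_def)
  then show "(\<lambda>\<tau>\<in>uhp. csqrt (of_int c * \<tau> + of_int d)) holomorphic_on uhp"
    by (rule holomorphic_transform) simp
qed auto

lemma translation_in_Gamma0: "translation n \<in> Gamma0 N"
  unfolding translation_def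
proof (rule Gamma0I)
  show "(\<lambda>\<tau>\<in>uhp. 1 :: complex) holomorphic_on uhp"
    by (rule holomorphic_transform [of "\<lambda>_. 1"]) auto
qed auto

lemma mult_translation:
  assumes "w \<in> extensional uhp"
  shows "(imat a b c d, w) \<otimes>\<^bsub>Mp1Z\<^esub> translation n = (imat a (a * n + b) c (c * n + d), \<lambda>\<tau>\<in>uhp. w (\<tau> + of_int n))"
  by (simp add: translation_def mult_Mp1Z mob_def cong: restrict_cong)

lemma lift_mult_translation: "lift a b c d \<otimes>\<^bsub>Mp1Z\<^esub> translation n = lift a (a * n + b) c (c * n + d)"
proof -
  have "\<tau> + of_int n \<in> uhp \<longleftrightarrow> \<tau> \<in> uhp" for \<tau> by (simp add: uhp_def)
  then show ?thesis
    unfolding lift_def by (subst mult_translation) (auto simp: ring_distribs add_ac cong: restrict_cong)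
qed

text \<open>Both roots square to the same automorphy factor, so only a sign is in doubt. With
  positive lower left entries all roots lie in the open first quadrant, and the product of two such
  numbers still has positive imaginary part.\<close>

lemma lift_mult:
  assumes "a * d - b * c = 1" "a' * d' - b' * c' = 1" "c > 0" "c' > 0" "c * a' + d * c' > 0"
  shows "lift a b c d \<otimes>\<^bsub>Mp1Z\<^esub> lift a' b' c' d' = lift (a * a' + b * c') (a * b' + b * d') (c * a' + d * c') (c * b' + d * d')"
proof -
  have "csqrt (of_int c * mob a' b' c' d' \<tau> + of_int d) * csqrt (of_int c' * \<tau> + of_int d')
      = csqrt (of_int (c * a' + d * c') * \<tau> + of_int (c * b' + d * d'))" if \<tau>: "\<tau> \<in> uhp" for \<tau>
  proof (rule square_eq_upper)
    define x y where "x = csqrt (of_int c * mob a' b' c' d' \<tau> + of_int d)" and "y = csqrt (of_int c' * \<tau> + of_int d')"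
    have "Im (of_int c * mob a' b' c' d' \<tau> + of_int d) > 0" "Im (of_int c' * \<tau> + of_int d') > 0"
      using mob_in_uhp [OF assms(2) \<tau>] \<tau> assms by (simp_all add: uhp_def)
    then have "Re x > 0" "Im x > 0" "Re y > 0" "Im y > 0" unfolding x_def y_def using csqrt_first_quadrant by blast+
    then show "Im (x * y) > 0" by (simp add: add_pos_pos)
    show "(x * y) ^ 2 = csqrt (of_int (c * a' + d * c') * \<tau> + of_int (c * b' + d * d')) ^ 2"
      unfolding x_def y_def power_mult_distrib power2_csqrt by (rule mob_cocycle [OF assms(2) \<tau>])
    have "Im (of_int (c * a' + d * c') * \<tau> + of_int (c * b' + d * d')) = of_int (c * a' + d * c') * Im \<tau>"
      by (simp del: of_int_mult of_int_add)
    then have "Im (of_int (c * a' + d * c') * \<tau> + of_int (c * b' + d * d')) > 0"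
      using assms(5) \<tau> by (simp only: uhp_def mem_Collect_eq) (simp only: of_int_0_less_iff mult_pos_pos)
    then show "Im (csqrt (of_int (c * a' + d * c') * \<tau> + of_int (c * b' + d * d'))) > 0"
      by (rule csqrt_first_quadrant)
  qed
  then show ?thesis unfolding lift_def mult_Mp1Z
    using mob_in_uhp [OF assms(2)] by (auto intro!: restrict_ext)
qed

section \<open>Transformation laws and elementary properties of theta and eta\<close>

lemma character_mult:
  assumes "is_character G \<Gamma> chi" "g \<in> \<Gamma>" "h \<in> \<Gamma>"
  shows "chi (g \<otimes>\<^bsub>G\<^esub> h) = chi g * chi h"
  using assms by (simp add: is_character_def hom_def complex_ring_def Ring_Divisibility.mult_of_def Multiplicative_Group.mult_of_def)

lemma character_nonzero:
  assumes "is_character G \<Gamma> chi" "g \<in> \<Gamma>"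
  shows "chi g \<noteq> 0"
  using assms by (auto simp: is_character_def hom_def complex_ring_def Pi_iff Ring_Divisibility.mult_of_def Multiplicative_Group.mult_of_def)

lemma slash_half: "slash (1/2) f (imat a b c d, w) \<tau> = inverse (w \<tau>) * f (mob a b c d \<tau>)"
  by (simp add: slash_def moebius_imat power_int_def)

lemma theta_character_eq:
  assumes "theta_character chi" "(imat a b c d, w) \<in> Gamma0 4" "\<tau> \<in> uhp" "w \<tau> \<noteq> 0"
  shows "theta (mob a b c d \<tau>) = chi (imat a b c d, w) * w \<tau> * theta \<tau>"
proof -
  have "inverse (w \<tau>) * theta (mob a b c d \<tau>) = chi (imat a b c d, w) * theta \<tau>"
  proof -
    have "slash (1/2) theta (imat a b c d, w) \<tau> = chi (imat a b c d, w) * theta \<tau>"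
      using assms(1-3) unfolding theta_character_def by blast
    then show ?thesis by (simp only: slash_half)
  qed
  then show ?thesis using assms(4) by (simp add: field_simps)
qed

lemma eta_character_eq:
  assumes "eta_character chi" "(imat a b c d, w) \<in> Gamma0 1" "\<tau> \<in> uhp" "w \<tau> \<noteq> 0"
  shows "eta (mob a b c d \<tau>) = chi (imat a b c d, w) * w \<tau> * eta \<tau>"
proof -
  have "inverse (w \<tau>) * eta (mob a b c d \<tau>) = chi (imat a b c d, w) * eta \<tau>"
  proof -
    have "(imat a b c d, w) \<in> carrier Mp1Z" using assms(2) Gamma0_subset_Mp1Z by blast
    then have "slash (1/2) eta (imat a b c d, w) \<tau> = chi (imat a b c d, w) * eta \<tau>"
      using assms(1,3) unfolding eta_character_def by blast
    then show ?thesis by (simp only: slash_half)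
  qed
  then show ?thesis using assms(4) by (simp add: field_simps)
qed

lemma eta_nonzero:
  assumes "\<tau> \<in> uhp"
  shows "eta \<tau> \<noteq> 0"
proof -
  have q: "norm (e \<tau>) < 1" using assms by (simp add: norm_e uhp_def)
  have eq: "e (of_nat (Suc n) * \<tau>) = e \<tau> ^ Suc n" for n by (rule e_of_nat_mult)
  have "summable (\<lambda>n. norm ((1 - e (of_nat (Suc n) * \<tau>)) - 1))"
    unfolding eq using q by (simp add: norm_power norm_mult summable_mult summable_geometric)
  then have "abs_convergent_prod (\<lambda>n. 1 - e (of_nat (Suc n) * \<tau>))" by (rule summable_imp_abs_convergent_prod)
  then have "convergent_prod (\<lambda>n. 1 - e (of_nat (Suc n) * \<tau>))" by (rule abs_convergent_prod_imp_convergent_prod)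
  moreover have "1 - e (of_nat (Suc n) * \<tau>) \<noteq> 0" for n
  proof
    assume "1 - e (of_nat (Suc n) * \<tau>) = 0"
    then have "norm (e \<tau>) ^ Suc n = 1" unfolding eq by (metis norm_one norm_power right_minus_eq)
    then show False using q power_Suc_less_one [of "norm (e \<tau>)" n] by simp
  qed
  ultimately have "prodinf (\<lambda>n. 1 - e (of_nat (Suc n) * \<tau>)) \<noteq> 0" by (rule prodinf_nonzero)
  then show ?thesis by (simp add: eta_def)
qed

lemma eta_add_int: "eta (\<tau> + of_int n) = e (of_int n / 24) * eta \<tau>"
proof -
  have "e (of_nat (Suc k) * (\<tau> + of_int n)) = e (of_nat (Suc k) * \<tau>)" for k
  proof -
    have "of_nat (Suc k) * (\<tau> + of_int n) = of_nat (Suc k) * \<tau> + of_int (int (Suc k) * n)"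
      by (simp add: ring_distribs)
    then show ?thesis by (simp only: e_add_of_int)
  qed
  then show ?thesis by (simp add: eta_def add_divide_distrib e_add mult.commute)
qed

lemma theta_add_int: "theta (\<tau> + of_int n) = theta \<tau>"
proof -
  have "e (of_int k ^ 2 * (\<tau> + of_int n)) = e (of_int k ^ 2 * \<tau>)" for k
  proof -
    have "of_int k ^ 2 * (\<tau> + of_int n) = of_int k ^ 2 * \<tau> + of_int (k ^ 2 * n)"
      by (simp add: ring_distribs)
    then show ?thesis by (simp only: e_add_of_int)
  qed
  then show ?thesis by (simp add: theta_def)
qed

lemma theta_not_zero: "\<exists>\<tau>\<in>uhp. theta \<tau> \<noteq> 0"
proof -
  have "exp (- 2 * pi) < (1/4 :: real)"
  proof -
    have "exp (- 2 * pi) \<le> exp (- 6 :: real)" using pi_gt3 by simp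
    also have "\<dots> = inverse (exp 6)" by (simp add: exp_minus)
    also have "\<dots> \<le> inverse 7" using exp_ge_add_one_self [of "6 :: real"] by (intro le_imp_inverse_le) auto
    finally show ?thesis by simp
  qed
  then have "2 * (exp (- 2 * pi) / (1 - exp (- 2 * pi))) < (1 :: real)" by (simp add: field_simps)
  moreover have "norm (theta \<i> - 1) \<le> 2 * (exp (- 2 * pi) / (1 - exp (- 2 * pi)))"
    using theta_bound [of \<i>] by (simp add: uhp_def)
  ultimately have "norm (theta \<i> - 1) < 1" by linarith
  then have "theta \<i> \<noteq> 0" by auto
  then show ?thesis by (intro bexI [of _ \<i>]) (simp_all add: uhp_def)
qed

lemma e_quarter: "e (1/4) = \<i>"
proof -
  have "e (1/4) = cis (pi / 2)" by (simp add: e_def cis_conv_exp mult_ac)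
  then show ?thesis by simp
qed

section \<open>The theta character on matrices whose lower left entry is an even square\<close>

lemma csqrt_ii_times:
  assumes "r > 0"
  shows "csqrt (\<i> * of_real r) = of_real (sqrt r) * csqrt \<i>"
proof (rule csqrt_unique)
  show "(of_real (sqrt r) * csqrt \<i>) ^ 2 = \<i> * of_real r"
    unfolding power_mult_distrib power2_csqrt of_real_power [symmetric] using assms by simp
  have "Re (csqrt \<i>) > 0" by (rule csqrt_first_quadrant) simp
  then show "0 < Re (of_real (sqrt r) * csqrt \<i>) \<or> Re (of_real (sqrt r) * csqrt \<i>) = 0 \<and> 0 \<le> Im (of_real (sqrt r) * csqrt \<i>)"
    using assms by (simp del: csqrt_ii csqrt.simps)
qed

text \<open>Compare \<open>\<theta>\<close> near the cusp \<open>a / q\<^sup>2\<close>, where it is governed by a Gauss sum, with its value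
  near \<open>\<i>\<infinity>\<close>. The limit on the left depends on the matrix only through \<open>a mod 4\<close>.\<close>

lemma theta_character_limit:
  assumes chi: "theta_character chi" and det: "a * d - b * int (q ^ 2) = 1" and q: "even q" "q > 0"
  shows "((\<lambda>y. of_real (sqrt y) * theta (\<i> * of_real y) * ((1 + e (of_int a / 4)) / csqrt \<i>)) \<longlongrightarrow> chi (lift a b (int (q ^ 2)) d)) (at_right 0)"
proof -
  define \<kappa> where "\<kappa> = csqrt \<i>"
  have \<kappa>: "\<kappa> \<noteq> 0" by (simp add: \<kappa>_def del: csqrt_ii)
  define Y where "Y = chi (lift a b (int (q ^ 2)) d)"
  \<comment> \<open>The point that the matrix sends to \<open>a / q ^ 2 + \<i> * y\<close>; its
    imaginary part tends to infinity as \<open>y\<close> tends to 0.\<close>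
  define g where "g y = - of_int d / of_nat (q ^ 2) + \<i> * of_real (1 / (real q ^ 4 * y))" for y
  define R where "R y = theta (of_int a / of_nat (q ^ 2) + \<i> * of_real y) - (1 + e (of_int a / 4)) / of_nat q * theta (\<i> * of_real y)" for y
  have cop: "coprime a (int q)"
  proof (rule coprimeI)
    fix k assume "k dvd a" "k dvd int q"
    then have "k dvd a * d - b * int (q ^ 2)" by (simp add: power2_eq_square)
    then show "is_unit k" using det by simp
  qed
  have R: "norm (R y) \<le> 2 * real (q ^ 2)" if "y > 0" for y
    unfolding R_def by (rule theta_near_cusp [OF q cop that])
  have g_uhp: "g y \<in> uhp" if "y > 0" for y using that q by (simp add: g_def uhp_def)
  \<comment> \<open>The transformation law at \<open>g y\<close>, solved for the character value.
    The factor \<open>q * sqrt y\<close> cancels the \<open>1 / q\<close> of the Gauss sum, so the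
    main term is free of \<open>q\<close>.\<close>
  have key: "Y * theta (g y) - of_nat q * of_real (sqrt y) / \<kappa> * R y
     = of_real (sqrt y) * theta (\<i> * of_real y) * ((1 + e (of_int a / 4)) / \<kappa>)" if y: "y > 0" for y
  proof -
    define D where "D = of_int (int (q ^ 2)) * g y + of_int d"
    have D: "D = \<i> * of_real (1 / (real q ^ 2 * y))"
      using q y by (simp add: D_def g_def field_simps power4_eq_xxxx power2_eq_square)
    have Dnz: "D \<noteq> 0" using q y by (simp add: D)
    have "(of_int (a * d - b * int (q ^ 2)) :: complex) = 1" using det by simp
    then have ad: "of_int a * of_int d = 1 + of_int b * (of_nat q :: complex) ^ 2" by (simp add: diff_eq_eq)
    have "of_int a * g y + of_int b = (of_int a / of_nat (q ^ 2) + \<i> * of_real y) * D"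
    proof -
      have "of_int a * g y + of_int b = (of_int b * of_nat q ^ 2 - of_int a * of_int d) / of_nat q ^ 2 + \<i> * of_int a * of_real (1 / (real q ^ 4 * y))"
        using q by (simp add: g_def field_simps)
      also have "\<dots> = - 1 / of_nat q ^ 2 + \<i> * of_int a * of_real (1 / (real q ^ 4 * y))" using ad by simp
      also have "\<dots> = (of_int a / of_nat (q ^ 2) + \<i> * of_real y) * D"
        using q y by (simp add: D field_simps power4_eq_xxxx power2_eq_square)
      finally show ?thesis .
    qed
    then have mob: "mob a b (int (q ^ 2)) d (g y) = of_int a / of_nat (q ^ 2) + \<i> * of_real y"
      using Dnz unfolding mob_def D_def [symmetric] by simp
    have w: "csqrt D = of_real (1 / (real q * sqrt y)) * \<kappa>"
      unfolding D \<kappa>_def using q y by (subst csqrt_ii_times) (simp_all add: real_sqrt_mult real_sqrt_divide del: csqrt_ii csqrt.simps)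
    have "lift a b (int (q ^ 2)) d \<in> Gamma0 4"
    proof (rule lift_in_Gamma0 [OF det])
      obtain p where "q = 2 * p" using q by blast
      then show "int 4 dvd int (q ^ 2)" by (simp add: power_mult_distrib)
      show "int (q ^ 2) \<noteq> 0" using q by simp
    qed
    from theta_character_eq [OF chi this [unfolded lift_def] g_uhp [OF y]]
    have "theta (mob a b (int (q ^ 2)) d (g y)) = Y * csqrt D * theta (g y)"
      using g_uhp [OF y] Dnz by (simp add: Y_def lift_def D_def del: csqrt.simps)
    then have "theta (of_int a / of_nat (q ^ 2) + \<i> * of_real y) = Y * (of_real (1 / (real q * sqrt y)) * \<kappa>) * theta (g y)"
      unfolding mob w .
    then have "Y * theta (g y) = of_nat q * of_real (sqrt y) / \<kappa> * theta (of_int a / of_nat (q ^ 2) + \<i> * of_real y)"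
      using \<kappa> q y by (simp add: field_simps)
    moreover have "of_nat q * of_real (sqrt y) / \<kappa> * theta (of_int a / of_nat (q ^ 2) + \<i> * of_real y) - of_nat q * of_real (sqrt y) / \<kappa> * R y
      = of_nat q * of_real (sqrt y) / \<kappa> * ((1 + e (of_int a / 4)) / of_nat q * theta (\<i> * of_real y))"
      unfolding R_def by (simp add: right_diff_distrib)
    moreover have "of_nat q * of_real (sqrt y) / \<kappa> * ((1 + e (of_int a / 4)) / of_nat q * theta (\<i> * of_real y))
      = of_real (sqrt y) * theta (\<i> * of_real y) * ((1 + e (of_int a / 4)) / \<kappa>)"
      using q by simp
    ultimately show ?thesis by simp
  qed
  have pos: "\<forall>\<^sub>F y :: real in at_right 0. y > 0" by (simp add: eventually_at_right_less)
  have "((\<lambda>y. theta (g y)) \<longlongrightarrow> 1) (at_right 0)"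
  proof (rule theta_tendsto_1)
    show "\<forall>\<^sub>F y in at_right 0. g y \<in> uhp" using pos by eventually_elim (rule g_uhp)
    have "filterlim (\<lambda>y. (1 / real q ^ 4) * inverse y) at_top (at_right 0)"
      by (rule filterlim_tendsto_pos_mult_at_top [OF tendsto_const _ filterlim_inverse_at_top_right]) (use q in simp)
    then show "filterlim (\<lambda>y. Im (g y)) at_top (at_right 0)" by (simp add: g_def field_simps)
  qed
  \<comment> \<open>A bounded error times \<open>sqrt y\<close>.\<close>
  moreover have "((\<lambda>y. of_nat q * of_real (sqrt y) / \<kappa> * R y) \<longlongrightarrow> 0) (at_right 0)"
  proof (rule Lim_null_comparison)
    show "\<forall>\<^sub>F y in at_right 0. norm (of_nat q * of_real (sqrt y) / \<kappa> * R y) \<le> real q * sqrt y / norm \<kappa> * (2 * real (q ^ 2))"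
      using pos by eventually_elim (use R in \<open>auto simp: norm_mult norm_divide intro!: mult_left_mono divide_right_mono\<close>)
    have "((\<lambda>y. real q * sqrt y / norm \<kappa> * (2 * real (q ^ 2))) \<longlongrightarrow> real q * sqrt 0 / norm \<kappa> * (2 * real (q ^ 2))) (at_right 0)"
      using \<kappa> by (intro tendsto_intros) auto
    then show "((\<lambda>y. real q * sqrt y / norm \<kappa> * (2 * real (q ^ 2))) \<longlongrightarrow> 0) (at_right 0)" by simp
  qed
  ultimately have "((\<lambda>y. Y * theta (g y) - of_nat q * of_real (sqrt y) / \<kappa> * R y) \<longlongrightarrow> Y * 1 - 0) (at_right 0)"
    by (intro tendsto_intros)
  then have "((\<lambda>y. Y * theta (g y) - of_nat q * of_real (sqrt y) / \<kappa> * R y) \<longlongrightarrow> Y) (at_right 0)" by simp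
  then show ?thesis unfolding Y_def [symmetric] \<kappa>_def [symmetric]
    by (rule Lim_transform_eventually) (use pos in eventually_elim, use key in blast)
qed

text \<open>Both values are limits of one and the same function of \<open>y\<close>, in which
  \<open>b\<close>, \<open>d\<close> and the lower left entry do not occur. In particular the two
  lower left entries may differ.\<close>

lemma theta_character_lift_eq:
  assumes chi: "theta_character chi" and det: "a * d - b * int (q ^ 2) = 1" "a' * d' - b' * int (q' ^ 2) = 1"
    and q: "even q" "q > 0" "even q'" "q' > 0" and a: "4 dvd a - a'"
  shows "chi (lift a b (int (q ^ 2)) d) = chi (lift a' b' (int (q' ^ 2)) d')"
proof (rule tendsto_unique [OF trivial_limit_at_right_real])
  have "e (of_int a / 4) = e (of_int a' / 4)"
  proof -
    obtain k where "a - a' = 4 * k" using a by blast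
    then have "(of_int a - of_int a' :: complex) = 4 * of_int k" by (metis of_int_diff of_int_mult of_int_numeral)
    then have "of_int a / 4 - of_int a' / 4 = (of_int k :: complex)" by (simp add: field_simps)
    then show ?thesis by (simp add: e_eq_iff)
  qed
  then show "((\<lambda>y. of_real (sqrt y) * theta (\<i> * of_real y) * ((1 + e (of_int a / 4)) / csqrt \<i>)) \<longlongrightarrow> chi (lift a' b' (int (q' ^ 2)) d')) (at_right 0)"
    using theta_character_limit [OF chi det(2) q(3,4)] by simp
qed (rule theta_character_limit [OF chi det(1) q(1,2)])

text \<open>Let \<open>x\<close> be the value. Doubling the lower left entry twice gives
  \<open>x ^ 4\<close> at entry 16; but 4 and 16 are both even squares and the upper left entry is 1
  in both cases, so that value is again \<open>x\<close>. The limit formula makes \<open>x\<close>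
  real and nonnegative, since \<open>(1 + \<i>) / csqrt \<i> = sqrt 2\<close>, and a character value
  is nonzero; hence \<open>x = 1\<close>.\<close>

lemma theta_character_L4:
  assumes chi: "theta_character chi"
  shows "chi (lift 1 0 4 1) = 1"
proof -
  define x where "x = chi (lift 1 0 4 1)"
  have lim: "((\<lambda>y. of_real (sqrt y) * theta (\<i> * of_real y) * ((1 + e (of_int 1 / 4)) / csqrt \<i>)) \<longlongrightarrow> x) (at_right 0)"
    using theta_character_limit [OF chi, of 1 1 0 2] by (simp add: x_def del: csqrt_ii)
  have "x \<in> \<real>\<^sub>\<ge>\<^sub>0"
  proof (rule Lim_in_closed_set [OF closed_nonneg_Reals_complex _ _ lim])
    show "\<forall>\<^sub>F y in at_right 0. of_real (sqrt y) * theta (\<i> * of_real y) * ((1 + e (of_int 1 / 4)) / csqrt \<i>) \<in> \<real>\<^sub>\<ge>\<^sub>0"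
    proof -
      have "\<forall>\<^sub>F y :: real in at_right 0. y > 0" by (simp add: eventually_at_right_less)
      then show ?thesis
      proof eventually_elim
        case (elim y)
        obtain t where t: "t \<ge> 0" "theta (\<i> * of_real y) = of_real t" using theta_imaginary_nonneg [OF elim] by blast
        have "1 + \<i> \<noteq> 0" by (simp add: complex_eq_iff)
        then have "(1 + e (of_int 1 / 4)) / csqrt \<i> = of_real (sqrt 2)" by (simp add: e_quarter)
        then have "of_real (sqrt y) * theta (\<i> * of_real y) * ((1 + e (of_int 1 / 4)) / csqrt \<i>) = of_real (sqrt y * t * sqrt 2)"
          by (simp only: t of_real_mult)
        moreover have "sqrt y * t * sqrt 2 \<ge> 0" using t elim by simp
        ultimately show ?case by (simp only: nonneg_Reals_of_real_iff)
      qed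
    qed
  qed simp
  then obtain r where r: "x = of_real r" "r \<ge> 0" by (auto elim: nonneg_Reals_cases)
  have mem: "lift 1 0 c 1 \<in> Gamma0 4" if "c > 0" "4 dvd c" for c using that by (intro lift_in_Gamma0) auto
  have chi_hom: "is_character Mp1Z (Gamma0 4) chi" using chi by (simp add: theta_character_def)
  have dbl: "chi (lift 1 0 (2 * c) 1) = chi (lift 1 0 c 1) ^ 2" if "c > 0" "4 dvd c" for c
    using character_mult [OF chi_hom mem [OF that] mem [OF that]] lift_mult [of 1 1 0 c 1 1 0 c] that
    by (simp add: power2_eq_square)
  have "chi (lift 1 0 16 1) = (x ^ 2) ^ 2" using dbl [of 4] dbl [of 8] by (simp add: x_def)
  moreover have "chi (lift 1 0 16 1) = x"
    using theta_character_lift_eq [OF chi, of 1 1 0 4 1 1 0 2] by (simp add: x_def)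
  ultimately have "x ^ 4 = x" by simp
  moreover have "x \<noteq> 0" unfolding x_def by (rule character_nonzero [OF chi_hom mem]) auto
  ultimately have "r ^ 3 = 1"
  proof -
    assume "x ^ 4 = x" "x \<noteq> 0"
    then have "(of_real (r ^ 4) :: complex) = of_real r" "r \<noteq> 0" using r by auto
    then have "r ^ 4 = r" by (simp only: of_real_eq_iff)
    then have "r * r ^ 3 = r * 1" by (simp add: power_Suc [symmetric] numeral_eq_Suc)
    then show ?thesis using \<open>r \<noteq> 0\<close> by simp
  qed
  then have "r = 1" using r(2) power_eq_1_iff [of r 3] by auto
  then show ?thesis using r by (simp add: x_def)
qed

section \<open>The quotient of the eta and theta characters\<close>

locale theta_eta =
  fixes chi_theta chi_eta :: "mp \<Rightarrow> complex"
  assumes theta: "theta_character chi_theta" and eta: "eta_character chi_eta"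
begin

lemma hom_theta: "is_character Mp1Z (Gamma0 4) chi_theta"
  using theta by (simp add: theta_character_def)

lemma carrier_Mp1Z: "carrier Mp1Z = Gamma0 1"
proof
  show "carrier Mp1Z \<subseteq> Gamma0 1"
  proof
    fix g assume g: "g \<in> carrier Mp1Z"
    then have "vec_nth (vec_nth (fst g) 2) 1 \<in> \<int>" by (auto simp: Mp1Z_def)
    then show "g \<in> Gamma0 1" using g by (auto simp: Gamma0_def elim: Ints_cases)
  qed
qed (rule Gamma0_subset_Mp1Z)

lemma hom_eta: "is_character Mp1Z (Gamma0 1) chi_eta"
  using eta by (simp add: eta_character_def carrier_Mp1Z)

lemma Gamma0_4_subset: "Gamma0 4 \<subseteq> Gamma0 1"
  by (rule Gamma0_mono) simp

text \<open>The weights cancel: this is the multiplier of eta divided by theta, of weight 0, so on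
  \<open>Gamma0 4\<close> the choice of the square root no longer matters.\<close>

definition psi :: "mp \<Rightarrow> complex" where
  "psi g = chi_eta g / chi_theta g"

lemma psi_mult:
  assumes "g \<in> Gamma0 4" "h \<in> Gamma0 4"
  shows "psi (g \<otimes>\<^bsub>Mp1Z\<^esub> h) = psi g * psi h"
  using character_mult [OF hom_theta assms] character_mult [OF hom_eta, of g h] assms Gamma0_4_subset
  by (auto simp: psi_def)

lemma chi_eta_translation: "chi_eta (translation n) = e (of_int n / 24)"
proof -
  have i: "\<i> \<in> uhp" by (simp add: uhp_def)
  have "eta (mob 1 n 0 1 \<i>) = chi_eta (translation n) * eta \<i>"
    using eta_character_eq [OF eta translation_in_Gamma0 [of n 1, unfolded translation_def] i] i
    by (simp add: translation_def)
  moreover have "eta (mob 1 n 0 1 \<i>) = e (of_int n / 24) * eta \<i>"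
    using eta_add_int [of \<i> n] by (simp add: mob_def)
  ultimately show ?thesis using eta_nonzero [OF i] by simp
qed

lemma chi_theta_translation: "chi_theta (translation n) = 1"
proof -
  obtain \<tau> where \<tau>: "\<tau> \<in> uhp" "theta \<tau> \<noteq> 0" using theta_not_zero by blast
  have "theta (mob 1 n 0 1 \<tau>) = chi_theta (translation n) * theta \<tau>"
    using theta_character_eq [OF theta translation_in_Gamma0 [of n 4, unfolded translation_def] \<tau>(1)] \<tau>
    by (simp add: translation_def)
  moreover have "theta (mob 1 n 0 1 \<tau>) = theta \<tau>"
    using theta_add_int [of \<tau> n] by (simp add: mob_def)
  ultimately show ?thesis using \<tau> by simp
qed

lemma psi_translation: "psi (translation n) = e (of_int n / 24)"
  by (simp add: psi_def chi_eta_translation chi_theta_translation)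

text \<open>A scalar matrix fixes \<open>\<tau>\<close>, so both characters equal
  \<open>1 / w \<tau>\<close> for any \<open>\<tau>\<close> at which theta does not vanish.\<close>

lemma psi_scalar:
  assumes "(imat d 0 0 d, w) \<in> Gamma0 4"
  shows "psi (imat d 0 0 d, w) = 1"
proof -
  obtain \<tau> where \<tau>: "\<tau> \<in> uhp" "theta \<tau> \<noteq> 0" using theta_not_zero by blast
  have d: "d * d = 1" and w: "w \<tau> ^ 2 = of_int d"
    using assms \<tau>(1) by (auto elim!: Gamma0_cases)
  have "d \<noteq> 0" using d by auto
  have "w \<tau> \<noteq> 0" using w \<open>d \<noteq> 0\<close> by auto
  have "mob d 0 0 d \<tau> = \<tau>" using \<open>d \<noteq> 0\<close> by (simp add: mob_def)
  then have "theta \<tau> = chi_theta (imat d 0 0 d, w) * w \<tau> * theta \<tau>" "eta \<tau> = chi_eta (imat d 0 0 d, w) * w \<tau> * eta \<tau>"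
    using theta_character_eq [OF theta assms \<tau>(1) \<open>w \<tau> \<noteq> 0\<close>] eta_character_eq [where w = w and a = d and b = 0 and c = 0 and d = d, OF eta _ \<tau>(1) \<open>w \<tau> \<noteq> 0\<close>] assms Gamma0_4_subset by auto
  then have "chi_theta (imat d 0 0 d, w) * w \<tau> = 1" "chi_eta (imat d 0 0 d, w) * w \<tau> = 1"
    using \<tau> eta_nonzero [OF \<tau>(1)] by auto
  then have "chi_theta (imat d 0 0 d, w) = chi_eta (imat d 0 0 d, w)"
    using \<open>w \<tau> \<noteq> 0\<close> by (metis mult_right_cancel)
  then show ?thesis unfolding psi_def using character_nonzero [OF hom_theta assms] by simp
qed

text \<open>\<open>L = (1 0; 1 1)\<close> is conjugate to \<open>T\<^sup>-\<^sup>1\<close> by \<open>S\<close>.\<close>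

lemma chi_eta_L: "chi_eta (lift 1 0 1 1) = e (- 1 / 24)"
proof -
  have S: "lift 0 (-1) 1 0 \<in> Gamma0 1" and L: "lift 1 0 1 1 \<in> Gamma0 1" by (rule lift_in_Gamma0; simp)+
  have T: "translation (-1) \<in> Gamma0 1" by (rule translation_in_Gamma0)
  have "lift 1 0 1 1 \<otimes>\<^bsub>Mp1Z\<^esub> lift 0 (-1) 1 0 = lift 0 (-1) 1 0 \<otimes>\<^bsub>Mp1Z\<^esub> translation (-1)"
    by (subst lift_mult) (simp_all add: lift_mult_translation)
  then have "chi_eta (lift 1 0 1 1) * chi_eta (lift 0 (-1) 1 0) = chi_eta (lift 0 (-1) 1 0) * chi_eta (translation (-1))"
    using character_mult [OF hom_eta L S] character_mult [OF hom_eta S T] by auto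
  then show ?thesis using character_nonzero [OF hom_eta S] by (simp add: chi_eta_translation)
qed

lemma psi_L4: "psi (lift 1 0 4 1) = e (- 1 / 6)"
proof -
  have mem: "lift 1 0 c 1 \<in> Gamma0 1" if "c > 0" for c using that by (intro lift_in_Gamma0) auto
  have dbl: "chi_eta (lift 1 0 (2 * c) 1) = chi_eta (lift 1 0 c 1) ^ 2" if "c > 0" for c
    using character_mult [OF hom_eta mem [OF that] mem [OF that]] lift_mult [of 1 1 0 c 1 1 0 c] that
    by (simp add: power2_eq_square)
  have "chi_eta (lift 1 0 4 1) = e (- 1 / 24) ^ 4"
    using dbl [of 1] dbl [of 2] by (simp add: chi_eta_L)
  also have "\<dots> = e (- 1 / 6)" by (simp flip: e_of_nat_mult)
  finally show ?thesis by (simp add: psi_def theta_character_L4 [OF theta])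
qed

end

text \<open>Twice the exponent, modulo 24, of the classical eta multiplier for even \<open>c\<close>
  divided by the theta multiplier. The Jacobi symbols cancel; for odd \<open>d\<close> and
  \<open>4 dvd c\<close> the fourth root of unity of theta turns \<open>6 * (d - 1)\<close> into
  \<open>3 * (d ^ 2 - 1)\<close>, and \<open>6 * c * d\<close> agrees with \<open>6 * c\<close>
  modulo 48. Doubling avoids a fraction, whence the modulus 48.\<close>

definition phase :: "int \<Rightarrow> int \<Rightarrow> int \<Rightarrow> int \<Rightarrow> int" where
  "phase a b c d = 2 * (a + d) * c - 2 * b * d * (c ^ 2 - 1) - 6 * c + 3 * (d ^ 2 - 1)"

lemma dvd_48I: "16 dvd x \<Longrightarrow> 3 dvd x \<Longrightarrow> 48 dvd (x :: int)"
  by presburger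

lemma square_mod_3:
  fixes c :: int
  obtains t where "c = 3 * t" | t where "c ^ 2 = 1 + 3 * t"
proof -
  consider t where "c = 3 * t" | t where "c = 3 * t + 1" | t where "c = 3 * t + 2"
  proof -
    have "c = 3 * (c div 3) \<or> c = 3 * (c div 3) + 1 \<or> c = 3 * (c div 3) + 2" by presburger
    then show ?thesis using that by blast
  qed
  then show ?thesis
  proof cases
    case 2
    then have "c ^ 2 = 1 + 3 * (3 * t ^ 2 + 2 * t)" by (simp add: power2_eq_square algebra_simps)
    then show ?thesis by (rule that(2))
  next
    case 3
    then have "c ^ 2 = 1 + 3 * (3 * t ^ 2 + 4 * t + 1)" by (simp add: power2_eq_square algebra_simps)
    then show ?thesis by (rule that(2))
  qed (rule that(1))
qed

text \<open>Mirrors the value \<open>e (2 / 48)\<close> of \<open>psi\<close> at the translation by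
  1. Modulo 16 the only doubtful term is \<open>8 * k * (a + 3 * d)\<close> with
  \<open>c = 4 * k\<close>, where \<open>a\<close> and \<open>d\<close> are both odd; modulo 3
  either \<open>c\<close> or \<open>c ^ 2 - 1\<close> vanishes.\<close>

lemma phase_translation:
  assumes det: "a * d - b * c = 1" and c: "4 dvd c"
  shows "48 dvd phase a (a + b) c (c + d) - phase a b c d - 2"
proof (rule dvd_48I)
  define \<Delta> where "\<Delta> = phase a (a + b) c (c + d) - phase a b c d - 2"
  have det0: "a * d - 1 - b * c = 0" using det by simp
  \<comment> \<open>The multiple of the determinant relation is split off explicitly, so that what
    is left to check is an identity of polynomials.\<close>
  have "\<Delta> = 5 * c ^ 2 - 2 * (a * c + 1 + 2 * b * c) * (c ^ 2 - 1) + 6 * c * d - 2 - 2 * (c ^ 2 - 1) * (a * d - 1 - b * c)"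
    unfolding \<Delta>_def phase_def by (simp add: algebra_simps power2_eq_square)
  then have \<Delta>: "\<Delta> = 5 * c ^ 2 - 2 * (a * c + 1 + 2 * b * c) * (c ^ 2 - 1) + 6 * c * d - 2"
    unfolding det0 by simp
  show "16 dvd \<Delta>"
  proof -
    obtain k where k: "c = 4 * k" using c by blast
    have "a * d = 1 + 2 * (2 * (b * k))" using det k by simp
    then have "odd (a * d)" by simp
    then have "even (a + 3 * d)" by simp
    then obtain m where m: "a + 3 * d = 2 * m" by blast
    have "\<Delta> = 16 * (5 * k ^ 2 - 2 * k ^ 2 * (4 * a * k + 1 + 8 * b * k) + b * k) + 8 * k * (a + 3 * d)"
      unfolding \<Delta> k by (simp add: algebra_simps power2_eq_square)
    also have "\<dots> = 16 * (5 * k ^ 2 - 2 * k ^ 2 * (4 * a * k + 1 + 8 * b * k) + b * k + k * m)"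
      unfolding m by (simp add: algebra_simps)
    finally show ?thesis by simp
  qed
  show "3 dvd \<Delta>"
  proof (cases c rule: square_mod_3)
    case (1 t)
    have "\<Delta> = 3 * (9 * t ^ 2 - 2 * (a * t + 2 * b * t) * (9 * t ^ 2 - 1) + 6 * t * d)"
      unfolding \<Delta> 1 by (simp add: algebra_simps power2_eq_square)
    then show ?thesis by simp
  next
    case (2 t)
    have "\<Delta> = 3 * (1 + 5 * t - 2 * t * (a * c + 1 + 2 * b * c) + 2 * c * d)"
      unfolding \<Delta> 2 by (simp add: algebra_simps)
    then show ?thesis by simp
  qed
qed

text \<open>Right multiplication by the matrix (1 0; 4 1), at which \<open>psi\<close> is
  \<open>e (- 8 / 48)\<close>. Modulo 16 the evenness of \<open>d * (d - 3)\<close> decides, modulo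
  3 the residue of \<open>d ^ 2\<close>.\<close>

lemma phase_L4:
  assumes det: "a * d - b * c = 1"
  shows "48 dvd phase (a + 4 * b) b (c + 4 * d) d - phase a b c d + 8"
proof (rule dvd_48I)
  define \<Delta> where "\<Delta> = phase (a + 4 * b) b (c + 4 * d) d - phase a b c d + 8"
  have det0: "a * d - 1 - b * c = 0" using det by simp
  have \<Delta>: "\<Delta> = 8 * (a * d) + 8 * d ^ 2 + 8 * (b * c) + 32 * b * d - 16 * b * c * d ^ 2 - 32 * b * d * d ^ 2 - 24 * d + 8"
    unfolding \<Delta>_def phase_def by (simp add: algebra_simps power2_eq_square)
  show "16 dvd \<Delta>"
  proof -
    have "even (d * (d - 3))" by simp
    then obtain m where m: "d * (d - 3) = 2 * m" by blast
    have "\<Delta> = 16 * (1 + b * c + 2 * b * d - b * c * d ^ 2 - 2 * b * d * d ^ 2) + 8 * (d * (d - 3)) + 8 * (a * d - 1 - b * c)"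
      unfolding \<Delta> by (simp add: algebra_simps power2_eq_square)
    also have "\<dots> = 16 * (1 + b * c + 2 * b * d - b * c * d ^ 2 - 2 * b * d * d ^ 2 + m)"
      unfolding m det0 by (simp add: algebra_simps)
    finally show ?thesis by simp
  qed
  show "3 dvd \<Delta>"
  proof (cases d rule: square_mod_3)
    case (1 t)
    have "\<Delta> = 3 * (16 * a * t + 24 * t ^ 2 + 32 * b * t - 48 * b * c * t ^ 2 - 288 * b * t ^ 3 - 24 * t) - 8 * (a * d - 1 - b * c)"
      unfolding \<Delta> 1 by (simp add: algebra_simps power2_eq_square power3_eq_cube)
    then show ?thesis unfolding det0 by simp
  next
    case (2 t)
    have "\<Delta> = 3 * (8 + 8 * t - 16 * b * c * t - 32 * b * d * t - 8 * d) + 8 * (a * d - 1 - b * c)"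
      unfolding \<Delta> 2 by (simp add: algebra_simps)
    then show ?thesis unfolding det0 by simp
  qed
qed

lemma e_over_48:
  assumes "48 dvd x - (y :: int)"
  shows "e (of_int x / 48) = e (of_int y / 48)"
proof -
  obtain k where "x - y = 48 * k" using assms by blast
  then have "(of_int x - of_int y :: complex) = 48 * of_int k" by (metis of_int_diff of_int_mult of_int_numeral)
  then have "of_int x / 48 - of_int y / 48 = (of_int k :: complex)" by (simp add: field_simps)
  then show ?thesis by (simp add: e_eq_iff)
qed

lemma phase_cong:
  assumes "48 dvd a - a'" "48 dvd b - b'" "48 dvd d - d'"
  shows "48 dvd phase a b c d - phase a' b' c d'"
proof -
  have mult: "48 dvd x * y - x' * y'" if "48 dvd x - x'" "48 dvd y - y'" for x y x' y' :: int
  proof -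
    have "x * y - x' * y' = x * (y - y') + (x - x') * y'" by (simp add: algebra_simps)
    then show ?thesis using that by simp
  qed
  have "phase a b c d - phase a' b' c d' = 2 * c * ((a - a') + (d - d')) - 2 * (c ^ 2 - 1) * (b * d - b' * d') + 3 * (d * d - d' * d')"
    by (simp add: phase_def algebra_simps power2_eq_square)
  also have "48 dvd \<dots>" 
    by (rule dvd_add [OF dvd_diff [OF dvd_mult dvd_mult] dvd_mult]) (use assms mult in \<open>auto intro: dvd_add\<close>)
  finally show ?thesis .
qed

context theta_eta
begin

lemma psi_L4_minus: "psi (lift 1 0 (-4) 1) = e (1 / 6)"
proof -
  have mem: "lift 1 0 (-4) 1 \<in> Gamma0 4" "lift 1 0 4 1 \<in> Gamma0 4" by (rule lift_in_Gamma0; simp)+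
  have prod: "\<exists>w. lift 1 0 (-4) 1 \<otimes>\<^bsub>Mp1Z\<^esub> lift 1 0 4 1 = (imat 1 0 0 1, w)"
    by (simp add: lift_def mult_Mp1Z)
  then have "psi (lift 1 0 (-4) 1 \<otimes>\<^bsub>Mp1Z\<^esub> lift 1 0 4 1) = 1"
    using Gamma0_mult_closed [OF mem] by (auto intro!: psi_scalar)
  then have "psi (lift 1 0 (-4) 1) * e (- 1 / 6) = 1" using psi_mult [OF mem] by (simp add: psi_L4)
  moreover have "e (1 / 6) * e (- 1 / 6) = 1" by (simp flip: e_add)
  ultimately show ?thesis by (metis mult_right_cancel e_nonzero)
qed

text \<open>The descent: the formula is already known for the product with \<open>h\<close>, whose
  phase exceeds that of \<open>g\<close> by \<open>s\<close> modulo 48.\<close>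

lemma psi_step:
  assumes g: "g \<in> Gamma0 4" and h: "h \<in> Gamma0 4" "psi h = e (of_int s / 48)"
    and gh: "psi (g \<otimes>\<^bsub>Mp1Z\<^esub> h) = e (of_int y / 48)" and dvd: "48 dvd y - x - s"
  shows "psi g = e (of_int x / 48)"
proof -
  have "psi g * e (of_int s / 48) = e (of_int y / 48)" using psi_mult [OF g h(1)] h(2) gh by simp
  also have "\<dots> = e (of_int (x + s) / 48)" by (rule e_over_48) (use dvd in \<open>simp add: algebra_simps\<close>)
  also have "\<dots> = e (of_int x / 48) * e (of_int s / 48)" by (simp add: add_divide_distrib e_add)
  finally show ?thesis by simp
qed

text \<open>Euclid's algorithm on the bottom row: \<open>T\<^sup>\<plusminus>\<^sup>1\<close> and \<open>L\<^sup>\<plusminus>\<^sup>4\<close>, acting from the right, reduce every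
  element to a scalar matrix times a power of \<open>T\<close>, since \<open>2 \<bar>d\<bar> = \<bar>c\<bar>\<close> is impossible for \<open>4 | c\<close>.\<close>

lemma psi_eq_phase:
  assumes "(imat a b c d, w) \<in> Gamma0 4"
  shows "psi (imat a b c d, w) = e (of_int (phase a b c d) / 48)"
  using assms
proof (induction "nat (\<bar>c\<bar> + \<bar>d\<bar>)" arbitrary: a b c d w rule: less_induct)
  case less
  have det: "a * d - b * c = 1" and c4: "4 dvd c" and w: "w \<in> extensional uhp"
    using less.prems by (auto elim!: Gamma0_cases)
  let ?g = "(imat a b c d, w)"
  \<comment> \<open>For nonzero \<open>c\<close> and \<open>d\<close>, the sign that makes
    \<open>n * c\<close> opposite to \<open>d\<close> and \<open>4 * n * d\<close> opposite to
    \<open>c\<close>, so that adding them can reduce absolute values.\<close>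
  define n where "n = (if (c > 0) = (d > 0) then - 1 else 1 :: int)"
  obtain k where k: "c = 4 * k" using c4 by blast
  have "odd d"
  proof
    assume "even d"
    then have "even (a * d - b * c)" using k by simp
    then show False using det by simp
  qed
  then have "d \<noteq> 0" by auto
  have "2 * \<bar>d\<bar> \<noteq> \<bar>c\<bar>"
  proof
    assume "2 * \<bar>d\<bar> = \<bar>c\<bar>"
    then have "\<bar>d\<bar> = 2 * \<bar>k\<bar>" using k by (simp add: abs_mult)
    then have "even \<bar>d\<bar>" by simp
    then show False using \<open>odd d\<close> by simp
  qed
  then consider "c = 0" | "c \<noteq> 0" "\<bar>c\<bar> < 2 * \<bar>d\<bar>" | "c \<noteq> 0" "2 * \<bar>d\<bar> < \<bar>c\<bar>" by linarith
  then show ?case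
  proof cases
    case 1
    then have "a * d = 1" using det by simp
    then have ad: "a = d" "d * d = 1" by (auto simp: zmult_eq_1_iff)
    \<comment> \<open>As \<open>d * d = 1\<close> and \<open>a = d\<close>, this translation clears
      the upper right entry.\<close>
    have h: "translation (- (b * d)) \<in> Gamma0 4" "psi (translation (- (b * d))) = e (of_int (- (2 * b * d)) / 48)"
      by (rule translation_in_Gamma0) (simp add: psi_translation)
    have "d * (b * d) = b" using ad(2) by (metis mult.commute mult.left_commute mult_1)
    then have "?g \<otimes>\<^bsub>Mp1Z\<^esub> translation (- (b * d)) = (imat d 0 0 d, \<lambda>\<tau>\<in>uhp. w (\<tau> + of_int (- (b * d))))"
      using mult_translation [OF w, of a b c d "- (b * d)"] 1 ad(1) by simp
    then have "psi (?g \<otimes>\<^bsub>Mp1Z\<^esub> translation (- (b * d))) = e (of_int 0 / 48)"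
      using psi_scalar Gamma0_mult_closed [OF less.prems h(1)] by simp
    moreover have "48 dvd 0 - phase a b c d - - (2 * b * d)"
      using 1 ad by (simp add: phase_def power2_eq_square)
    ultimately show ?thesis using psi_step [OF less.prems h] by blast
  next
    case 2
    have h: "translation n \<in> Gamma0 4" "psi (translation n) = e (of_int (2 * n) / 48)"
      by (rule translation_in_Gamma0) (simp add: psi_translation)
    have gh: "?g \<otimes>\<^bsub>Mp1Z\<^esub> translation n = (imat a (a * n + b) c (c * n + d), \<lambda>\<tau>\<in>uhp. w (\<tau> + of_int n))"
      by (rule mult_translation [OF w])
    have "\<bar>c * n + d\<bar> < \<bar>d\<bar>" using 2 \<open>d \<noteq> 0\<close> unfolding n_def by (auto simp: abs_if split: if_splits)
    then have "nat (\<bar>c\<bar> + \<bar>c * n + d\<bar>) < nat (\<bar>c\<bar> + \<bar>d\<bar>)" by linarith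
    from less.hyps [OF this Gamma0_mult_closed [OF less.prems h(1), unfolded gh]]
    have "psi (?g \<otimes>\<^bsub>Mp1Z\<^esub> translation n) = e (of_int (phase a (a * n + b) c (c * n + d)) / 48)" unfolding gh .
    moreover have "48 dvd phase a (a * n + b) c (c * n + d) - phase a b c d - 2 * n"
    proof (cases "n = 1")
      case True
      then show ?thesis using phase_translation [OF det c4] by simp
    next
      case False
      then have n: "n = - 1" by (simp add: n_def split: if_splits)
      have "48 dvd phase a b c d - phase a (b - a) c (d - c) - 2"
        using phase_translation [of a "d - c" "b - a" c] det c4 by (simp add: algebra_simps)
      then have "48 dvd - (phase a b c d - phase a (b - a) c (d - c) - 2)" by (simp only: dvd_minus_iff)
      then show ?thesis by (simp add: n algebra_simps)
    qed
    ultimately show ?thesis using psi_step [OF less.prems h] by blast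
  next
    case 3
    have n: "n = 1 \<or> n = - 1" by (simp add: n_def)
    have h: "lift 1 0 (4 * n) 1 \<in> Gamma0 4" "psi (lift 1 0 (4 * n) 1) = e (of_int (- 8 * n) / 48)"
    proof -
      show "lift 1 0 (4 * n) 1 \<in> Gamma0 4" using n by (intro lift_in_Gamma0) auto
      show "psi (lift 1 0 (4 * n) 1) = e (of_int (- 8 * n) / 48)" using n psi_L4 psi_L4_minus by auto
    qed
    obtain w' where gh: "?g \<otimes>\<^bsub>Mp1Z\<^esub> lift 1 0 (4 * n) 1 = (imat (a + 4 * b * n) b (c + 4 * d * n) d, w')"
      unfolding lift_def mult_Mp1Z by (simp add: mult_ac)
    have "\<bar>c + 4 * d * n\<bar> < \<bar>c\<bar>" using 3 \<open>d \<noteq> 0\<close> unfolding n_def by (auto simp: abs_if split: if_splits)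
    then have "nat (\<bar>c + 4 * d * n\<bar> + \<bar>d\<bar>) < nat (\<bar>c\<bar> + \<bar>d\<bar>)" by linarith
    from less.hyps [OF this Gamma0_mult_closed [OF less.prems h(1), unfolded gh]]
    have "psi (?g \<otimes>\<^bsub>Mp1Z\<^esub> lift 1 0 (4 * n) 1) = e (of_int (phase (a + 4 * b * n) b (c + 4 * d * n) d) / 48)" unfolding gh .
    moreover have "48 dvd phase (a + 4 * b * n) b (c + 4 * d * n) d - phase a b c d - (- 8 * n)"
    proof (cases "n = 1")
      case True
      then show ?thesis using phase_L4 [OF det] by simp
    next
      case False
      then have n: "n = - 1" using n by blast
      have "48 dvd phase a b c d - phase (a - 4 * b) b (c - 4 * d) d + 8"
        using phase_L4 [of "a - 4 * b" d b "c - 4 * d"] det by (simp add: algebra_simps)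
      then have "48 dvd - (phase a b c d - phase (a - 4 * b) b (c - 4 * d) d + 8)" by (simp only: dvd_minus_iff)
      then show ?thesis by (simp add: n algebra_simps)
    qed
    ultimately show ?thesis using psi_step [OF less.prems h] by blast
  qed
qed

text \<open>\<open>chi_eta\<close> is \<open>psi\<close> times \<open>chi_theta\<close>. For a fixed
  lower left entry the first factor depends on the other entries modulo 48 only; the second depends
  on \<open>a\<close> modulo 4 because that entry is an even square.\<close>

lemma eta_character_lift_eq:
  assumes det: "a * d - b * int (q ^ 2) = 1" "a' * d' - b' * int (q ^ 2) = 1"
    and q: "even q" "q > 0" and dvd: "48 dvd a - a'" "48 dvd b - b'" "48 dvd d - d'"
  shows "chi_eta (lift a b (int (q ^ 2)) d) = chi_eta (lift a' b' (int (q ^ 2)) d')"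
proof -
  obtain p where "q = 2 * p" using q by blast
  then have "4 dvd int (q ^ 2)" by (simp add: power_mult_distrib)
  then have mem: "lift a b (int (q ^ 2)) d \<in> Gamma0 4" "lift a' b' (int (q ^ 2)) d' \<in> Gamma0 4"
    using det q by (simp_all add: lift_in_Gamma0)
  have "4 dvd a - a'" using dvd(1) by (rule dvd_trans [rotated]) simp
  then have th: "chi_theta (lift a b (int (q ^ 2)) d) = chi_theta (lift a' b' (int (q ^ 2)) d')"
    by (rule theta_character_lift_eq [OF theta det q q])
  have "psi (lift a b (int (q ^ 2)) d) = psi (lift a' b' (int (q ^ 2)) d')"
    unfolding lift_def psi_eq_phase [OF mem(1) [unfolded lift_def]] psi_eq_phase [OF mem(2) [unfolded lift_def]]
    by (rule e_over_48, rule phase_cong) fact+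
  moreover have "chi_theta (lift a b (int (q ^ 2)) d) \<noteq> 0" by (rule character_nonzero [OF hom_theta mem(1)])
  ultimately show ?thesis using th by (simp add: psi_def)
qed

end

section \<open>Jacobi forms at torsion points\<close>

lemma regular_at_differentiable_snd:
  assumes "regular_at F (\<tau>, z)"
  shows "(\<lambda>z. F (\<tau>, z)) field_differentiable at z"
proof -
  obtain U a b where "open U" "(\<tau>, z) \<in> U" "(F has_derivative (\<lambda>(s, t). a * s + b * t)) (at (\<tau>, z))"
    using assms unfolding regular_at_def holomorphic2_on_def by blast
  then have F: "(F has_derivative (\<lambda>(s, t). a * s + b * t)) (at (\<tau>, z))" by blast
  have "((\<lambda>z. (\<tau>, z)) has_derivative (\<lambda>t. (0, t))) (at z)" by (auto intro!: derivative_eq_intros)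
  from has_derivative_compose [OF this F]
  have "((\<lambda>z. F (\<tau>, z)) has_derivative (\<lambda>t. b * t)) (at z)" by simp
  then show ?thesis unfolding field_differentiable_def has_field_derivative_def by blast
qed

lemma regular_at_differentiable_fst:
  assumes "regular_at F (\<tau>, z)"
  shows "(\<lambda>\<tau>. F (\<tau>, z)) field_differentiable at \<tau>"
proof -
  obtain U a b where "open U" "(\<tau>, z) \<in> U" "(F has_derivative (\<lambda>(s, t). a * s + b * t)) (at (\<tau>, z))"
    using assms unfolding regular_at_def holomorphic2_on_def by blast
  then have F: "(F has_derivative (\<lambda>(s, t). a * s + b * t)) (at (\<tau>, z))" by blast
  have "((\<lambda>\<tau>. (\<tau>, z)) has_derivative (\<lambda>t. (t, 0))) (at \<tau>)" by (auto intro!: derivative_eq_intros)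
  from has_derivative_compose [OF this F]
  have "((\<lambda>\<tau>. F (\<tau>, z)) has_derivative (\<lambda>t. a * t)) (at \<tau>)" by simp
  then show ?thesis unfolding field_differentiable_def has_field_derivative_def by blast
qed

lemma regular_at_isCont:
  assumes "regular_at F p"
  shows "isCont F p"
  using assms unfolding regular_at_def holomorphic2_on_def by (meson has_derivative_continuous)

text \<open>The specialization and the leading coefficients each choose an order of their own; this
  makes their pole factors agree. If \<open>\<nu> < \<mu>\<close>, the additional positive power of
  \<open>z\<close> forces every limit for \<open>\<mu>\<close> to be 0.\<close>

lemma order_at_zero_unique:
  assumes "has_order_at_zero \<phi> (- \<nu>)" "has_order_at_zero \<phi> (- \<mu>)"
  shows "\<nu> = \<mu>"
proof -
  have "\<not> \<nu> < \<mu>" if ord: "has_order_at_zero \<phi> (- \<nu>)" "has_order_at_zero \<phi> (- \<mu>)" for \<nu> \<mu>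
  proof
    assume "\<nu> < \<mu>"
    obtain a where a: "\<And>\<tau>. \<tau> \<in> uhp \<Longrightarrow> ((\<lambda>z. z powi \<nu> * \<phi> (\<tau>, z)) \<longlongrightarrow> a \<tau>) (at 0)"
      using ord(1) by (auto simp: has_order_at_zero_def)
    obtain b \<tau> where b: "((\<lambda>z. z powi \<mu> * \<phi> (\<tau>, z)) \<longlongrightarrow> b) (at 0)" "b \<noteq> 0" and \<tau>: "\<tau> \<in> uhp"
      using ord(2) by (auto simp: has_order_at_zero_def)
    define n where "n = nat (\<mu> - \<nu>)"
    have "n > 0" using \<open>\<nu> < \<mu>\<close> by (simp add: n_def)
    have lim: "((\<lambda>z. z ^ n * (z powi \<nu> * \<phi> (\<tau>, z))) \<longlongrightarrow> 0 ^ n * a \<tau>) (at 0)"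
      by (intro tendsto_intros a \<tau>)
    have "z ^ n * z powi \<nu> = z powi \<mu>" if "z \<noteq> 0" for z :: complex
      using \<open>\<nu> < \<mu>\<close> that by (simp add: n_def flip: power_int_add power_int_of_nat)
    then have "\<forall>\<^sub>F z in at 0. z ^ n * (z powi \<nu> * \<phi> (\<tau>, z)) = z powi \<mu> * \<phi> (\<tau>, z)"
      unfolding eventually_at_filter by (intro always_eventually) (simp add: mult.assoc [symmetric])
    from Lim_transform_eventually [OF lim this]
    have "((\<lambda>z. z powi \<mu> * \<phi> (\<tau>, z)) \<longlongrightarrow> 0) (at 0)"
      using \<open>n > 0\<close> by (simp add: zero_power)
    then show False using b tendsto_unique [OF _ b(1)] by auto
  qed
  then show ?thesis using assms by (metis linorder_neqE)
qed

lemma holomorphic_pole_factor: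
  assumes "\<And>z. z \<in> S \<Longrightarrow> z \<notin> \<int>"
  shows "pole_factor \<nu> holomorphic_on S"
proof -
  have "e (z / 2) - e (- z / 2) \<noteq> 0" if "z \<in> S" for z using assms [OF that] e_half_diff_eq_0_iff by blast
  then show ?thesis unfolding pole_factor_def by (intro holomorphic_intros) auto
qed

lemma pole_factor_nonzero: "z \<notin> \<int> \<Longrightarrow> pole_factor \<nu> z \<noteq> 0"
  using e_half_diff_eq_0_iff [of z] by (auto simp: pole_factor_def)

text \<open>The last assumption will come from the existence of an order at \<open>z = 0\<close>; it
  serves to show that the index is integral.\<close>

locale jacobi_form =
  fixes N :: nat and k :: real and m :: complex and chi' :: "mp \<Rightarrow> complex" and \<phi> :: "complex \<times> complex \<Rightarrow> complex"
  assumes jac: "weakly_holomorphic_jacobi_form k m (Gamma0 N) (\<lambda>(g, h). chi' g) \<phi>"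
    and sing: "singularities_at_torsion 1 \<phi>"
    and nonzero: "\<exists>\<tau>\<in>uhp. \<exists>z. \<phi> (\<tau>, z) \<noteq> 0"
begin

lemma chi'_nonzero: "g \<in> Gamma0 N \<Longrightarrow> chi' g \<noteq> 0"
  using character_nonzero [of jacobi_group "Gamma0 N \<times> HZ" "\<lambda>(g, h). chi' g" "(g, (0, 0, 0))"] jac
  by (auto simp: weakly_holomorphic_jacobi_form_def HZ_def)

lemma transformation:
  assumes "g \<in> Gamma0 N" "h \<in> HZ" "\<tau> \<in> uhp"
  shows "jslash_heis m (jslash_mp k m \<phi> g) h (\<tau>, z) = chi' g * \<phi> (\<tau>, z)"
proof -
  have "\<forall>g\<in>Gamma0 N \<times> HZ. \<forall>p\<in>uhp \<times> UNIV. jslash k m \<phi> g p = (case g of (g, h) \<Rightarrow> chi' g) * \<phi> p"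
    using jac unfolding weakly_holomorphic_jacobi_form_def by blast
  from this [THEN bspec, of "(g, h)", THEN bspec, of "(\<tau>, z)"] assms show ?thesis by (simp add: jslash_def)
qed

lemma transformation_mp:
  assumes "g \<in> Gamma0 N" "\<tau> \<in> uhp"
  shows "jslash_mp k m \<phi> g (\<tau>, z) = chi' g * \<phi> (\<tau>, z)"
  using transformation [OF assms(1) _ assms(2), of "(0, 0, 0)" z] by (simp add: HZ_def jslash_heis_def)

lemma jslash_translation:
  assumes "\<tau> \<in> uhp"
  shows "jslash_mp k m \<phi> (translation n) (\<tau>, z) = \<phi> (\<tau> + of_int n, z)"
  using assms by (simp add: jslash_mp_def translation_def auto_factor_imat moebius_imat mob_def)

lemma add_int_fst:
  assumes "\<tau> \<in> uhp"
  shows "\<phi> (\<tau> + of_int n, z) = chi' (translation n) * \<phi> (\<tau>, z)"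
  using transformation_mp [OF translation_in_Gamma0 assms] jslash_translation [OF assms] by simp

lemma heisenberg:
  assumes "\<tau> \<in> uhp"
  shows "e (m * (of_int l ^ 2 * \<tau> + 2 * of_int l * z + of_int v)) * \<phi> (\<tau>, z + of_int l * \<tau> + of_int u) = \<phi> (\<tau>, z)"
proof -
  \<comment> \<open>\<open>translation 0\<close> plays the identity element;
    \<open>add_int_fst\<close> with shift 0 disposes of its character value.\<close>
  have "jslash_heis m (jslash_mp k m \<phi> (translation 0)) (of_int l, of_int u, of_int v) (\<tau>, z) = chi' (translation 0) * \<phi> (\<tau>, z)"
    by (rule transformation [OF translation_in_Gamma0 _ assms]) (simp add: HZ_def)
  moreover have "chi' (translation 0) * \<phi> (\<tau>, z) = \<phi> (\<tau>, z)"
    using add_int_fst [OF assms, of 0 z] by simp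
  ultimately show ?thesis using assms by (simp add: jslash_heis_def jslash_translation)
qed

lemma add_int_snd:
  assumes "\<tau> \<in> uhp"
  shows "\<phi> (\<tau>, z + of_int u) = \<phi> (\<tau>, z)"
  using heisenberg [OF assms, of 0 z 0 u] by simp

text \<open>Central elements of the Heisenberg group act by this scalar, and trivially since the
  character ignores \<open>HZ\<close>.\<close>

lemma e_index_int: "e (m * of_int v) = 1"
proof -
  obtain \<tau> z where "\<tau> \<in> uhp" "\<phi> (\<tau>, z) \<noteq> 0" using nonzero by blast
  then show ?thesis using heisenberg [of \<tau> 0 z v 0] by simp
qed

text \<open>Multiplying \<open>j * a / l\<close> by \<open>c * \<tau> + d\<close> gives
  \<open>j * a * d / l\<close> plus an integral multiple of \<open>\<tau>\<close>, which the
  elliptic law removes. Because \<open>l ^ 2\<close> divides \<open>c\<close>, the two exponential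
  factors combine to \<open>e (m * v)\<close> with an integer \<open>v\<close>, which is 1. Finally
  \<open>a * d\<close> is 1 modulo \<open>l\<close>.\<close>

lemma transformation_lift:
  assumes det: "a * d - b * c = 1" and c: "c \<noteq> 0" "int N dvd c" "int (l ^ 2) dvd c" and l: "l > 0" and \<tau>: "\<tau> \<in> uhp"
  shows "\<phi> (mob a b c d \<tau>, of_int (j * a) / of_nat l)
    = chi' (lift a b c d) * csqrt (of_int c * \<tau> + of_int d) powi \<lfloor>2 * k\<rfloor> * \<phi> (\<tau>, of_int j / of_nat l)"
proof -
  define D where "D = of_int c * \<tau> + of_int d"
  have D: "D \<noteq> 0" unfolding D_def by (rule denominator_nonzero [OF det \<tau>])
  obtain c2 where c2: "c = int (l ^ 2) * c2" using c by blast
  define i where "i = j * a"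
  define z where "z = of_int i / of_nat l * D"
  define n where "n = i * int l * c2"
  have z: "z = of_int (i * d) / of_nat l + of_int n * \<tau>"
    using l by (simp add: z_def n_def D_def c2 power2_eq_square field_simps)
  have "csqrt D powi (- \<lfloor>2 * k\<rfloor>) * e (- m * of_int c * z ^ 2 / D) * \<phi> (mob a b c d \<tau>, z / D) = chi' (lift a b c d) * \<phi> (\<tau>, z)"
    using transformation_mp [OF lift_in_Gamma0 [OF det c(2,1)] \<tau>, of z] \<tau>
    by (simp add: jslash_mp_def lift_def auto_factor_imat moebius_imat D_def del: csqrt.simps)
  then have "\<phi> (mob a b c d \<tau>, z / D) = chi' (lift a b c d) * csqrt D powi \<lfloor>2 * k\<rfloor> * (e (m * of_int c * z ^ 2 / D) * \<phi> (\<tau>, z))"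
    using D by (simp add: power_int_minus e_minus field_simps del: csqrt.simps)
  also have "\<phi> (\<tau>, z) = e (- (m * (of_int n ^ 2 * \<tau> + 2 * of_int n * (of_int (i * d) / of_nat l)))) * \<phi> (\<tau>, of_int (i * d) / of_nat l)"
    using heisenberg [OF \<tau>, of n "of_int (i * d) / of_nat l" 0 0] unfolding z e_minus
    by (simp add: field_simps)
  also have "e (m * of_int c * z ^ 2 / D) * (e (- (m * (of_int n ^ 2 * \<tau> + 2 * of_int n * (of_int (i * d) / of_nat l)))) * \<phi> (\<tau>, of_int (i * d) / of_nat l)) = \<phi> (\<tau>, of_int (i * d) / of_nat l)"
  proof -
    have "m * of_int c * z ^ 2 / D + - (m * (of_int n ^ 2 * \<tau> + 2 * of_int n * (of_int (i * d) / of_nat l))) = m * of_int (- (i ^ 2 * c2 * d))"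
    proof -
      have 1: "m * of_int c * z ^ 2 / D = m * of_int c2 * of_int i ^ 2 * D"
        using D l by (simp add: z_def c2 power2_eq_square)
      show ?thesis unfolding 1 using l by (simp add: D_def n_def c2 power2_eq_square field_simps)
    qed
    then have "e (m * of_int c * z ^ 2 / D) * e (- (m * (of_int n ^ 2 * \<tau> + 2 * of_int n * (of_int (i * d) / of_nat l)))) = 1"
      by (simp only: e_add [symmetric] e_index_int)
    then show ?thesis by (simp add: mult.assoc [symmetric])
  qed
  also have "\<phi> (\<tau>, of_int (i * d) / of_nat l) = \<phi> (\<tau>, of_int j / of_nat l)"
  proof -
    have "a * d = 1 + b * (int (l ^ 2) * c2)" using det c2 by simp
    then have "j * (a * d) = j + (j * b * int l * c2) * int l" by (simp add: power2_eq_square algebra_simps)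
    then have "i * d = j + (j * b * int l * c2) * int l" by (simp add: i_def mult.assoc)
    then have "of_int (i * d) / of_nat l = of_int j / of_nat l + (of_int (j * b * int l * c2) :: complex)"
      using l by (simp add: field_simps)
    then show ?thesis by (simp only: add_int_snd [OF \<tau>])
  qed
  finally show ?thesis using D by (simp add: z_def D_def i_def)
qed

lemma regular:
  assumes "\<tau> \<in> uhp" "\<bar>Im z\<bar> < Im \<tau>" "z \<notin> \<int>"
  shows "regular_at \<phi> (\<tau>, z)"
proof -
  have "z \<notin> torsion_lattice 1 \<tau>"
  proof
    assume "z \<in> torsion_lattice 1 \<tau>"
    then obtain a b :: int where z: "z = of_int a + of_int b * \<tau>" by (auto simp: torsion_lattice_def)
    then have "\<bar>of_int b\<bar> * Im \<tau> < Im \<tau>" using assms by (simp add: uhp_def abs_mult)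
    then have "\<bar>of_int b :: real\<bar> < 1" using assms(1) by (simp add: uhp_def)
    then have "b = 0" by linarith
    then show False using z assms(3) by simp
  qed
  then show ?thesis using sing assms(1) by (auto simp: singularities_at_torsion_def)
qed

text \<open>The growth condition at the identity element for a real torsion point. It concerns the
  slashed function, which is known to agree with \<open>\<phi>\<close> only over the upper half
  plane, so regularity has to be carried over and \<open>Im \<tau> \<ge> 1\<close> imposed.\<close>

lemma growth:
  assumes "x \<notin> \<int>"
  shows "\<exists>Y C a. \<forall>\<tau>. Im \<tau> \<ge> Y \<longrightarrow> norm (\<phi> (\<tau>, of_rat x)) \<le> C * exp (a * Im \<tau>)"
proof -
  define G where "G = jslash_mp k m \<phi> (translation 0)"
  have G: "G (\<tau>, z) = \<phi> (\<tau>, z)" if "\<tau> \<in> uhp" for \<tau> z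
    using that by (simp add: G_def jslash_translation)
  have reg: "regular_at G (\<tau>, of_rat x)" if \<tau>: "\<tau> \<in> uhp" for \<tau>
  proof -
    have "(of_rat x :: complex) \<notin> \<int>" using assms by (simp add: of_rat_in_Ints_iff)
    then have "regular_at \<phi> (\<tau>, of_rat x)" using regular [OF \<tau>] \<tau> by (simp add: uhp_def)
    then obtain U where U: "open U" "(\<tau>, of_rat x) \<in> U" "\<phi> holomorphic2_on U" unfolding regular_at_def by blast
    define V where "V = U \<inter> (uhp \<times> UNIV)"
    have "open uhp" unfolding uhp_def by (rule open_halfspace_Im_gt)
    then have V: "open V" "(\<tau>, of_rat x) \<in> V" using U \<tau> by (auto simp: V_def intro!: open_Times)
    have "G holomorphic2_on V" unfolding holomorphic2_on_def
    proof
      fix p assume p: "p \<in> V"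
      then obtain a b where "(\<phi> has_derivative (\<lambda>(s, t). a * s + b * t)) (at p)"
        using U(3) by (auto simp: holomorphic2_on_def V_def)
      then have "(G has_derivative (\<lambda>(s, t). a * s + b * t)) (at p)"
        by (rule has_derivative_transform_within_open [OF _ V(1) p]) (auto simp: V_def G)
      then show "\<exists>a b. (G has_derivative (\<lambda>(s, t). a * s + b * t)) (at p)" by blast
    qed
    then show ?thesis unfolding regular_at_def using V by blast
  qed
  have "\<exists>a::real. \<forall>g\<in>carrier Mp1Z. (\<lambda>\<tau>. norm (jslash_mp k m \<phi> g (\<tau>, of_rat x + of_rat 0 * \<tau>)))
        \<in> O[inf (filtercomap Im at_top) (principal {\<tau>. regular_at (jslash_mp k m \<phi> g) (\<tau>, of_rat x + of_rat 0 * \<tau>)})](\<lambda>\<tau>. exp (a * Im \<tau>))"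
    using jac unfolding weakly_holomorphic_jacobi_form_def by blast
  moreover have "translation 0 \<in> carrier Mp1Z" using translation_in_Gamma0 [of 0 1] Gamma0_subset_Mp1Z by blast
  ultimately obtain a :: real where "(\<lambda>\<tau>. norm (G (\<tau>, of_rat x)))
        \<in> O[inf (filtercomap Im at_top) (principal {\<tau>. regular_at G (\<tau>, of_rat x)})](\<lambda>\<tau>. exp (a * Im \<tau>))"
    unfolding G_def by auto
  then obtain C where "\<forall>\<^sub>F \<tau> in inf (filtercomap Im at_top) (principal {\<tau>. regular_at G (\<tau>, of_rat x)}). norm (norm (G (\<tau>, of_rat x))) \<le> C * norm (exp (a * Im \<tau>))"
    by (elim landau_o.bigE)
  then obtain Y where Y: "\<And>\<tau>. Im \<tau> \<ge> Y \<Longrightarrow> regular_at G (\<tau>, of_rat x) \<Longrightarrow> norm (G (\<tau>, of_rat x)) \<le> C * exp (a * Im \<tau>)"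
    unfolding eventually_inf_principal eventually_filtercomap_at_top_linorder by auto
  have "norm (\<phi> (\<tau>, of_rat x)) \<le> C * exp (a * Im \<tau>)" if "Im \<tau> \<ge> max Y 1" for \<tau>
  proof -
    have "\<tau> \<in> uhp" using that by (simp add: uhp_def)
    then show ?thesis using Y [of \<tau>] that reg G by simp
  qed
  then show ?thesis by blast
qed

lemma special_value_expansion:
  assumes "x \<notin> \<int>" and T: "chi' (translation 1) = e (of_rat s)"
  shows "\<exists>b. has_fourier_expansion (\<lambda>\<tau>. \<phi> (\<tau>, of_rat x)) b"
proof -
  obtain Y C a where g: "\<And>\<tau>. Im \<tau> \<ge> Y \<Longrightarrow> norm (\<phi> (\<tau>, of_rat x)) \<le> C * exp (a * Im \<tau>)"
    using growth [OF assms(1)] by blast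
  have "(of_rat x :: complex) \<notin> \<int>" using assms(1) by (simp add: of_rat_in_Ints_iff)
  then have "(\<lambda>\<tau>. \<phi> (\<tau>, of_rat x)) field_differentiable at \<tau>" if "\<tau> \<in> uhp" for \<tau>
    using that regular [OF that] by (intro regular_at_differentiable_fst) (simp add: uhp_def)
  then have "(\<lambda>\<tau>. \<phi> (\<tau>, of_rat x)) holomorphic_on uhp"
    by (auto simp: holomorphic_on_def intro: field_differentiable_at_within)
  then show ?thesis
    by (rule periodic_fourier_expansion [where s = s, OF _ _ g]) (use add_int_fst [of _ 1] T in simp)
qed

end

text \<open>Rows of a summable double series are summable. Up to a nonzero factor a row is free of
  \<open>\<tau>\<close>, so for any \<open>z\<close> in the upper half plane \<open>\<tau>\<close>
  may be taken so high that \<open>z\<close> falls into the strip of validity.\<close>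

lemma
  assumes fou: "has_jacobi_fourier_expansion \<phi> c"
  shows jacobi_fourier_coefficient: "has_fourier_expansion (\<lambda>z. \<Sum>\<^sub>\<infinity>r. c n r * e (of_rat r * z)) (c n)"
    and jacobi_fourier_expansion_fst: "\<exists>\<epsilon>>0. \<forall>\<tau>\<in>uhp. \<forall>z. 0 < Im z \<longrightarrow> Im z < \<epsilon> * Im \<tau> \<longrightarrow>
      ((\<lambda>n. (\<Sum>\<^sub>\<infinity>r. c n r * e (of_rat r * z)) * e (of_rat n * \<tau>)) has_sum \<phi> (\<tau>, z)) UNIV"
proof -
  obtain \<epsilon> where \<epsilon>: "\<epsilon> > 0" and sums: "\<And>\<tau> z. \<tau> \<in> uhp \<Longrightarrow> 0 < Im z / Im \<tau> \<Longrightarrow> Im z / Im \<tau> < \<epsilon> \<Longrightarrow>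
     ((\<lambda>(n, r). c n r * e (of_rat n * \<tau> + of_rat r * z)) has_sum \<phi> (\<tau>, z)) UNIV"
    using fou unfolding has_jacobi_fourier_expansion_def by blast
  have sums': "((\<lambda>(n, r). c n r * e (of_rat n * \<tau> + of_rat r * z)) has_sum \<phi> (\<tau>, z)) (Sigma UNIV (\<lambda>_. UNIV))"
    if "\<tau> \<in> uhp" "0 < Im z" "Im z < \<epsilon> * Im \<tau>" for \<tau> z
    using sums [of \<tau> z] that by (simp add: uhp_def divide_less_eq)
  have row: "((\<lambda>r. c n r * e (of_rat r * z)) has_sum (\<Sum>\<^sub>\<infinity>r. c n r * e (of_rat r * z))) UNIV"
    if \<tau>: "\<tau> \<in> uhp" "0 < Im z" "Im z < \<epsilon> * Im \<tau>" for n \<tau> z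
  proof -
    have "(\<lambda>r. c n r * e (of_rat n * \<tau> + of_rat r * z)) summable_on UNIV"
      by (rule summable_on_SigmaD1 [OF has_sum_imp_summable [OF sums' [OF \<tau>]]]) simp
    then have "(\<lambda>r. c n r * e (of_rat n * \<tau> + of_rat r * z) * e (- of_rat n * \<tau>)) summable_on UNIV"
      by (rule summable_on_cmult_left)
    moreover have "c n r * e (of_rat n * \<tau> + of_rat r * z) * e (- of_rat n * \<tau>) = c n r * e (of_rat r * z)" for r
      by (simp add: mult.assoc flip: e_add)
    ultimately have "(\<lambda>r. c n r * e (of_rat r * z)) summable_on UNIV" by (simp only:)
    then show ?thesis by (rule has_sum_infsum)
  qed
  show "has_fourier_expansion (\<lambda>z. \<Sum>\<^sub>\<infinity>r. c n r * e (of_rat r * z)) (c n)"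
    unfolding has_fourier_expansion_def
  proof
    fix z assume z: "z \<in> uhp"
    \<comment> \<open>Makes \<open>Im z / Im \<tau>\<close> equal to
      \<open>\<epsilon> / 2\<close>.\<close>
    define \<tau> where "\<tau> = \<i> * of_real (2 * Im z / \<epsilon>)"
    show "((\<lambda>r. c n r * e (of_rat r * z)) has_sum (\<Sum>\<^sub>\<infinity>r. c n r * e (of_rat r * z))) UNIV"
      by (rule row [of \<tau>]) (use z \<epsilon> in \<open>simp_all add: uhp_def \<tau>_def\<close>)
  qed
  have "((\<lambda>n. (\<Sum>\<^sub>\<infinity>r. c n r * e (of_rat r * z)) * e (of_rat n * \<tau>)) has_sum \<phi> (\<tau>, z)) UNIV"
    if \<tau>: "\<tau> \<in> uhp" "0 < Im z" "Im z < \<epsilon> * Im \<tau>" for \<tau> z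
  proof (rule has_sum_SigmaD [OF sums' [OF \<tau>]])
    fix n
    have "((\<lambda>r. c n r * e (of_rat r * z) * e (of_rat n * \<tau>)) has_sum (\<Sum>\<^sub>\<infinity>r. c n r * e (of_rat r * z)) * e (of_rat n * \<tau>)) UNIV"
      by (rule has_sum_cmult_left [OF row [OF \<tau>]])
    then show "((\<lambda>r. case (n, r) of (n, r) \<Rightarrow> c n r * e (of_rat n * \<tau> + of_rat r * z)) has_sum (\<Sum>\<^sub>\<infinity>r. c n r * e (of_rat r * z)) * e (of_rat n * \<tau>)) UNIV"
      by (simp add: e_add mult_ac)
  qed
  then show "\<exists>\<epsilon>>0. \<forall>\<tau>\<in>uhp. \<forall>z. 0 < Im z \<longrightarrow> Im z < \<epsilon> * Im \<tau> \<longrightarrow>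
      ((\<lambda>n. (\<Sum>\<^sub>\<infinity>r. c n r * e (of_rat r * z)) * e (of_rat n * \<tau>)) has_sum \<phi> (\<tau>, z)) UNIV"
    using \<epsilon> by (intro exI [of _ \<epsilon>]) simp
qed

section \<open>Scaling, twisting and exponents of Fourier expansions\<close>

lemma fourier_expansion_cmult:
  assumes "has_fourier_expansion g b"
  shows "has_fourier_expansion (\<lambda>\<tau>. a * g \<tau>) (\<lambda>n. a * b n)"
  using assms unfolding has_fourier_expansion_def by (auto simp: mult.assoc intro!: has_sum_cmult_right)

lemma fourier_expansion_twist:
  fixes M :: nat
  assumes "has_fourier_expansion g b"
  shows "has_fourier_expansion (\<lambda>\<tau>. \<Sum>h<M. \<alpha> h * g (\<tau> + of_real (x h))) (\<lambda>n. b n * (\<Sum>h<M. \<alpha> h * e (of_rat n * of_real (x h))))"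
  unfolding has_fourier_expansion_def
proof
  fix \<tau> assume \<tau>: "\<tau> \<in> uhp"
  have "((\<lambda>n. \<Sum>h<M. \<alpha> h * (b n * e (of_rat n * (\<tau> + of_real (x h))))) has_sum (\<Sum>h<M. \<alpha> h * g (\<tau> + of_real (x h)))) UNIV"
  proof (intro has_sum_sum has_sum_cmult_right finite_lessThan)
    fix h
    have "\<tau> + of_real (x h) \<in> uhp" using \<tau> by (simp add: uhp_def)
    then show "((\<lambda>n. b n * e (of_rat n * (\<tau> + of_real (x h)))) has_sum g (\<tau> + of_real (x h))) UNIV"
      using assms by (simp add: has_fourier_expansion_def)
  qed
  moreover have "(\<Sum>h<M. \<alpha> h * (b n * e (of_rat n * (\<tau> + of_real (x h))))) = b n * (\<Sum>h<M. \<alpha> h * e (of_rat n * of_real (x h))) * e (of_rat n * \<tau>)" for n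
    by (simp add: sum_distrib_left sum_distrib_right ring_distribs e_add mult_ac)
  ultimately show "((\<lambda>n. b n * (\<Sum>h<M. \<alpha> h * e (of_rat n * of_real (x h))) * e (of_rat n * \<tau>)) has_sum (\<Sum>h<M. \<alpha> h * g (\<tau> + of_real (x h)))) UNIV"
    by simp
qed

lemma fourier_exponents:
  assumes g: "has_fourier_expansion g b" and per: "\<And>\<tau>. \<tau> \<in> uhp \<Longrightarrow> g (\<tau> + 1) = e (of_rat s) * g \<tau>" and "b n \<noteq> 0"
  shows "n - s \<in> \<int>"
proof -
  have "has_fourier_expansion (\<lambda>\<tau>. e (of_rat s) * g \<tau>) (\<lambda>n. b n * e (of_rat n))"
    using fourier_expansion_twist [OF g, of "\<lambda>_. 1" "\<lambda>_. 1" 1] per by (simp add: has_fourier_expansion_def)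
  from fourier_expansion_unique [OF this fourier_expansion_cmult [OF g]]
  have "b n * e (of_rat n) = e (of_rat s) * b n" by meson
  then have "e (of_rat n) = e (of_rat s)" using assms(3) by simp
  then have "of_rat (n - s) \<in> (\<int> :: complex set)" by (simp add: e_eq_iff of_rat_diff)
  then show ?thesis by (simp only: of_rat_in_Ints_iff)
qed

lemma fourier_expansion_zero:
  assumes "has_fourier_expansion g b" "\<And>\<tau>. \<tau> \<in> uhp \<Longrightarrow> g \<tau> = 0"
  shows "b n = 0"
proof -
  have "has_fourier_expansion g (\<lambda>_. 0)" using assms(2) by (simp add: has_fourier_expansion_def)
  from fourier_expansion_unique [OF assms(1) this] show ?thesis by simp
qed

section \<open>Values of the leading coefficients at real points\<close>

context jacobi_form
begin

text \<open>For shifts in the unit interval this is compactness. Integral translations multiply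
  \<open>\<phi>\<close> by character values of modulus 1, since \<open>s\<close> is real, so the
  bound extends to all real shifts.\<close>

lemma bounded_on_sphere:
  assumes T: "chi' (translation 1) = e (of_rat s)" and \<tau>: "\<tau> \<in> uhp" and "r < Im \<tau>" "Im z0 = 0"
    and noint: "\<And>z. z \<in> sphere z0 r \<Longrightarrow> z \<notin> \<int>"
  shows "\<exists>B. \<forall>(x::real) z. z \<in> sphere z0 r \<longrightarrow> norm (pole_factor \<nu> z * \<phi> (\<tau> + of_real x, z)) \<le> B"
proof -
  define K where "K = (\<lambda>t. \<tau> + of_real t) ` {0..1} \<times> sphere z0 r"
  have "compact K" unfolding K_def
    by (intro compact_Times compact_continuous_image continuous_intros) auto
  have Im: "\<bar>Im z\<bar> < Im \<tau>" if "z \<in> sphere z0 r" for z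
    using abs_Im_le_cmod [of "z - z0"] that assms by (simp add: dist_norm norm_minus_commute)
  have "continuous_on K (\<lambda>p. pole_factor \<nu> (snd p) * \<phi> p)"
  proof (intro continuous_on_mult)
    have "continuous_on (sphere z0 r) (pole_factor \<nu>)"
      using noint by (intro holomorphic_on_imp_continuous_on holomorphic_pole_factor)
    then show "continuous_on K (\<lambda>p. pole_factor \<nu> (snd p))"
      by (rule continuous_on_compose2) (auto simp: K_def intro!: continuous_intros)
    have "isCont \<phi> p" if "p \<in> K" for p
    proof (rule regular_at_isCont)
      obtain t z where p: "p = (\<tau> + of_real t, z)" "z \<in> sphere z0 r" using \<open>p \<in> K\<close> by (auto simp: K_def)
      show "regular_at \<phi> p" unfolding p(1)
        by (rule regular) (use \<tau> Im [OF p(2)] noint [OF p(2)] in \<open>auto simp: uhp_def\<close>)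
    qed
    then show "continuous_on K \<phi>" by (simp add: continuous_at_imp_continuous_on)
  qed
  then have "bounded ((\<lambda>p. pole_factor \<nu> (snd p) * \<phi> p) ` K)"
    using \<open>compact K\<close> compact_continuous_image compact_imp_bounded by blast
  then obtain B where B: "\<And>p. p \<in> K \<Longrightarrow> norm (pole_factor \<nu> (snd p) * \<phi> p) \<le> B"
    unfolding bounded_iff by blast
  have "norm (pole_factor \<nu> z * \<phi> (\<tau> + of_real x, z)) \<le> B" if z: "z \<in> sphere z0 r" for x :: real and z
  proof -
    \<comment> \<open>The modulus is regarded as a complex number so that
      \<open>periodic_add_int\<close> applies to it.\<close>
    define g where "g \<tau> = complex_of_real (norm (\<phi> (\<tau>, z)))" for \<tau>
    have per: "g (\<tau> + 1) = g \<tau>" if "\<tau> \<in> uhp" for \<tau>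
      using add_int_fst [OF that, of 1 z] by (simp add: g_def T norm_mult norm_e)
    have "\<tau> + of_real (frac x) \<in> uhp" using \<tau> by (simp add: uhp_def)
    from periodic_add_int [of g, OF per this, of "\<lfloor>x\<rfloor>"]
    have "g (\<tau> + of_real (frac x) + of_int \<lfloor>x\<rfloor>) = g (\<tau> + of_real (frac x))" by simp
    moreover have "\<tau> + of_real (frac x) + of_int \<lfloor>x\<rfloor> = \<tau> + of_real x" by (simp add: frac_def)
    ultimately have "norm (\<phi> (\<tau> + of_real x, z)) = norm (\<phi> (\<tau> + of_real (frac x), z))" by (simp add: g_def)
    moreover have "(\<tau> + of_real (frac x), z) \<in> K"
      unfolding K_def using z frac_ge_0 [of x] frac_lt_1 [of x] by auto
    ultimately show ?thesis using B [of "(\<tau> + of_real (frac x), z)"] by (simp add: norm_mult)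
  qed
  then show ?thesis by blast
qed

text \<open>Analytic continuation in \<open>z\<close> from the strip where the Fourier expansion is valid to the real
  points, at which \<open>\<phi>\<close> is evaluated for all \<open>\<tau>\<close>. At \<open>z0 = 0\<close> the function \<open>H\<close> removes the
  singularity.\<close>

lemma average_at_real_point:
  assumes fou: "has_jacobi_fourier_expansion \<phi> c"
    and P: "\<And>z. z \<in> uhp \<Longrightarrow> laurent_eval P z = pole_factor \<nu> z * (\<Sum>\<^sub>\<infinity>r. c n r * e (of_rat r * z))"
    and T: "chi' (translation 1) = e (of_rat s)" and \<tau>: "\<tau> \<in> uhp"
    and z0: "Im z0 = 0" "R > 0" "R \<le> Im \<tau>" and noint: "\<And>z. z \<in> ball z0 R \<Longrightarrow> z \<noteq> z0 \<Longrightarrow> z \<notin> \<int>"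
    and hol: "\<And>x::real. H (\<tau> + of_real x) holomorphic_on ball z0 R"
    and H: "\<And>(x::real) z. z \<in> ball z0 R \<Longrightarrow> z \<noteq> z0 \<Longrightarrow> H (\<tau> + of_real x) z = pole_factor \<nu> z * \<phi> (\<tau> + of_real x, z)"
  shows "(\<lambda>J. average J n (\<lambda>\<tau>'. H \<tau>' z0) \<tau>) \<longlonglongrightarrow> laurent_eval P z0"
proof -
  obtain \<epsilon> where \<epsilon>: "\<epsilon> > 0" and sums: "\<forall>\<tau>\<in>uhp. \<forall>z. 0 < Im z \<longrightarrow> Im z < \<epsilon> * Im \<tau> \<longrightarrow>
      ((\<lambda>n. (\<Sum>\<^sub>\<infinity>r. c n r * e (of_rat r * z)) * e (of_rat n * \<tau>)) has_sum \<phi> (\<tau>, z)) UNIV"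
    using jacobi_fourier_expansion_fst [OF fou] by blast
  define r where "r = R / 2"
  have r: "0 < r" "r < R" using z0 by (simp_all add: r_def)
  have sub: "cball z0 r \<subseteq> ball z0 R" using r by auto
  have sphere: "z \<in> ball z0 R \<and> z \<noteq> z0" if "z \<in> sphere z0 r" for z using that r by auto
  have "\<exists>B. \<forall>(x::real) z. z \<in> sphere z0 r \<longrightarrow> norm (pole_factor \<nu> z * \<phi> (\<tau> + of_real x, z)) \<le> B"
    by (rule bounded_on_sphere [OF T \<tau> _ z0(1)]) (use r z0 noint sphere in auto)
  then obtain B where B: "\<And>(x::real) z. z \<in> sphere z0 r \<Longrightarrow> norm (pole_factor \<nu> z * \<phi> (\<tau> + of_real x, z)) \<le> B"
    by blast
  show ?thesis
  proof (rule average_continuation [OF r(1) _ z0(1)])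
    show "\<epsilon> * Im \<tau> > 0" using \<epsilon> \<tau> by (simp add: uhp_def)
    show "H (\<tau> + of_real x) holomorphic_on ball z0 r" for x
      using hol by (rule holomorphic_on_subset) (use sub ball_subset_cball in blast)
    \<comment> \<open>On the sphere \<open>H\<close> is bounded independently of \<open>x\<close>;
      the maximum principle carries the bound inside, across the possible singularity of
      \<open>\<phi>\<close> at the centre.\<close>
    show "norm (H (\<tau> + of_real x) z) \<le> B" if z: "z \<in> ball z0 r" for x z
    proof (rule maximum_modulus_frontier [of "H (\<tau> + of_real x)" "ball z0 r"])
      show "H (\<tau> + of_real x) holomorphic_on interior (ball z0 r)"
        using hol by (rule holomorphic_on_subset) (use sub ball_subset_cball interior_subset in blast)
      show "continuous_on (closure (ball z0 r)) (H (\<tau> + of_real x))"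
        using holomorphic_on_imp_continuous_on [OF hol] by (rule continuous_on_subset) (use r sub in simp)
      show "norm (H (\<tau> + of_real x) w) \<le> B" if "w \<in> frontier (ball z0 r)" for w
      proof -
        have w: "w \<in> sphere z0 r" using that r by simp
        then show ?thesis using B [OF w, of x] H [of w x] sphere [OF w] by simp
      qed
    qed (use z in auto)
    show "laurent_eval P holomorphic_on ball z0 r" by (intro holomorphic_intros)
    show "(\<lambda>J. average J n (\<lambda>\<tau>'. H \<tau>' z) \<tau>) \<longlonglongrightarrow> laurent_eval P z"
      if z: "z \<in> ball z0 r" "0 < Im z" "Im z < \<epsilon> * Im \<tau>" for z
    proof -
      have "(\<lambda>J. average J n (\<lambda>\<tau>'. H \<tau>' z) \<tau>) \<longlonglongrightarrow> pole_factor \<nu> z * (\<Sum>\<^sub>\<infinity>r. c n r * e (of_rat r * z))"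
      proof (rule average_tendsto)
        fix x :: real
        have phi_sum: "((\<lambda>n. (\<Sum>\<^sub>\<infinity>r. c n r * e (of_rat r * z)) * e (of_rat n * (\<tau> + of_real x))) has_sum \<phi> (\<tau> + of_real x, z)) UNIV"
          by (rule sums [rule_format]) (use \<tau> z in \<open>simp_all add: uhp_def\<close>)
        show "((\<lambda>n. pole_factor \<nu> z * (\<Sum>\<^sub>\<infinity>r. c n r * e (of_rat r * z)) * e (of_rat n * (\<tau> + of_real x))) has_sum H (\<tau> + of_real x) z) UNIV"
        proof -
          have "z \<noteq> z0" "z \<in> ball z0 R" using z z0(1) r by auto
          then have "H (\<tau> + of_real x) z = pole_factor \<nu> z * \<phi> (\<tau> + of_real x, z)" using H by blast
          then show ?thesis using has_sum_cmult_right [OF phi_sum, of "pole_factor \<nu> z"] by (simp only: mult.assoc)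
        qed
      qed
      then show ?thesis using P [of z] z by (simp add: uhp_def)
    qed
  qed
qed

text \<open>Two limits of the same averages at \<open>x\<close> are compared:
  \<open>average_at_real_point\<close> yields the continued leading coefficient,
  \<open>fourier_expansion_average\<close> the coefficient of the expansion of \<open>\<phi>\<close>
  at this torsion point.\<close>

lemma coefficient_at_special_value:
  assumes fou: "has_jacobi_fourier_expansion \<phi> c"
    and P: "\<And>z. z \<in> uhp \<Longrightarrow> laurent_eval P z = pole_factor \<nu> z * (\<Sum>\<^sub>\<infinity>r. c n r * e (of_rat r * z))"
    and T: "chi' (translation 1) = e (of_rat s)"
    and x: "x \<notin> \<int>" and b: "has_fourier_expansion (\<lambda>\<tau>. \<phi> (\<tau>, of_rat x)) b"
  shows "laurent_eval P (of_rat x) = pole_factor \<nu> (of_rat x) * b n"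
proof -
  have \<i>: "\<i> \<in> uhp" by (simp add: uhp_def)
  have xc: "(of_rat x :: complex) \<notin> \<int>" using x by (simp add: of_rat_in_Ints_iff)
  have "open (- (\<int> :: complex set))" by (rule open_Compl [OF closed_Ints])
  then obtain R0 where R0: "R0 > 0" "ball (of_rat x) R0 \<subseteq> - (\<int> :: complex set)"
    using xc by (auto simp: open_contains_ball)
  \<comment> \<open>Radius at most 1 keeps the imaginary part of \<open>z\<close> below that of the
    points \<open>\<i> + y\<close>.\<close>
  define R where "R = min R0 1"
  define H where "H \<tau> z = pole_factor \<nu> z * \<phi> (\<tau>, z)" for \<tau> z
  have noint: "z \<notin> \<int>" if "z \<in> ball (of_rat x) R" for z :: complex
  proof -
    have "z \<in> ball (of_rat x) R0" using that by (simp add: R_def)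
    then show ?thesis using R0(2) by blast
  qed
  have "(\<lambda>J. average J n (\<lambda>\<tau>'. H \<tau>' (of_rat x)) \<i>) \<longlonglongrightarrow> laurent_eval P (of_rat x)"
  proof (rule average_at_real_point [OF fou P T \<i>])
    show "H (\<i> + of_real y) holomorphic_on ball (of_rat x) R" for y
    proof -
      have "(\<lambda>z. \<phi> (\<i> + of_real y, z)) field_differentiable at z" if z: "z \<in> ball (of_rat x) R" for z
      proof (intro regular_at_differentiable_snd regular)
        have "\<bar>Im (z - of_rat x)\<bar> < 1" using z abs_Im_le_cmod [of "z - of_rat x"] by (simp add: R_def dist_norm norm_minus_commute)
        then show "\<bar>Im z\<bar> < Im (\<i> + of_real y)" by simp
      qed (use noint [OF z] in \<open>auto simp: uhp_def\<close>)
      then have "(\<lambda>z. \<phi> (\<i> + of_real y, z)) holomorphic_on ball (of_rat x) R"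
        by (auto simp: holomorphic_on_def intro: field_differentiable_at_within)
      then show ?thesis unfolding H_def by (intro holomorphic_intros holomorphic_pole_factor noint)
    qed
  qed (use R0 noint in \<open>auto simp: R_def H_def\<close>)
  moreover have "(\<lambda>J. average J n (\<lambda>\<tau>'. H \<tau>' (of_rat x)) \<i>) \<longlonglongrightarrow> pole_factor \<nu> (of_rat x) * b n"
    unfolding H_def by (rule fourier_expansion_average [OF fourier_expansion_cmult [OF b] \<i>])
  ultimately show ?thesis by (rule LIMSEQ_unique)
qed

text \<open>The same comparison at \<open>z = 0\<close>: multiplication by the pole factor makes the
  singularity removable, and the value filled in is that of \<open>f\<close>.\<close>

lemma coefficient_of_specialization:
  assumes fou: "has_jacobi_fourier_expansion \<phi> c"
    and P: "\<And>z. z \<in> uhp \<Longrightarrow> laurent_eval P z = pole_factor \<nu> z * (\<Sum>\<^sub>\<infinity>r. c n r * e (of_rat r * z))"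
    and T: "chi' (translation 1) = e (of_rat s)"
    and f: "\<And>\<tau>. \<tau> \<in> uhp \<Longrightarrow> ((\<lambda>z. pole_factor \<nu> z * \<phi> (\<tau>, z)) \<longlongrightarrow> f \<tau>) (at 0)"
    and b: "has_fourier_expansion f b"
  shows "laurent_eval P 0 = b n"
proof -
  have \<i>: "\<i> \<in> uhp" by (simp add: uhp_def)
  define H where "H \<tau> z = (if z = 0 then f \<tau> else pole_factor \<nu> z * \<phi> (\<tau>, z))" for \<tau> z
  have noint: "z \<notin> \<int>" if "z \<in> ball 0 1" "z \<noteq> 0" for z :: complex
    using that Ints_nonzero_abs_less1 by (auto elim!: Ints_cases)
  have "(\<lambda>J. average J n (\<lambda>\<tau>'. H \<tau>' 0) \<i>) \<longlonglongrightarrow> laurent_eval P 0"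
  proof (rule average_at_real_point [OF fou P T \<i>, where R = 1])
    show "H (\<i> + of_real y) holomorphic_on ball 0 1" for y
    proof (rule no_isolated_singularity' [where K = "{0}"])
      have \<tau>: "\<i> + of_real y \<in> uhp" by (simp add: uhp_def)
      have "(H (\<i> + of_real y) \<longlongrightarrow> f (\<i> + of_real y)) (at 0)"
        using f [OF \<tau>] by (rule Lim_transform_eventually) (simp add: eventually_at_filter H_def)
      then show "(H (\<i> + of_real y) \<longlongrightarrow> H (\<i> + of_real y) z) (at z within ball 0 1)" if "z \<in> {0}" for z
        using that by (auto simp: H_def intro: tendsto_within_subset)
      have "(\<lambda>z. \<phi> (\<i> + of_real y, z)) field_differentiable at z" if z: "z \<in> ball 0 1 - {0}" for z
      proof (intro regular_at_differentiable_snd regular)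
        show "\<bar>Im z\<bar> < Im (\<i> + of_real y)" using z abs_Im_le_cmod [of z] by simp
      qed (use noint z in \<open>auto simp: uhp_def\<close>)
      then have "(\<lambda>z. \<phi> (\<i> + of_real y, z)) holomorphic_on ball 0 1 - {0}"
        by (auto simp: holomorphic_on_def intro: field_differentiable_at_within)
      then have "(\<lambda>z. pole_factor \<nu> z * \<phi> (\<i> + of_real y, z)) holomorphic_on ball 0 1 - {0}"
        by (intro holomorphic_intros holomorphic_pole_factor) (use noint in auto)
      then show "H (\<i> + of_real y) holomorphic_on ball 0 1 - {0}"
        by (rule holomorphic_transform) (simp add: H_def)
    qed auto
  qed (use noint in \<open>auto simp: H_def\<close>)
  moreover have "(\<lambda>J. average J n (\<lambda>\<tau>'. H \<tau>' 0) \<i>) \<longlonglongrightarrow> b n"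
    unfolding H_def using fourier_expansion_average [OF b \<i>] by simp
  ultimately show ?thesis by (rule LIMSEQ_unique)
qed

end

section \<open>Transfer of congruences\<close>

text \<open>Let \<open>t\<close> be the product of the primes of \<open>Q\<close> that do not divide
  \<open>u\<close>. A prime of \<open>Q\<close> dividing \<open>u\<close> divides neither
  \<open>W\<close> nor \<open>t\<close>, and one not dividing \<open>u\<close> divides
  \<open>t\<close>; in both cases it does not divide \<open>u + W * t\<close>.\<close>

lemma coprime_in_progression:
  fixes u W Q :: int
  assumes "coprime u W" "Q \<noteq> 0"
  shows "\<exists>t. coprime (u + W * t) Q"
proof -
  define t where "t = \<Prod>{p \<in> prime_factors Q. \<not> p dvd u}"
  have fin: "finite {p \<in> prime_factors Q. \<not> p dvd u}" by simp
  have "coprime (u + W * t) Q"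
  proof (rule ccontr)
    assume "\<not> coprime (u + W * t) Q"
    then have "gcd (u + W * t) Q \<noteq> 0" "\<not> is_unit (gcd (u + W * t) Q)"
      using assms(2) by (auto simp: is_unit_gcd)
    then obtain p where p: "p dvd gcd (u + W * t) Q" "Factorial_Ring.prime p"
      using prime_divisor_exists by blast
    then have pQ: "p \<in> prime_factors Q" and pu: "p dvd u + W * t"
      using assms(2) by (auto intro: prime_factorsI)
    show False
    proof (cases "p dvd u")
      case True
      then have "\<not> p dvd W" using assms(1) p(2) by (meson coprime_common_divisor not_prime_unit)
      have "p dvd W * t" using True pu by (simp add: dvd_add_right_iff)
      then have "p dvd t" using \<open>\<not> p dvd W\<close> p(2) prime_dvd_mult_iff by blast
      then obtain p' where p': "p' \<in> {p \<in> prime_factors Q. \<not> p dvd u}" "p dvd p'"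
        using prime_dvd_prod_iff [OF fin p(2), of "\<lambda>x. x"] unfolding t_def by auto
      have "Factorial_Ring.prime p'" using p'(1) by (auto simp: in_prime_factors_iff)
      from primes_dvd_imp_eq [OF p(2) this p'(2)] have "p = p'" .
      then show False using p' True by simp
    next
      case False
      then have "p \<in> {p \<in> prime_factors Q. \<not> p dvd u}" using pQ by simp
      from dvd_prodI [OF fin this, of "\<lambda>x. x"] have "p dvd t" by (simp add: t_def)
      then show False using False pu by (simp add: dvd_add_left_iff)
    qed
  qed
  then show ?thesis by blast
qed

lemma dirichlet_character_periodic:
  assumes "dirichlet_character N chi"
  shows "chi (a + int N * t) = chi a"
proof (induction t rule: int_induct [where k = 0])
  case (step1 i)
  have "chi (a + int N * i + int N) = chi (a + int N * i)" using assms by (simp add: dirichlet_character_def)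
  then show ?case using step1 by (simp add: ring_distribs add_ac)
next
  case (step2 i)
  have "chi (a + int N * (i - 1) + int N) = chi (a + int N * (i - 1))" using assms by (simp add: dirichlet_character_def)
  then show ?case using step2 by (simp add: ring_distribs add_ac)
qed simp

lemma dirichlet_character_1:
  assumes "dirichlet_character N chi"
  shows "chi 1 = 1"
proof -
  have "chi 1 * chi 1 = chi 1 * 1" "chi 1 \<noteq> 0"
    using assms unfolding dirichlet_character_def by (metis mult_1 mult_1_right, metis coprime_1_left)
  then show ?thesis by simp
qed

lemma character_of_dirichlet_lift [simp]: "character_of_dirichlet chi (lift a b c d) = chi d"
  by (simp add: character_of_dirichlet_def lift_def)

lemma character_of_dirichlet_translation [simp]: "character_of_dirichlet chi (translation n) = chi 1"
  by (simp add: character_of_dirichlet_def translation_def)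

lemma order_at_zero_nonzero:
  assumes "has_order_at_zero \<phi> n"
  shows "\<exists>\<tau>\<in>uhp. \<exists>z. \<phi> (\<tau>, z) \<noteq> 0"
proof (rule ccontr)
  assume "\<not> ?thesis"
  then have zero: "\<phi> (\<tau>, z) = 0" if "\<tau> \<in> uhp" for \<tau> z using that by blast
  obtain a \<tau> where "\<tau> \<in> uhp" "a \<noteq> 0" "((\<lambda>z. z powi (- n) * \<phi> (\<tau>, z)) \<longlongrightarrow> a) (at 0)"
    using assms by (auto simp: has_order_at_zero_def)
  then have "((\<lambda>z :: complex. 0) \<longlongrightarrow> a) (at 0)" using zero by simp
  then show False using \<open>a \<noteq> 0\<close> by (simp add: tendsto_const_iff)
qed

text \<open>\<open>T\<^bsup>h/M\<^esup> \<gamma> = \<gamma>\<^sub>h T\<^bsup>d\<^sup>2h/M\<^esup>\<close> with \<open>\<gamma>\<^sub>h\<close> integral and congruent to \<open>\<gamma>\<close> modulo \<open>c1\<close>, where the lower left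
  entry of \<open>\<gamma>\<close> is \<open>M\<^sup>2 c1\<close>.\<close>

lemma conjugate_by_translation:
  fixes a b d h M c1 :: int
  assumes det: "a * d - b * (M ^ 2 * c1) = 1" and M: "M \<noteq> 0" and \<tau>: "\<tau> \<in> uhp"
  defines "a' \<equiv> a + h * M * c1" and "b' \<equiv> b - h * d * b * M * c1 - h ^ 2 * d ^ 2 * c1" and "d' \<equiv> d - M * c1 * d ^ 2 * h"
    and "\<tau>' \<equiv> \<tau> + of_int (d ^ 2 * h) / of_int M"
  shows "a' * d' - b' * (M ^ 2 * c1) = 1"
    and "of_int (M ^ 2 * c1) * \<tau>' + of_int d' = of_int (M ^ 2 * c1) * \<tau> + of_int d"
    and "mob a' b' (M ^ 2 * c1) d' \<tau>' = mob a b (M ^ 2 * c1) d \<tau> + of_int h / of_int M"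
proof -
  have "a' * d' - b' * (M ^ 2 * c1) = (a * d - b * (M ^ 2 * c1)) + h * M * c1 * d * (1 - (a * d - b * (M ^ 2 * c1)))"
    unfolding a'_def b'_def d'_def by (simp add: algebra_simps power2_eq_square)
  then show "a' * d' - b' * (M ^ 2 * c1) = 1" unfolding det by simp
  show den: "of_int (M ^ 2 * c1) * \<tau>' + of_int d' = of_int (M ^ 2 * c1) * \<tau> + of_int d"
    using M unfolding d'_def \<tau>'_def by (simp add: field_simps power2_eq_square)
  define D where "D = of_int (M ^ 2 * c1) * \<tau> + of_int d"
  have D: "D \<noteq> 0" unfolding D_def by (rule denominator_nonzero [OF det \<tau>])
  have "(of_int (a * d - b * (M ^ 2 * c1)) :: complex) = 1" unfolding det by simp
  then have ad: "of_int a * of_int d - of_int b * (of_int M ^ 2 * of_int c1) = (1 :: complex)" by simp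
  have "of_int a' * \<tau>' + of_int b' = of_int a * \<tau> + of_int b + of_int h / of_int M * D
     + (of_int a * of_int d - of_int b * (of_int M ^ 2 * of_int c1) - 1) * (of_int h * of_int d / of_int M)"
    using M unfolding a'_def b'_def \<tau>'_def D_def by (simp add: field_simps power2_eq_square)
  then have "of_int a' * \<tau>' + of_int b' = of_int a * \<tau> + of_int b + of_int h / of_int M * D" unfolding ad by simp
  then show "mob a' b' (M ^ 2 * c1) d' \<tau>' = mob a b (M ^ 2 * c1) d \<tau> + of_int h / of_int M"
    using D unfolding mob_def den D_def [symmetric] by (simp add: add_divide_distrib)
qed

section \<open>Transport of the sieve by a modular substitution\<close>

context jacobi_form
begin

text \<open>The twisted sum over \<open>h\<close> filters exponents congruent to \<beta> modulo
  \<open>M\<close>. At \<open>j * a / l\<close> it vanishes identically: all exponents lie in one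
  class modulo 1, those in the progression have coefficient 0, and the others are cancelled by roots
  of unity. Conjugation turns the shifts \<open>h / M\<close> into \<open>d ^ 2 * h / M\<close> at
  \<open>j / l\<close>, where the coefficient at \<open>n0\<close> is counted \<open>M\<close>
  times.\<close>

lemma vanishing_transfer:
  fixes M l :: nat and \<beta> s n0 :: rat and a b d j t :: int and c1 :: int
  assumes T: "chi' (translation 1) = e (of_rat s)" and pos: "l > 0" "M > 0" "c1 \<noteq> 0"
    and c1: "int N dvd c1" "int (l ^ 2) dvd c1"
    and \<beta>: "\<beta> - s \<in> \<int>" and det: "a * d - b * (int M ^ 2 * c1) = 1"
    and chi_const: "\<And>h. chi' (lift (a + h * int M * c1) (b - h * d * b * int M * c1 - h ^ 2 * d ^ 2 * c1) (int M ^ 2 * c1) (d - int M * c1 * d ^ 2 * h))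
       = chi' (lift a b (int M ^ 2 * c1) d)"
    and expansion: "\<And>j. \<not> int l dvd j \<Longrightarrow> has_fourier_expansion (\<lambda>\<tau>. \<phi> (\<tau>, of_int j / of_nat l)) (B j)"
    and vanish: "\<And>j n. \<not> int l dvd j \<Longrightarrow> n \<in> progression M \<beta> \<Longrightarrow> B j n = 0"
    and j: "\<not> int l dvd j" and n0: "of_int (d ^ 2) * n0 - \<beta> = of_int (int M * t)"
  shows "B j n0 = 0"
proof -
  define c where "c = int M ^ 2 * c1"
  have c: "c \<noteq> 0" "int N dvd c" "int (l ^ 2) dvd c" using c1 pos by (auto simp: c_def)
  have "int l dvd int (l ^ 2)" by (simp add: power2_eq_square)
  then have lc: "int l dvd c" "int l dvd c1" using c(3) c1(2) by (meson dvd_trans)+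
  have det': "a * d - b * c = 1" using det by (simp add: c_def)
  \<comment> \<open>\<open>a\<close> is a unit modulo \<open>l\<close>, because \<open>l\<close>
    divides \<open>c\<close>.\<close>
  have ja: "\<not> int l dvd j * a"
  proof
    assume "int l dvd j * a"
    then have "int l dvd j * (a * d) - j * b * c" using lc by (metis dvd_diff dvd_mult dvd_mult2 mult.assoc)
    also have "j * (a * d) - j * b * c = j * (a * d - b * c)" by (simp add: algebra_simps)
    finally show False using j det' by simp
  qed
  define \<alpha> where "\<alpha> h = e (- of_rat \<beta> * of_real (of_nat h / of_nat M))" for h :: nat
  have sum0: "(\<Sum>h<M. \<alpha> h * \<phi> (\<tau> + of_real (of_nat h / of_nat M), of_int (j * a) / of_nat l)) = 0" if \<tau>: "\<tau> \<in> uhp" for \<tau>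
  proof -
    have coeff0: "B (j * a) n * (\<Sum>h<M. \<alpha> h * e (of_rat n * of_real (of_nat h / of_nat M))) = 0" for n
    proof (cases "B (j * a) n = 0")
      case False
      have "n - s \<in> \<int>"
        by (rule fourier_exponents [OF expansion [OF ja] _ False]) (use add_int_fst [of _ 1] T in simp)
      then have "(n - s) - (\<beta> - s) \<in> \<int>" using \<beta> by (rule Ints_diff)
      then obtain i where i: "n - \<beta> = of_int i" by (auto elim: Ints_cases)
      have "\<not> int M dvd i"
      proof
        assume "int M dvd i"
        then obtain k where "i = int M * k" by blast
        then have "n = of_int (int M * k) + \<beta>" using i by (simp add: algebra_simps)
        then have "n \<in> progression M \<beta>" unfolding progression_def by blast
        then show False using vanish [OF ja] False by blast
      qed
      then have not: "(of_int i / of_nat M :: complex) \<notin> \<int>" by (simp only: of_int_div_of_nat_in_Ints_iff [OF pos(2)] not_False_eq_True)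
      have "\<alpha> h * e (of_rat n * of_real (of_nat h / of_nat M)) = e (of_nat h * (of_int i / of_nat M))" for h
      proof -
        have "of_rat n - of_rat \<beta> = (of_int i :: complex)" by (metis i of_rat_diff of_rat_of_int_eq)
        then have "- of_rat \<beta> * of_real (of_nat h / of_nat M) + of_rat n * of_real (of_nat h / of_nat M) = of_nat h * (of_int i / (of_nat M :: complex))"
          by (simp flip: left_diff_distrib add: diff_divide_distrib [symmetric] algebra_simps)
        then show ?thesis unfolding \<alpha>_def by (simp only: e_add [symmetric])
      qed
      moreover have "(\<Sum>h<M. e (of_nat h * (of_int i / of_nat M))) = 0"
        using e_sum_roots [of M "of_int i / of_nat M"] not pos by simp
      ultimately show ?thesis by simp
    qed simp
    have "has_fourier_expansion (\<lambda>\<tau>. \<Sum>h<M. \<alpha> h * \<phi> (\<tau> + of_real (of_nat h / of_nat M), of_int (j * a) / of_nat l)) (\<lambda>_. 0)"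
      using fourier_expansion_twist [OF expansion [OF ja], of \<alpha> "\<lambda>h. of_nat h / of_nat M" M]
      unfolding coeff0 .
    then have "((\<lambda>n. 0 * e (of_rat n * \<tau>)) has_sum (\<Sum>h<M. \<alpha> h * \<phi> (\<tau> + of_real (of_nat h / of_nat M), of_int (j * a) / of_nat l))) UNIV"
      using \<tau> unfolding has_fourier_expansion_def by blast
    then show ?thesis using has_sum_unique [OF _ has_sum_0_simp] by simp
  qed
  define x where "x h = of_int (d ^ 2) * of_nat h / real M" for h :: nat
  have sum1: "(\<Sum>h<M. \<alpha> h * \<phi> (\<tau> + of_real (x h), of_int j / of_nat l)) = 0" if \<tau>: "\<tau> \<in> uhp" for \<tau>
  proof -
    define w where "w = chi' (lift a b c d) * csqrt (of_int c * \<tau> + of_int d) powi \<lfloor>2 * k\<rfloor>"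
    have "lift a b c d \<in> Gamma0 N" by (rule lift_in_Gamma0 [OF det' c(2,1)])
    then have w: "w \<noteq> 0" unfolding w_def using chi'_nonzero denominator_nonzero [OF det' \<tau>] by (simp del: csqrt.simps)
    have "\<phi> (mob a b c d \<tau> + of_real (of_nat h / of_nat M), of_int (j * a) / of_nat l) = w * \<phi> (\<tau> + of_real (x h), of_int j / of_nat l)" for h :: nat
    proof -
      define a' where "a' = a + int h * int M * c1"
      define b' where "b' = b - int h * d * b * int M * c1 - int h ^ 2 * d ^ 2 * c1"
      define d' where "d' = d - int M * c1 * d ^ 2 * int h"
      define \<tau>' where "\<tau>' = \<tau> + of_int (d ^ 2 * int h) / of_int (int M)"
      have \<tau>'_eq: "\<tau>' = \<tau> + of_real (x h)" by (simp add: \<tau>'_def x_def)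
      have \<tau>': "\<tau>' \<in> uhp" using \<tau> unfolding \<tau>'_eq by (simp add: uhp_def)
      have "int M \<noteq> 0" using pos by simp
      note conj = conjugate_by_translation [OF det this \<tau>, of "int h", folded a'_def b'_def d'_def c_def \<tau>'_def]
      \<comment> \<open>\<open>a'\<close> differs from \<open>a\<close> by a multiple of
        \<open>l\<close>, so \<open>\<phi>\<close> takes the same value at both torsion
        points.\<close>
      have "of_int (j * a') / of_nat l = of_int (j * a) / of_nat l + (of_int (j * int h * int M * (c1 div int l)) :: complex)"
      proof -
        obtain c2 where "c1 = int l * c2" using lc by blast
        then show ?thesis using pos by (simp add: a'_def field_simps)
      qed
      then have "\<phi> (mob a' b' c d' \<tau>', of_int (j * a') / of_nat l) = \<phi> (mob a' b' c d' \<tau>', of_int (j * a) / of_nat l)"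
        by (simp only: add_int_snd [OF mob_in_uhp [OF conj(1) \<tau>']])
      moreover have "\<phi> (mob a' b' c d' \<tau>', of_int (j * a') / of_nat l)
        = chi' (lift a' b' c d') * csqrt (of_int c * \<tau>' + of_int d') powi \<lfloor>2 * k\<rfloor> * \<phi> (\<tau>', of_int j / of_nat l)"
        by (rule transformation_lift [OF conj(1) c pos(1) \<tau>'])
      moreover have "chi' (lift a' b' c d') = chi' (lift a b c d)"
        unfolding a'_def b'_def d'_def c_def by (rule chi_const)
      ultimately have "\<phi> (mob a b c d \<tau> + of_int (int h) / of_int (int M), of_int (j * a) / of_nat l) = w * \<phi> (\<tau>', of_int j / of_nat l)"
        unfolding conj(2,3) w_def by simp
      then show ?thesis unfolding \<tau>'_eq by simp
    qed
    then have "(\<Sum>h<M. \<alpha> h * \<phi> (mob a b c d \<tau> + of_real (of_nat h / of_nat M), of_int (j * a) / of_nat l)) = w * (\<Sum>h<M. \<alpha> h * \<phi> (\<tau> + of_real (x h), of_int j / of_nat l))"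
      by (simp add: sum_distrib_left mult.left_commute)
    then show ?thesis using sum0 [OF mob_in_uhp [OF det' \<tau>]] w by simp
  qed
  have "B j n0 * (\<Sum>h<M. \<alpha> h * e (of_rat n0 * of_real (x h))) = 0"
    by (rule fourier_expansion_zero [OF fourier_expansion_twist [OF expansion [OF j]] sum1])
  \<comment> \<open>All \<open>M\<close> phases are 1, as \<open>d ^ 2 * n0 - \<beta>\<close> is an
    integral multiple of \<open>M\<close>.\<close>
  moreover have "\<alpha> h * e (of_rat n0 * of_real (x h)) = 1" for h
  proof -
    have "(of_rat (of_int (d ^ 2) * n0 - \<beta>) :: complex) = of_rat (of_int (int M * t))" unfolding n0 ..
    then have "of_int (d ^ 2) * of_rat n0 - of_rat \<beta> = (of_nat M * of_int t :: complex)"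
      by (simp add: of_rat_diff of_rat_mult of_rat_power)
    then have "- of_rat \<beta> = of_nat M * of_int t - of_int (d ^ 2) * (of_rat n0 :: complex)" by (simp add: algebra_simps)
    then have "- of_rat \<beta> * of_real (of_nat h / of_nat M) + of_rat n0 * of_real (x h) = (of_int (t * int h) :: complex)"
      using pos by (simp add: x_def field_simps)
    then show ?thesis unfolding \<alpha>_def by (simp only: e_add [symmetric] e_of_int)
  qed
  ultimately show ?thesis using pos by simp
qed

end

lemma character_translation:
  assumes "dirichlet_character N chi" and "theta_character chi_theta" and "eta_character chi_eta"
    and "(4 dvd N \<and> chi' = (\<lambda>g. character_of_dirichlet chi g * chi_theta g)) \<or>
         chi' = (\<lambda>g. character_of_dirichlet chi g * chi_eta g)"
  shows "chi' (translation 1) = e (of_rat 0) \<or> chi' (translation 1) = e (of_rat (1 / 24))"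
proof -
  interpret theta_eta chi_theta chi_eta using assms(2,3) by unfold_locales
  show ?thesis using assms(4)
    by (auto simp: chi_theta_translation chi_eta_translation dirichlet_character_1 [OF assms(1)] of_rat_divide)
qed

text \<open>The Dirichlet factor sees \<open>d\<close> modulo \<open>N\<close>; since the common
  lower left entry is an even square, theta sees \<open>a\<close> modulo 4 and eta sees the other
  entries modulo 48.\<close>

lemma character_lift_cong:
  assumes "dirichlet_character N chi" and "theta_character chi_theta" and "eta_character chi_eta"
    and "(4 dvd N \<and> chi' = (\<lambda>g. character_of_dirichlet chi g * chi_theta g)) \<or>
         chi' = (\<lambda>g. character_of_dirichlet chi g * chi_eta g)"
    and det: "a * d - b * int (q ^ 2) = 1" "a' * d' - b' * int (q ^ 2) = 1" and q: "even q" "q > 0"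
    and dvd: "48 dvd a - a'" "48 dvd b - b'" "48 dvd d - d'" "int N dvd d - d'"
  shows "chi' (lift a b (int (q ^ 2)) d) = chi' (lift a' b' (int (q ^ 2)) d')"
proof -
  interpret theta_eta chi_theta chi_eta using assms(2,3) by unfold_locales
  obtain t where "d - d' = int N * t" using dvd(4) by blast
  then have "d = d' + int N * t" by simp
  then have chi: "chi d = chi d'" using dirichlet_character_periodic [OF assms(1)] by simp
  have "4 dvd a - a'" using dvd(1) by (rule dvd_trans [rotated]) simp
  then have th: "chi_theta (lift a b (int (q ^ 2)) d) = chi_theta (lift a' b' (int (q ^ 2)) d')"
    by (rule theta_character_lift_eq [OF theta det q q])
  have "chi_eta (lift a b (int (q ^ 2)) d) = chi_eta (lift a' b' (int (q ^ 2)) d')"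
    by (rule eta_character_lift_eq [OF det q dvd(1-3)])
  with th chi assms(4) show ?thesis by (elim disjE conjE) (simp_all only: character_of_dirichlet_lift)
qed

lemma laurent_eval_cyclotomic_mult_0:
  assumes R: "subring_set R" and "laurent_dvd R (cyclotomic l) P"
  shows "laurent_eval P 0 \<in> (\<lambda>x. of_nat l * x) ` R"
proof -
  obtain S where S: "range (coef S) \<subseteq> R" "P = cyclotomic l * S"
    using assms(2) by (auto simp: laurent_dvd_def)
  have "laurent_eval S 0 \<in> R"
    unfolding laurent_eval_def by (rule subring_set_sum [OF R]) (use S in auto)
  moreover have "laurent_eval P 0 = of_nat l * laurent_eval S 0"
    by (simp add: S laurent_eval_cyclotomic)
  ultimately show ?thesis by blast
qed

lemma of_int_div_in_Ints_rat_iff: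
  assumes "q > 0"
  shows "(of_int k / of_nat q :: rat) \<in> \<int> \<longleftrightarrow> int q dvd k"
  using of_int_div_of_nat_in_Ints_iff [OF assms, of k] of_rat_in_Ints_iff [of "of_int k / of_nat q"]
  by (simp add: of_rat_divide)

theorem mainTheorem1:
  fixes N M l :: nat and \<beta> :: rat
    and chi :: "int \<Rightarrow> complex" and chi_theta chi_eta chi' :: "mp \<Rightarrow> complex"
    and K L :: "complex set"
    and f :: "complex \<Rightarrow> complex" and k_f :: real and \<Gamma>_f :: "mp set" and chi_f :: "mp \<Rightarrow> complex"
    and \<phi> :: "complex \<times> complex \<Rightarrow> complex" and k :: real and m :: complex
  assumes "number_field K" and "Factorial_Ring.prime l" and "prime_above K L l"
    and "N > 0" and "M > 0"
    and "dirichlet_character N chi"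
    and "theta_character chi_theta" and "eta_character chi_eta"
    and "(4 dvd N \<and> chi' = (\<lambda>g. character_of_dirichlet chi g * chi_theta g)) \<or>
         chi' = (\<lambda>g. character_of_dirichlet chi g * chi_eta g)"
    and "weakly_holomorphic_modular_form k_f \<Gamma>_f chi_f f"
    and "weakly_holomorphic_jacobi_form k m (Gamma0 N) (\<lambda>(g, h). chi' g) \<phi>"
    and "singularities_at_torsion 1 \<phi>"
    and "meets_exponents \<beta> f"
    and "ramanujan_congruence K L l M \<beta> f" and "explains K L l M \<beta> \<phi> f"
  shows "\<forall>u::int. coprime (int M) u \<longrightarrow> explainable_congruence K L l M (of_int u ^ 2 * \<beta>) f"
proof (intro allI impI)
  fix u :: int
  assume u: "coprime (int M) u"
  note jacobi = assms(11) and explains = assms(15)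
  define R where "R = localization K L"
  have R: "subring_set R" unfolding R_def using assms(1,3) by (rule subring_set_localization)
  have l: "l > 0" using assms(2) by (simp add: prime_gt_0_nat)
  obtain c ct where fou: "has_jacobi_fourier_expansion \<phi> c" and lead: "leading_coefficients \<phi> c ct"
    and c: "\<And>n r. c n r \<in> R" and dvd: "\<And>n. n \<in> progression M \<beta> \<Longrightarrow> laurent_dvd R (cyclotomic l) (ct n)"
    using explains unfolding explains_def R_def by blast
  obtain \<nu> where ord: "has_order_at_zero \<phi> (- \<nu>)"
    and ct: "\<And>n z. z \<in> uhp \<Longrightarrow> laurent_eval (ct n) z = pole_factor \<nu> z * (\<Sum>\<^sub>\<infinity>r. c n r * e (of_rat r * z))"
    using lead unfolding leading_coefficients_def by blast
  have spec: "specializes_to \<phi> f" using explains by (simp add: explains_def)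
  \<comment> \<open>The order provided by \<open>specializes_to\<close> is not yet known to be the
    chosen \<open>\<nu>\<close>.\<close>
  have f: "((\<lambda>z. pole_factor \<nu> z * \<phi> (\<tau>, z)) \<longlongrightarrow> f \<tau>) (at 0)" if "\<tau> \<in> uhp" for \<tau>
  proof -
    obtain \<mu> where \<mu>: "has_order_at_zero \<phi> (- \<mu>)" "\<forall>\<tau>\<in>uhp. ((\<lambda>z. pole_factor \<mu> z * \<phi> (\<tau>, z)) \<longlongrightarrow> f \<tau>) (at 0)"
      using spec unfolding specializes_to_def by blast
    then show ?thesis using order_at_zero_unique [OF \<mu>(1) ord] that by simp
  qed
  interpret jacobi_form N k m chi' \<phi>
    using jacobi assms(12) order_at_zero_nonzero [OF ord] by unfold_locales
  \<comment> \<open>The exponents of the special values of \<open>\<phi>\<close> lie in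
    \<open>s\<close> plus the integers, and \<open>D\<close> is the denominator of
    \<open>s\<close>.\<close>
  obtain s :: rat and D :: nat where sD: "(s = 0 \<and> D = 1) \<or> (s = 1 / 24 \<and> D = 24)" and T: "chi' (translation 1) = e (of_rat s)"
    using character_translation [OF assms(6-9)] by blast
  have "of_nat D * s = 0 \<or> of_nat D * s = 1" using sD by auto
  then have Ds: "of_nat D * s \<in> \<int>" by auto
  have nonint: "(of_int j / of_nat l :: rat) \<notin> \<int>" if "\<not> int l dvd j" for j
    using that by (simp only: of_int_div_in_Ints_rat_iff [OF l] not_False_eq_True)
  have "\<exists>b. \<not> int l dvd j \<longrightarrow> has_fourier_expansion (\<lambda>\<tau>. \<phi> (\<tau>, of_int j / of_nat l)) b" for j
    using special_value_expansion [OF nonint [of j] T] by (auto simp: of_rat_divide)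
  then obtain B where B: "\<And>j. \<not> int l dvd j \<Longrightarrow> has_fourier_expansion (\<lambda>\<tau>. \<phi> (\<tau>, of_int j / of_nat l)) (B j)"
    by metis
  have ct_B: "laurent_eval (ct n) (of_int j / of_nat l) = pole_factor \<nu> (of_int j / of_nat l) * B j n" if j: "\<not> int l dvd j" for j n
    using coefficient_at_special_value [OF fou ct T nonint [OF j], of "B j" n] B [OF j] by (simp add: of_rat_divide)
  have pole: "pole_factor \<nu> (of_int j / of_nat l) \<noteq> 0" if j: "\<not> int l dvd j" for j
    using that by (intro pole_factor_nonzero) (simp only: of_int_div_of_nat_in_Ints_iff [OF l] not_False_eq_True)
  have vanish: "B j n = 0" if j: "\<not> int l dvd j" and n: "n \<in> progression M \<beta>" for j n
  proof -
    obtain S where "ct n = cyclotomic l * S" using dvd [OF n] by (auto simp: laurent_dvd_def)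
    then have "laurent_eval (ct n) (of_int j / of_nat l) = 0" using laurent_eval_cyclotomic_root [OF l j] by simp
    then show ?thesis using ct_B [OF j] pole [OF j] by simp
  qed
  have f_coeff: "laurent_eval (ct n) 0 = b n" if "has_fourier_expansion f b" for b n
    by (rule coefficient_of_specialization [OF fou ct T f that])
  \<comment> \<open>\<open>f\<close> inherits the behaviour of \<open>\<phi>\<close> under
    translation, so its exponents are congruent to \<open>s\<close> modulo 1; one of them is
    congruent to \<beta>.\<close>
  have \<beta>: "\<beta> - s \<in> \<int>"
  proof -
    obtain b n where b: "has_fourier_expansion f b" "b n \<noteq> 0" "n - \<beta> \<in> \<int>"
      using assms(13) unfolding meets_exponents_def by blast
    have "f (\<tau> + 1) = e (of_rat s) * f \<tau>" if \<tau>: "\<tau> \<in> uhp" for \<tau>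
    proof (rule tendsto_unique [OF _ f])
      show "\<tau> + 1 \<in> uhp" using \<tau> by (simp add: uhp_def)
      have "((\<lambda>z. e (of_rat s) * (pole_factor \<nu> z * \<phi> (\<tau>, z))) \<longlongrightarrow> e (of_rat s) * f \<tau>) (at 0)"
        by (intro tendsto_intros f \<tau>)
      then show "((\<lambda>z. pole_factor \<nu> z * \<phi> (\<tau> + 1, z)) \<longlongrightarrow> e (of_rat s) * f \<tau>) (at 0)"
        using add_int_fst [OF \<tau>, of 1] T by (simp add: mult.left_commute)
    qed simp
    from fourier_exponents [OF b(1) this b(2)] have "(n - s) - (n - \<beta>) \<in> \<int>" using b(3) by (rule Ints_diff)
    then show ?thesis by simp
  qed
  have new: "B j n = 0" if j: "\<not> int l dvd j" and n: "n \<in> progression M (of_int u ^ 2 * \<beta>)" for j n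
  proof (cases "n - s \<in> \<int>")
    case False
    have "B j n = 0 \<or> n - s \<in> \<int>"
      using fourier_exponents [OF B [OF j], of s n] add_int_fst [of _ 1] T by auto
    then show ?thesis using False by simp
  next
    case True
    obtain t0 where t0: "n = of_int (int M * t0) + of_int u ^ 2 * \<beta>" using n by (auto simp: progression_def)
    have "coprime u (int (D * M))"
    proof -
      have "coprime u (int D)"
      proof (cases "D = 1")
        case False
        then have "D = 24" "s = 1 / 24" using sD by auto
        \<comment> \<open>Both \<open>n\<close> and \<beta> are congruent to
          \<open>s = 1 / 24\<close> modulo 1, which forces \<open>u ^ 2 = 1\<close> modulo
          24.\<close>
        have "(n - s) - of_int (int M * t0) - of_int (u ^ 2) * (\<beta> - s) \<in> \<int>"
          by (rule Ints_diff [OF Ints_diff [OF True Ints_of_int] Ints_mult [OF Ints_of_int \<beta>]])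
        moreover have "(n - s) - of_int (int M * t0) - of_int (u ^ 2) * (\<beta> - s) = of_int (u ^ 2 - 1) / of_nat 24"
          unfolding t0 \<open>s = 1 / 24\<close> by (simp add: algebra_simps diff_divide_distrib)
        ultimately have "int 24 dvd u ^ 2 - 1"
          using of_int_div_in_Ints_rat_iff [of 24 "u ^ 2 - 1"] by (simp only: zero_less_numeral)
        then obtain v where v: "u ^ 2 - 1 = 24 * v" by auto
        have "coprime u 24"
        proof (rule coprimeI)
          fix x assume x: "x dvd u" "x dvd 24"
          then have "x dvd u ^ 2 - 24 * v" by (simp add: power2_eq_square)
          moreover have "u ^ 2 - 24 * v = 1" using v by simp
          ultimately show "is_unit x" by simp
        qed
        then show ?thesis using \<open>D = 24\<close> by simp
      qed simp
      then show ?thesis using u by (simp add: coprime_commute)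
    qed
    \<comment> \<open>48 serves the phase, \<open>N\<close> the group and the Dirichlet character,
      \<open>l\<close> the elliptic variable, and \<open>M\<close> the conjugation by the
      translation by \<open>h / M\<close>.\<close>
    define q where "q = 48 * N * M * l"
    have q: "q > 0" "even q" using assms(4,5) l by (simp_all add: q_def)
    \<comment> \<open>A multiple of \<open>D * M\<close> is added to \<open>u\<close> to make it
      prime to \<open>q\<close>, hence the upper left entry of a matrix of determinant 1.\<close>
    obtain x where x: "coprime (u + int (D * M) * x) (int q)"
      using coprime_in_progression [OF \<open>coprime u (int (D * M))\<close>, of "int q"] q by auto
    define a where "a = u + int (D * M) * x"
    have "coprime a (int (q ^ 2))" using x by (simp add: a_def)
    then obtain d b0 where "d * a + b0 * int (q ^ 2) = 1"
      using bezout_int [of a "int (q ^ 2)"] by (auto simp: coprime_iff_gcd_eq_1)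
    then have det: "a * d - (- b0) * int (q ^ 2) = 1" by (simp add: mult.commute)
    define b where "b = - b0"
    define c1 where "c1 = int ((48 * N * l) ^ 2)"
    have q2: "int (q ^ 2) = int M ^ 2 * c1" by (simp add: q_def c1_def power2_eq_square algebra_simps)
    have det': "a * d - b * (int M ^ 2 * c1) = 1" using det by (simp only: b_def q2)
    have "int (D * M) dvd int q"
      unfolding q_def using sD by (auto simp: mult_ac)
    then have DMq: "int (D * M) dvd int (q ^ 2)" by (simp add: power2_eq_square)
    \<comment> \<open>\<open>a * d\<close> is 1 modulo \<open>D * M\<close>, hence so is
      \<open>d * u\<close>; as \<open>D * \<beta>\<close> is an integer,
      \<open>d ^ 2 * u ^ 2 * \<beta>\<close> and \<beta> differ by a multiple of
      \<open>M\<close>.\<close>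
    obtain t where t: "of_int (d ^ 2) * n - \<beta> = of_int (int M * t)"
    proof -
      have "d * u = 1 + b * int (q ^ 2) - int (D * M) * (d * x)"
        using det by (simp add: a_def b_def algebra_simps)
      then have "int (D * M) dvd d * u - 1" using DMq by simp
      then have "int (D * M) dvd (d * u - 1) * (d * u + 1)" by (rule dvd_mult2)
      also have "(d * u - 1) * (d * u + 1) = d ^ 2 * u ^ 2 - 1" by (simp add: algebra_simps power2_eq_square)
      finally obtain y where y: "d ^ 2 * u ^ 2 - 1 = int (D * M) * y" by blast
      have "of_nat D * (\<beta> - s) + of_nat D * s \<in> \<int>" by (rule Ints_add [OF Ints_mult [OF Ints_of_nat \<beta>] Ds])
      then have "of_nat D * \<beta> \<in> \<int>" by (simp add: algebra_simps)
      then obtain i where i: "of_nat D * \<beta> = of_int i" by (auto elim: Ints_cases)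
      have "of_int (d ^ 2) * n - \<beta> = of_int (d ^ 2 * (int M * t0)) + of_int (d ^ 2 * u ^ 2 - 1) * \<beta>"
        unfolding t0 by (simp add: algebra_simps)
      also have "\<dots> = of_int (d ^ 2 * (int M * t0)) + of_int (int M * y) * (of_nat D * \<beta>)"
        unfolding y by (simp add: algebra_simps)
      also have "\<dots> = of_int (int M * (d ^ 2 * t0 + y * i))"
        unfolding i by (simp add: algebra_simps)
      finally show ?thesis by (rule that)
    qed
    show ?thesis
    proof (rule vanishing_transfer [OF T l assms(5) _ _ _ \<beta> det' _ B vanish j t])
      show "c1 \<noteq> 0" using assms(4) l by (simp add: c1_def)
      show "int N dvd c1" "int (l ^ 2) dvd c1" by (simp_all add: c1_def power2_eq_square mult_ac)
      have "48 dvd c1" by (simp add: c1_def power2_eq_square mult_ac)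
      fix h
      show "chi' (lift (a + h * int M * c1) (b - h * d * b * int M * c1 - h ^ 2 * d ^ 2 * c1) (int M ^ 2 * c1) (d - int M * c1 * d ^ 2 * h))
         = chi' (lift a b (int M ^ 2 * c1) d)"
      proof (rule character_lift_cong [OF assms(6-9), of _ _ _ q, unfolded q2])
        \<comment> \<open>Only the determinant is wanted here; \<open>\<i>\<close> is an arbitrary
          point of the upper half plane.\<close>
        show "(a + h * int M * c1) * (d - int M * c1 * d ^ 2 * h) - (b - h * d * b * int M * c1 - h ^ 2 * d ^ 2 * c1) * (int M ^ 2 * c1) = 1"
          by (rule conjugate_by_translation [OF det', of \<i>]) (use assms(5) in \<open>simp_all add: uhp_def\<close>)
        show "48 dvd a + h * int M * c1 - a" "48 dvd b - h * d * b * int M * c1 - h ^ 2 * d ^ 2 * c1 - b" "48 dvd d - int M * c1 * d ^ 2 * h - d"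
          using \<open>48 dvd c1\<close> by simp_all
        show "int N dvd d - int M * c1 * d ^ 2 * h - d" using \<open>int N dvd c1\<close> by simp
      qed (use q det' in auto)
    qed
  qed
  have dvd_new: "laurent_dvd R (cyclotomic l) (ct n)" if n: "n \<in> progression M (of_int u ^ 2 * \<beta>)" for n
  proof (rule laurent_dvd_cyclotomicI [OF R l])
    show "range (coef (ct n)) \<subseteq> R"
      by (rule leading_coefficient_integral [OF R jacobi_fourier_coefficient [OF fou] _ ct]) (use c in auto)
    show "laurent_eval (ct n) (of_int j / of_nat l) = 0" if "\<not> int l dvd j" for j
      using ct_B [OF that, of n] new [OF that n] by simp
  qed
  have "ramanujan_congruence K L l M (of_int u ^ 2 * \<beta>) f"
  proof -
    obtain b where b: "has_fourier_expansion f b" "range b \<subseteq> K"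
      using assms(14) unfolding ramanujan_congruence_def by blast
    have "b n \<in> (\<lambda>x. of_nat l * x) ` localization K L" if "n \<in> progression M (of_int u ^ 2 * \<beta>)" for n
      using laurent_eval_cyclotomic_mult_0 [OF R dvd_new [OF that]] f_coeff [OF b(1), of n] by (simp add: R_def)
    then show ?thesis unfolding ramanujan_congruence_def using b by blast
  qed
  moreover have "explains K L l M (of_int u ^ 2 * \<beta>) \<phi> f"
    unfolding explains_def using assms(12) spec fou lead c dvd_new unfolding R_def by blast
  ultimately show "explainable_congruence K L l M (of_int u ^ 2 * \<beta>) f"
    unfolding explainable_congruence_def using jacobi by blast
qed

end
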